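(* Let $G=\mathbb{Z}$ or $G=\mathbb{Z}/m\mathbb{Z}$ for some integer $m\ge2$, let $N\ge 1$, $1<p<\infty$, and let $\alpha=(\alpha_1,\dots,\alpha_N)\in\mathbb{R}^N$. Then the operator $R_\alpha^2=\sum_{i=1}^N\alpha_iR_i^2: L^p(G^N,\mathbb{R})\to L^p(G^N,\mathbb{R})$ enjoys the sharp operator norm estimate $$\|R_\alpha^2\|\le \mathfrak{C}_{\min_i\alpha_i,\ \max_i\alpha_i,\ p},$$ where $\mathfrak{C}_{b,B,p}$ denotes the Choi constant. Here sharp means that when $G=\mathbb{Z}$ the constant on the right cannot be replaced by a smaller one.
   Context: $L^p(G^N,\mathbb{R})$ is the space of real valued $p$-summable functions on $G^N$ with counting measure, and $\|R_\alpha^2\|$ is the operator norm on it. Let $e$ be the generator $1$ of $G$ and $e_i$ the element of $G^N$ with $e$ in the $i$-th coordinate and $0$ elsewhere. Discrete derivatives: $\partial_+^i f(n)=f(n+e_i)-f(n)$, $\partial_-^i f(n)=f(n)-f(n-e_i)$. Discrete Laplacian: $\Delta=\sum_{i=1}^N\partial_+^i\partial_-^i$. The discrete Riesz transforms are defined by $R_\pm^i\circ\sqrt{-\Delta}=\partial_\pm^i$, and they map constants to $0$. The second order Riesz transforms are $R_i^2:=R_+^iR_-^i$. Equivalently, $R_j^2$ is the Fourier multiplier operator with symbol $$\frac{-4\sin^2(\pi\xi_j)}{4\sum_i\sin^2(\pi\xi_i)},\quad \xi\in[-\tfrac12,\tfrac12]^N\quad(G=\mathbb{Z}),\qquad \frac{-4\sin^2(\frac{\pi}{m}\xi_j)}{4\sum_i\sin^2(\frac{\pi}{m}\xi_i)},\quad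 \xi\in(\mathbb{Z}/m\mathbb{Z})^N\quad(G=\mathbb{Z}/m\mathbb{Z}),$$ with value $0$ at $\xi=0$, where $\hat f(\xi)=\sum_{n}f(n)e^{-2\pi i n\cdot\xi}$, respectively $\hat f(\xi)=\sum_n f(n)e^{-\frac{2\pi i}{m}n\cdot\xi}$. For $G=\mathbb{Z}$ the operator is defined on finitely supported functions and extended to $L^p$ by density and continuity. Choi constants: for real $b\le B$ and $1<p<\infty$, $\mathfrak{C}_{b,B,p}$ is the smallest constant $C$ such that $$\Big\|\sum_{k=1}^n\theta_kd_k\Big\|_p\le C\Big\|\sum_{k=1}^nd_k\Big\|_p$$ for every $n\ge 1$, every probability space with filtration $(\mathcal{F}_k)_{k\ge0}$, every real valued martingale difference sequence $(d_k)_{k\ge1}$ in $L^p$ adapted to it, and every predictable sequence $(\theta_k)_{k\ge1}$ ($\theta_k$ is $\mathcal{F}_{k-1}$-measurable) with values in $\{b,B\}$.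
   Formalization: For G=Z/mZ the bound on all of L^p fails in general (α=(1,1), m=N=2, p=3/2, f a point mass); it is proved there on mean zero functions for every α, and on all of L^p(G^N) when min α_i ≤ 0 ≤ max α_i. For G=Z the statement is proved as given, with sharpness. *)

theory Defs
  imports "HOL-Probability.Probability" "Berlekamp_Zassenhaus.Finite_Field"
begin

definition Lp :: "real \<Rightarrow> 'a measure \<Rightarrow> ('a \<Rightarrow> real) set" where
  "Lp p M = {f \<in> borel_measurable M. integrable M (\<lambda>x. \<bar>f x\<bar> powr p)}"

definition Lp_norm :: "real \<Rightarrow> 'a measure \<Rightarrow> ('a \<Rightarrow> real) \<Rightarrow> real" where
  "Lp_norm p M f = (\<integral>x. \<bar>f x\<bar> powr p \<partial>M) powr (1 / p)"

abbreviation lp :: "real \<Rightarrow> ('a \<Rightarrow> real) set" where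
  "lp p \<equiv> Lp p (count_space UNIV)"

abbreviation lp_norm :: "real \<Rightarrow> ('a \<Rightarrow> real) \<Rightarrow> real" where
  "lp_norm p \<equiv> Lp_norm p (count_space UNIV)"

definition lp_mean_zero :: "real \<Rightarrow> ('a::finite \<Rightarrow> real) set" where
  "lp_mean_zero p = {f \<in> lp p. (\<Sum>x\<in>UNIV. f x) = 0}"

definition lp_bounded_linear ::
    "('a \<Rightarrow> real) set \<Rightarrow> real \<Rightarrow> (('a \<Rightarrow> real) \<Rightarrow> 'a \<Rightarrow> real) \<Rightarrow> bool" where
  "lp_bounded_linear V p T \<longleftrightarrow>
     (\<forall>f\<in>V. T f \<in> V) \<and>
     (\<forall>f\<in>V. \<forall>g\<in>V. \<forall>a c. T (\<lambda>x. a * f x + c * g x) = (\<lambda>x. a * T f x + c * T g x)) \<and>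
     (\<exists>K. \<forall>f\<in>V. lp_norm p (T f) \<le> K * lp_norm p f)"

text \<open>As in \<^const>\<open>onorm\<close>, the quotient is \<open>0\<close> for \<open>f = 0\<close>; the supremum is the operator norm
  only for operators satisfying \<^const>\<open>lp_bounded_linear\<close>.\<close>

definition lp_onorm ::
    "('a \<Rightarrow> real) set \<Rightarrow> real \<Rightarrow> (('a \<Rightarrow> real) \<Rightarrow> 'a \<Rightarrow> real) \<Rightarrow> real" where
  "lp_onorm V p T = (SUP f\<in>V. lp_norm p (T f) / lp_norm p f)"

definition finsupp :: "('a \<Rightarrow> real) \<Rightarrow> bool" where
  "finsupp f \<longleftrightarrow> finite {x. f x \<noteq> 0}"

definition lp_extension ::
    "real \<Rightarrow> (('a \<Rightarrow> real) \<Rightarrow> 'a \<Rightarrow> real) \<Rightarrow> ('a \<Rightarrow> real) \<Rightarrow> 'a \<Rightarrow> real" where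
  "lp_extension p T f =
     (THE g. g \<in> lp p \<and>
        (\<forall>h. (\<forall>k::nat. finsupp (h k)) \<and> (\<lambda>k. lp_norm p (\<lambda>x. h k x - f x)) \<longlonglongrightarrow> 0 \<longrightarrow>
             (\<lambda>k. lp_norm p (\<lambda>x. T (h k) x - g x)) \<longlonglongrightarrow> 0))"

text \<open>In both symbols below, the value at \<open>\<xi> = 0\<close> is \<open>0\<close> because \<open>x / 0 = 0\<close>.  Symbols are real
  and even, so the multiplier operators preserve real functions and taking the real part
  only changes the type.\<close>

definition char_int :: "int ^ 'n::finite \<Rightarrow> real ^ 'n \<Rightarrow> complex" where
  "char_int n \<xi> = cis (2 * pi * (\<Sum>i\<in>UNIV. of_int (n $ i) * \<xi> $ i))"

definition fourier_int :: "(int ^ 'n::finite \<Rightarrow> real) \<Rightarrow> real ^ 'n \<Rightarrow> complex" where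
  "fourier_int f \<xi> = (\<Sum>n | f n \<noteq> 0. of_real (f n) * cnj (char_int n \<xi>))"

abbreviation cube :: "(real ^ 'n::finite) set" where
  "cube \<equiv> cbox (\<chi> i. - 1 / 2) (\<chi> i. 1 / 2)"

definition symbol_int :: "'n::finite \<Rightarrow> real ^ 'n \<Rightarrow> real" where
  "symbol_int j \<xi> = - 4 * (sin (pi * \<xi> $ j))\<^sup>2 / (4 * (\<Sum>i\<in>UNIV. (sin (pi * \<xi> $ i))\<^sup>2))"

definition riesz2_int :: "'n::finite \<Rightarrow> (int ^ 'n \<Rightarrow> real) \<Rightarrow> int ^ 'n \<Rightarrow> real" where
  "riesz2_int j f n =
     Re (LINT \<xi> : cube | lborel. of_real (symbol_int j \<xi>) * fourier_int f \<xi> * char_int n \<xi>)"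

definition riesz_int :: "real \<Rightarrow> real ^ 'n::finite \<Rightarrow> (int ^ 'n \<Rightarrow> real) \<Rightarrow> int ^ 'n \<Rightarrow> real" where
  "riesz_int p \<alpha> = lp_extension p (\<lambda>f n. \<Sum>i\<in>UNIV. \<alpha> $ i * riesz2_int i f n)"

definition char_cyclic :: "'m::nontriv mod_ring ^ 'n::finite \<Rightarrow> 'm mod_ring ^ 'n \<Rightarrow> complex" where
  "char_cyclic n \<xi> =
     cis (2 * pi / real CARD('m) *
       (\<Sum>i\<in>UNIV. of_int (to_int_mod_ring (n $ i)) * of_int (to_int_mod_ring (\<xi> $ i))))"

definition fourier_cyclic ::
    "('m::nontriv mod_ring ^ 'n::finite \<Rightarrow> real) \<Rightarrow> 'm mod_ring ^ 'n \<Rightarrow> complex" where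
  "fourier_cyclic f \<xi> = (\<Sum>n\<in>UNIV. of_real (f n) * cnj (char_cyclic n \<xi>))"

definition symbol_cyclic :: "'n::finite \<Rightarrow> 'm::nontriv mod_ring ^ 'n \<Rightarrow> real" where
  "symbol_cyclic j \<xi> =
     - 4 * (sin (pi / real CARD('m) * of_int (to_int_mod_ring (\<xi> $ j))))\<^sup>2 /
     (4 * (\<Sum>i\<in>UNIV. (sin (pi / real CARD('m) * of_int (to_int_mod_ring (\<xi> $ i))))\<^sup>2))"

definition riesz2_cyclic ::
    "'n::finite \<Rightarrow> ('m::nontriv mod_ring ^ 'n \<Rightarrow> real) \<Rightarrow> 'm mod_ring ^ 'n \<Rightarrow> real" where
  "riesz2_cyclic j f n =
     Re ((\<Sum>\<xi>\<in>UNIV. of_real (symbol_cyclic j \<xi>) * fourier_cyclic f \<xi> * char_cyclic n \<xi>) /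
         of_nat (CARD('m) ^ CARD('n)))"

definition riesz_cyclic ::
    "real ^ 'n::finite \<Rightarrow> ('m::nontriv mod_ring ^ 'n \<Rightarrow> real) \<Rightarrow> 'm mod_ring ^ 'n \<Rightarrow> real" where
  "riesz_cyclic \<alpha> f n = (\<Sum>i\<in>UNIV. \<alpha> $ i * riesz2_cyclic i f n)"

text \<open>Martingale difference sequence \<open>d\<close> and predictable sequence \<open>\<theta>\<close>; the indices of
  \<open>d\<close> and \<open>\<theta>\<close> start at \<open>1\<close>, those of the filtration at \<open>0\<close>.\<close>

definition martingale_transform ::
    "'a measure \<Rightarrow> (nat \<Rightarrow> 'a measure) \<Rightarrow> (nat \<Rightarrow> 'a \<Rightarrow> real) \<Rightarrow> (nat \<Rightarrow> 'a \<Rightarrow> real) \<Rightarrow>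
     real \<Rightarrow> real \<Rightarrow> real \<Rightarrow> bool" where
  "martingale_transform M F d \<theta> b B p \<longleftrightarrow>
     prob_space M \<and> filtration (space M) F \<and> (\<forall>k. subalgebra M (F k)) \<and>
     (\<forall>k\<ge>1. d k \<in> borel_measurable (F k) \<and> d k \<in> Lp p M \<and>
            (AE \<omega> in M. real_cond_exp M (F (k - 1)) (d k) \<omega> = 0) \<and>
            \<theta> k \<in> borel_measurable (F (k - 1)) \<and> (\<forall>\<omega>\<in>space M. \<theta> k \<omega> \<in> {b, B}))"

definition choi_bound :: "'a itself \<Rightarrow> real \<Rightarrow> real \<Rightarrow> real \<Rightarrow> real \<Rightarrow> bool" where
  "choi_bound _ b B p C \<longleftrightarrow>
     (\<forall>n\<ge>1. \<forall>(M :: 'a measure) F d \<theta>. martingale_transform M F d \<theta> b B p \<longrightarrow>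
        Lp_norm p M (\<lambda>\<omega>. \<Sum>k=1..n. \<theta> k \<omega> * d k \<omega>) \<le> C * Lp_norm p M (\<lambda>\<omega>. \<Sum>k=1..n. d k \<omega>))"

text \<open>A definition cannot quantify over all sample spaces of all types.  Sample spaces carried by
  \<^typ>\<open>nat \<Rightarrow> real\<close> suffice, see \<open>choi_bound_transfer\<close> below.\<close>

definition choi_const :: "real \<Rightarrow> real \<Rightarrow> real \<Rightarrow> real" where
  "choi_const b B p = Inf {C. choi_bound TYPE(nat \<Rightarrow> real) b B p C}"

lemma integrable_of_Lp:
  assumes "prob_space M" "1 < p" "f \<in> Lp p M"
  shows "integrable M (f :: 'a \<Rightarrow> real)"
proof -
  interpret prob_space M by fact
  have f: "f \<in> borel_measurable M" "integrable M (\<lambda>x. \<bar>f x\<bar> powr p)"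
    using assms by (auto simp: Lp_def)
  show ?thesis
  proof (rule Bochner_Integration.integrable_bound)
    show "integrable M (\<lambda>x. 1 + \<bar>f x\<bar> powr p)" using f by auto
    show "AE x in M. norm (f x) \<le> norm (1 + \<bar>f x\<bar> powr p)"
    proof (rule AE_I2)
      fix x
      have "\<bar>f x\<bar> \<le> 1 + \<bar>f x\<bar> powr p"
      proof (cases "\<bar>f x\<bar> \<le> 1")
        case True
        thus ?thesis using powr_ge_zero[of "\<bar>f x\<bar>" p] by linarith
      next
        case False
        hence "\<bar>f x\<bar> powr 1 \<le> \<bar>f x\<bar> powr p" using assms by (intro powr_mono) auto
        thus ?thesis using False by simp
      qed
      thus "norm (f x) \<le> norm (1 + \<bar>f x\<bar> powr p)" by simp
    qed
  qed (use f in auto)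
qed

lemma choi_bound_transfer:
  assumes "1 < p" and C: "choi_bound TYPE(nat \<Rightarrow> real) b B p C"
  shows "choi_bound TYPE('a) b B p C"
  unfolding choi_bound_def
proof (intro allI impI)
  fix n :: nat and M :: "'a measure" and F d \<theta>
  assume n: "n \<ge> 1" and mt: "martingale_transform M F d \<theta> b B p"
  from mt interpret prob_space M by (simp add: martingale_transform_def)
  from mt interpret filtration "space M" F by (simp add: martingale_transform_def)
  from mt have subalg: "subalgebra M (F k)" for k by (simp add: martingale_transform_def)
  from mt have d: "d k \<in> borel_measurable (F k)" "d k \<in> Lp p M"
      "AE \<omega> in M. real_cond_exp M (F (k - 1)) (d k) \<omega> = 0"
      "\<theta> k \<in> borel_measurable (F (k - 1))" "\<And>\<omega>. \<omega> \<in> space M \<Longrightarrow> \<theta> k \<omega> \<in> {b, B}" if "k \<ge> 1" for k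
    using that by (auto simp: martingale_transform_def)
  have mono: "f \<in> borel_measurable (F i) \<Longrightarrow> i \<le> j \<Longrightarrow> f \<in> borel_measurable (F j)" for f :: "'a \<Rightarrow> real" and i j
    using sets_F_mono[of i j] space_F by (auto simp: measurable_def)
  have toM: "f \<in> borel_measurable (F i) \<Longrightarrow> f \<in> borel_measurable M" for f :: "'a \<Rightarrow> real" and i
    using subalg measurable_from_subalg by blast
  define Y :: "'a \<Rightarrow> nat \<Rightarrow> real" where
    "Y \<omega> i = (if i < 2 then 0 else if even i then d (i div 2) \<omega> else \<theta> (i div 2) \<omega>)" for \<omega> i
  define P :: "(nat \<Rightarrow> real) measure" where "P = (\<Pi>\<^sub>M i\<in>UNIV. borel)"
  define Z :: "nat \<Rightarrow> (nat \<Rightarrow> real) \<Rightarrow> nat \<Rightarrow> real" where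
    "Z k x i = (if i \<le> 2 * k + 1 \<or> i = 2 * k + 3 then x i else 0)" for k x i
  define G where "G k = vimage_algebra UNIV (Z k) P" for k
  have spP [simp]: "space P = UNIV" by (simp add: P_def space_PiM)
  have coord: "(\<lambda>x. x i) \<in> borel_measurable P" for i by (simp add: P_def)
  have intoP: "f \<in> measurable N P" if "\<And>i. (\<lambda>x. f x i) \<in> borel_measurable N" for f :: "'c \<Rightarrow> nat \<Rightarrow> real" and N
    unfolding P_def using that by (intro measurable_PiM_single') (auto simp: space_PiM)
  have spG [simp]: "space (G k) = UNIV" for k by (simp add: G_def)
  have ZG: "Z k \<in> measurable (G k) P" for k unfolding G_def by (rule measurable_vimage_algebra1) auto
  have coordG: "(\<lambda>x. x i) \<in> borel_measurable (G k)" if "i \<le> 2 * k + 1 \<or> i = 2 * k + 3" for i k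
  proof -
    have "(\<lambda>x. Z k x i) \<in> borel_measurable (G k)"
      using measurable_compose[OF ZG coord[of i]] .
    thus ?thesis using that by (simp add: Z_def)
  qed
  have inG: "\<exists>A'\<in>sets P. A = Z k -` A'" if "A \<in> sets (G k)" for A k
    using that unfolding G_def by (subst (asm) sets_vimage_algebra2) auto
  have G_into: "sets (G k) \<subseteq> sets N" if N: "space N = UNIV"
    "\<And>i. i \<le> 2 * k + 1 \<or> i = 2 * k + 3 \<Longrightarrow> (\<lambda>x. x i) \<in> borel_measurable N" for k and N :: "(nat \<Rightarrow> real) measure"
  proof
    fix A assume "A \<in> sets (G k)"
    then obtain A' where A': "A' \<in> sets P" "A = Z k -` A'" using inG by blast
    have "Z k \<in> measurable N P"
    proof (rule intoP)
      fix i
      show "(\<lambda>x. Z k x i) \<in> borel_measurable N"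
        using N(2)[of i] by (cases "i \<le> 2 * k + 1 \<or> i = 2 * k + 3") (auto simp: Z_def)
    qed
    from measurable_sets[OF this A'(1)] show "A \<in> sets N" using A'(2) N(1) by simp
  qed
  have YF: "(\<lambda>\<omega>. Y \<omega> i) \<in> borel_measurable (F k)" if i: "i \<le> 2 * k + 1 \<or> i = 2 * k + 3" for i k
  proof (cases "i < 2")
    case True
    thus ?thesis by (simp add: Y_def)
  next
    case i2: False
    show ?thesis
    proof (cases "even i")
      case True
      then obtain j where j: "i = 2 * j" by blast
      have "i \<noteq> 2 * k + 3" using True by auto
      hence "1 \<le> j" "j \<le> k" using i i2 j by auto
      hence "d j \<in> borel_measurable (F k)" by (intro mono[OF d(1)])
      thus ?thesis using j i2 by (simp add: Y_def)
    next
      case False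
      then obtain j where j: "i = 2 * j + 1" using oddE by blast
      hence "1 \<le> j" "j - 1 \<le> k" using i i2 by auto
      hence "\<theta> j \<in> borel_measurable (F k)" by (intro mono[OF d(4)])
      thus ?thesis using j i2 by (simp add: Y_def)
    qed
  qed
  have Y: "Y \<in> measurable M P"
  proof (rule intoP)
    fix i
    show "(\<lambda>\<omega>. Y \<omega> i) \<in> borel_measurable M" by (rule toM[OF YF[of i i]]) auto
  qed
  have Y_F: "Y -` A \<inter> space M \<in> sets (F k)" if A: "A \<in> sets (G k)" for A k
  proof -
    obtain A' where A': "A' \<in> sets P" "A = Z k -` A'" using inG[OF A] by blast
    have "(\<lambda>\<omega>. Z k (Y \<omega>)) \<in> measurable (F k) P"
    proof (rule intoP)
      fix i
      show "(\<lambda>\<omega>. Z k (Y \<omega>) i) \<in> borel_measurable (F k)"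
        using YF[of i k] by (cases "i \<le> 2 * k + 1 \<or> i = 2 * k + 3") (auto simp: Z_def)
    qed
    from measurable_sets[OF this A'(1)] show ?thesis using A'(2) space_F[of k]
      by (simp add: vimage_def)
  qed
  define N where "N = distr M P Y"
  have spN [simp]: "space N = UNIV" and setsN: "sets N = sets P" by (simp_all add: N_def)
  interpret N: prob_space N unfolding N_def by (rule prob_space_distr[OF Y])
  define d' :: "nat \<Rightarrow> (nat \<Rightarrow> real) \<Rightarrow> real" where "d' k x = x (2 * k)" for k x
  define \<theta>' :: "nat \<Rightarrow> (nat \<Rightarrow> real) \<Rightarrow> real" where
    "\<theta>' k x = (if x (2 * k + 1) = b then b else B)" for k x
  have dY: "d' k (Y \<omega>) = d k \<omega>" if "k \<ge> 1" for k \<omega> using that by (simp add: d'_def Y_def)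
  have tY: "\<theta>' k (Y \<omega>) = \<theta> k \<omega>" if "k \<ge> 1" "\<omega> \<in> space M" for k \<omega>
    using that d(5)[OF that] by (auto simp: \<theta>'_def Y_def)
  have coordN: "(\<lambda>x. x i) \<in> borel_measurable N" for i using coord[of i] setsN by (simp cong: measurable_cong_sets)
  have subN: "subalgebra N (G k)" for k
    unfolding subalgebra_def using G_into[of N k] coordN by simp
  have d'_G: "d' k \<in> borel_measurable (G k)" for k unfolding d'_def using coordG[of "2 * k" k] by simp
  have \<theta>'_G: "\<theta>' k \<in> borel_measurable (G (k - 1))" if "k \<ge> 1" for k
  proof -
    have [measurable]: "(\<lambda>x. x (2 * k + 1)) \<in> borel_measurable (G (k - 1))"
      using that by (intro coordG) auto
    show ?thesis unfolding \<theta>'_def by measurable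
  qed
  have bmP: "f \<in> borel_measurable P" if "f \<in> borel_measurable (G k)" for f :: "(nat \<Rightarrow> real) \<Rightarrow> real" and k
    using measurable_from_subalg[OF subN that] setsN by (simp cong: measurable_cong_sets)
  have d'_P: "d' k \<in> borel_measurable P" and \<theta>'_P: "k \<ge> 1 \<Longrightarrow> \<theta>' k \<in> borel_measurable P" for k
    using d'_G bmP \<theta>'_G by blast+
  have d'_Lp: "d' k \<in> Lp p N" if "k \<ge> 1" for k
  proof -
    have [measurable]: "d' k \<in> borel_measurable P" by (rule d'_P)
    have "integrable M (\<lambda>\<omega>. \<bar>d' k (Y \<omega>)\<bar> powr p)"
      using d(2)[OF that] dY[OF that] by (simp add: Lp_def)
    hence "integrable N (\<lambda>x. \<bar>d' k x\<bar> powr p)"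
      unfolding N_def by (subst integrable_distr_eq[OF Y]) auto
    thus ?thesis using d'_P setsN by (simp add: Lp_def cong: measurable_cong_sets)
  qed
  have cond: "AE x in N. real_cond_exp N (G (k - 1)) (d' k) x = 0" if k: "k \<ge> 1" for k
  proof -
    interpret NG: finite_measure_subalgebra N "G (k - 1)" by standard (rule subN)
    interpret MF: finite_measure_subalgebra M "F (k - 1)" by standard (rule subalg)
    have int_d: "integrable M (d k)"
      using integrable_of_Lp[OF _ \<open>1 < p\<close> d(2)[OF k]] by (simp add: prob_space_axioms)
    show ?thesis
    proof (rule NG.real_cond_exp_charact)
      fix A assume A: "A \<in> sets (G (k - 1))"
      hence AP: "A \<in> sets P" using subN[of "k - 1"] setsN by (auto simp: subalgebra_def)
      have [measurable]: "d' k \<in> borel_measurable P" by (rule d'_P)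
      note [measurable] = AP
      have "(\<integral>x\<in>A. d' k x \<partial>N) = (\<integral>\<omega>. indicator A (Y \<omega>) *\<^sub>R d' k (Y \<omega>) \<partial>M)"
        unfolding set_lebesgue_integral_def N_def by (subst integral_distr[OF Y]) auto
      also have "\<dots> = (\<integral>\<omega>\<in>(Y -` A \<inter> space M). d k \<omega> \<partial>M)"
        unfolding set_lebesgue_integral_def dY[OF k]
        by (intro Bochner_Integration.integral_cong refl) (auto simp: indicator_def)
      also have "\<dots> = (\<integral>\<omega>\<in>(Y -` A \<inter> space M). real_cond_exp M (F (k - 1)) (d k) \<omega> \<partial>M)"
        by (rule MF.real_cond_exp_intA[OF int_d Y_F[OF A]])
      also have "\<dots> = (\<integral>\<omega>\<in>(Y -` A \<inter> space M). 0 \<partial>M)"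
        unfolding set_lebesgue_integral_def
        by (rule integral_cong_AE) (use d(3)[OF k] Y_F[OF A] subalg[of "k - 1"] in \<open>auto simp: subalgebra_def\<close>)
      finally show "(\<integral>x\<in>A. d' k x \<partial>N) = (\<integral>x\<in>A. 0 \<partial>N)" by (simp add: set_lebesgue_integral_def)
    next
      show "integrable N (d' k)"
        using integrable_of_Lp[OF _ \<open>1 < p\<close> d'_Lp[OF k]] by (simp add: N.prob_space_axioms)
    qed auto
  qed
  have "martingale_transform N G d' \<theta>' b B p"
    unfolding martingale_transform_def
  proof (intro conjI allI impI ballI)
    show "prob_space N" by (rule N.prob_space_axioms)
    show "filtration (space N) G"
    proof
      fix i j :: nat assume "i \<le> j"
      thus "sets (G i) \<subseteq> sets (G j)" by (intro G_into) (auto intro!: coordG)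
    qed simp
    fix k :: nat and x :: "nat \<Rightarrow> real" assume "1 \<le> k"
    show "\<theta>' k x \<in> {b, B}" by (simp add: \<theta>'_def)
  qed (use subN d'_G d'_Lp cond \<theta>'_G in auto)
  hence "Lp_norm p N (\<lambda>x. \<Sum>k=1..n. \<theta>' k x * d' k x) \<le> C * Lp_norm p N (\<lambda>x. \<Sum>k=1..n. d' k x)"
    using C n unfolding choi_bound_def by blast
  moreover have "Lp_norm p N (\<lambda>x. \<Sum>k=1..n. \<theta>' k x * d' k x) = Lp_norm p M (\<lambda>\<omega>. \<Sum>k=1..n. \<theta> k \<omega> * d k \<omega>)"
  proof -
    have [measurable]: "(\<lambda>x. \<Sum>k=1..n. \<theta>' k x * d' k x) \<in> borel_measurable P"
      using d'_P \<theta>'_P by (intro borel_measurable_sum borel_measurable_times) auto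
    hence meas: "(\<lambda>x. \<bar>\<Sum>k=1..n. \<theta>' k x * d' k x\<bar> powr p) \<in> borel_measurable P" by measurable
    have "(\<integral>x. \<bar>\<Sum>k=1..n. \<theta>' k x * d' k x\<bar> powr p \<partial>N) = (\<integral>\<omega>. \<bar>\<Sum>k=1..n. \<theta>' k (Y \<omega>) * d' k (Y \<omega>)\<bar> powr p \<partial>M)"
      unfolding N_def by (rule integral_distr[OF Y meas])
    also have "\<dots> = (\<integral>\<omega>. \<bar>\<Sum>k=1..n. \<theta> k \<omega> * d k \<omega>\<bar> powr p \<partial>M)"
      by (intro Bochner_Integration.integral_cong refl) (simp add: dY tY)
    finally show ?thesis by (simp add: Lp_norm_def)
  qed
  moreover have "Lp_norm p N (\<lambda>x. \<Sum>k=1..n. d' k x) = Lp_norm p M (\<lambda>\<omega>. \<Sum>k=1..n. d k \<omega>)"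
  proof -
    have [measurable]: "(\<lambda>x. \<Sum>k=1..n. d' k x) \<in> borel_measurable P"
      using d'_P by (intro borel_measurable_sum) auto
    hence meas: "(\<lambda>x. \<bar>\<Sum>k=1..n. d' k x\<bar> powr p) \<in> borel_measurable P" by measurable
    have "(\<integral>x. \<bar>\<Sum>k=1..n. d' k x\<bar> powr p \<partial>N) = (\<integral>\<omega>. \<bar>\<Sum>k=1..n. d' k (Y \<omega>)\<bar> powr p \<partial>M)"
      unfolding N_def by (rule integral_distr[OF Y meas])
    thus ?thesis by (simp add: Lp_norm_def dY)
  qed
  ultimately show "Lp_norm p M (\<lambda>\<omega>. \<Sum>k = 1..n. \<theta> k \<omega> * d k \<omega>) \<le> C * Lp_norm p M (\<lambda>\<omega>. \<Sum>k = 1..n. d k \<omega>)"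
    by simp
qed

lemma choi_bound_nonneg:
  assumes C: "choi_bound TYPE(nat \<Rightarrow> real) b B p C"
  shows "0 \<le> C"
proof -
  define q :: "(nat \<Rightarrow> real) pmf" where "q = map_pmf (\<lambda>s i. s) (pmf_of_set {- 1, 1})"
  define M where "M = measure_pmf q"
  define F :: "nat \<Rightarrow> (nat \<Rightarrow> real) measure" where "F k = (if k = 0 then sigma UNIV {} else M)" for k
  define d :: "nat \<Rightarrow> (nat \<Rightarrow> real) \<Rightarrow> real" where "d k x = (if k = 1 then x 0 else 0)" for k x
  interpret prob_space M unfolding M_def by (rule prob_space_measure_pmf)
  have sets0: "sets (F 0) = {{}, UNIV}" by (simp add: F_def sigma_sets_empty_eq)
  have spF: "space (F k) = UNIV" for k by (simp add: F_def M_def)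
  have meas: "f \<in> borel_measurable M" for f :: "(nat \<Rightarrow> real) \<Rightarrow> real" by (simp add: M_def)
  have fin: "finite (set_pmf q)" by (simp add: q_def set_pmf_of_set)
  have int: "integrable M f" for f :: "(nat \<Rightarrow> real) \<Rightarrow> real"
    unfolding M_def by (rule integrable_measure_pmf_finite[OF fin])
  have sub: "subalgebra M (F k)" for k
    using spF[of k] by (auto simp: subalgebra_def M_def)
  have E: "(\<integral>x. f x \<partial>M) = (f (\<lambda>_. - 1) + f (\<lambda>_. 1)) / 2" for f :: "(nat \<Rightarrow> real) \<Rightarrow> real"
    unfolding M_def q_def by (simp add: integral_pmf_of_set)
  have cond: "AE x in M. real_cond_exp M (F (k - 1)) (d k) x = 0" if "k \<ge> 1" for k
  proof -
    interpret S: finite_measure_subalgebra M "F (k - 1)" by standard (rule sub)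
    show ?thesis
    proof (rule S.real_cond_exp_charact)
      fix A assume A: "A \<in> sets (F (k - 1))"
      show "(\<integral>x\<in>A. d k x \<partial>M) = (\<integral>x\<in>A. 0 \<partial>M)"
      proof (cases "k = 1")
        case True
        hence "A = {} \<or> A = UNIV" using A sets0 by simp
        thus ?thesis using True by (auto simp: set_lebesgue_integral_def E d_def)
      next
        case False
        thus ?thesis by (simp add: set_lebesgue_integral_def d_def)
      qed
    qed (auto intro: int)
  qed
  have "martingale_transform M F d (\<lambda>_ _. b) b B p"
    unfolding martingale_transform_def
  proof (intro conjI allI impI ballI)
    show "filtration (space M) F"
      by standard (auto simp: F_def M_def)
    fix k :: nat assume k: "1 \<le> k"
    show "d k \<in> borel_measurable (F k)" using k meas by (simp add: F_def)
    show "d k \<in> Lp p M" using meas int by (simp add: Lp_def)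
    show "AE x in M. real_cond_exp M (F (k - 1)) (d k) x = 0" by (rule cond[OF k])
  qed (auto simp: sub prob_space_axioms)
  hence "Lp_norm p M (\<lambda>x. \<Sum>k=1..1::nat. b * d k x) \<le> C * Lp_norm p M (\<lambda>x. \<Sum>k=1..1::nat. d k x)"
    using C unfolding choi_bound_def by blast
  moreover have "Lp_norm p M (\<lambda>x. \<Sum>k=1..1::nat. d k x) = 1"
    by (simp add: Lp_norm_def E d_def)
  moreover have "0 \<le> Lp_norm p M (\<lambda>x. \<Sum>k=1..1::nat. b * d k x)"
    unfolding Lp_norm_def by (rule powr_ge_zero)
  ultimately have "0 \<le> C * 1" by (simp only:)
  thus ?thesis by simp
qed

lemma choi_const_one: "choi_const 1 1 p \<le> 1"
  unfolding choi_const_def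
proof (rule cInf_lower)
  show "bdd_below {C. choi_bound TYPE(nat \<Rightarrow> real) 1 1 p C}"
    using choi_bound_nonneg by (intro bdd_belowI[of _ 0]) auto
  have "choi_bound TYPE(nat \<Rightarrow> real) 1 1 p 1"
    unfolding choi_bound_def
  proof (intro allI impI)
    fix n :: nat and M :: "(nat \<Rightarrow> real) measure" and F d \<theta>
    assume n: "n \<ge> 1" and m: "martingale_transform M F d \<theta> 1 1 p"
    have "(\<integral>x. \<bar>\<Sum>k=1..n. \<theta> k x * d k x\<bar> powr p \<partial>M) = (\<integral>x. \<bar>\<Sum>k=1..n. d k x\<bar> powr p \<partial>M)"
    proof (intro Bochner_Integration.integral_cong refl)
      fix x assume x: "x \<in> space M"
      have "(\<Sum>k=1..n. \<theta> k x * d k x) = (\<Sum>k=1..n. d k x)"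
        using m x by (intro sum.cong refl) (auto simp: martingale_transform_def)
      thus "\<bar>\<Sum>k=1..n. \<theta> k x * d k x\<bar> powr p = \<bar>\<Sum>k=1..n. d k x\<bar> powr p" by simp
    qed
    thus "Lp_norm p M (\<lambda>x. \<Sum>k=1..n. \<theta> k x * d k x) \<le> 1 * Lp_norm p M (\<lambda>x. \<Sum>k=1..n. d k x)"
      by (simp add: Lp_norm_def)
  qed
  thus "1 \<in> {C. choi_bound TYPE(nat \<Rightarrow> real) 1 1 p C}" by simp
qed

text \<open>The second order Riesz transforms in terms of discrete derivatives:
  \<open>R\<^sub>j\<^sup>2 (- \<Delta> f) = \<partial>\<^sub>+\<^sup>j \<partial>\<^sub>-\<^sup>j f\<close> for finitely supported \<open>f\<close>, and constants are mapped to \<open>0\<close>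
  on the finite groups.\<close>

definition deriv_plus :: "'n::finite \<Rightarrow> ('g::comm_ring_1 ^ 'n \<Rightarrow> real) \<Rightarrow> 'g ^ 'n \<Rightarrow> real" where
  "deriv_plus i f n = f (n + axis i 1) - f n"

definition deriv_minus :: "'n::finite \<Rightarrow> ('g::comm_ring_1 ^ 'n \<Rightarrow> real) \<Rightarrow> 'g ^ 'n \<Rightarrow> real" where
  "deriv_minus i f n = f n - f (n - axis i 1)"

definition laplacian :: "('g::comm_ring_1 ^ 'n::finite \<Rightarrow> real) \<Rightarrow> 'g ^ 'n \<Rightarrow> real" where
  "laplacian f n = (\<Sum>i\<in>UNIV. deriv_plus i (deriv_minus i f) n)"

lemma sum_vec_prod:
  fixes g :: "'n::finite \<Rightarrow> 'a::finite \<Rightarrow> 'b::comm_semiring_1"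
  shows "(\<Sum>\<xi>\<in>(UNIV :: ('a ^ 'n) set). \<Prod>i\<in>UNIV. g i (\<xi> $ i)) = (\<Prod>i\<in>UNIV. \<Sum>x\<in>UNIV. g i x)"
proof -
  have "(\<Prod>i\<in>UNIV. \<Sum>x\<in>UNIV. g i x) = (\<Sum>h\<in>Pi\<^sub>E UNIV (\<lambda>_. UNIV). \<Prod>i\<in>UNIV. g i (h i))"
    by (rule prod_sum_PiE) auto
  also have "\<dots> = (\<Sum>\<xi>\<in>(UNIV :: ('a ^ 'n) set). \<Prod>i\<in>UNIV. g i (\<xi> $ i))"
    by (rule sum.reindex_bij_witness[of _ "\<lambda>\<xi>. ($) \<xi>" "\<lambda>h. \<chi> i. h i"]) auto
  finally show ?thesis by simp
qed

lemma sum_mod_ring: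
  "(\<Sum>x\<in>(UNIV :: 'm::nontriv mod_ring set). g (to_int_mod_ring x)) = (\<Sum>k<CARD('m). g (int k))"
proof -
  have "(\<Sum>x\<in>(UNIV :: 'm mod_ring set). g (to_int_mod_ring x)) =
        sum g (range (to_int_mod_ring :: 'm mod_ring \<Rightarrow> int))"
    by (subst sum.reindex) (auto simp: to_int_mod_ring_hom.injectivity intro!: injI)
  also have "\<dots> = sum g {0..<int CARD('m)}" by (simp add: range_to_int_mod_ring)
  also have "\<dots> = (\<Sum>k<CARD('m). g (int k))"
    by (rule sum.reindex_bij_witness[of _ int nat]) auto
  finally show ?thesis .
qed

lemma sum_character_mod_ring:
  fixes a b :: "'m::nontriv mod_ring"
  shows "(\<Sum>x\<in>(UNIV :: 'm mod_ring set).
           cis (2 * pi / CARD('m) * ((of_int (to_int_mod_ring a) - of_int (to_int_mod_ring b)) * of_int (to_int_mod_ring x))))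
         = (if a = b then of_nat CARD('m) else 0)"
proof -
  let ?m = "CARD('m)"
  define c where "c = to_int_mod_ring a - to_int_mod_ring b"
  have m: "?m > 1" by (rule nontriv)
  have ra: "to_int_mod_ring a \<in> {0..<int ?m}" "to_int_mod_ring b \<in> {0..<int ?m}"
    by (metis range_to_int_mod_ring rangeI)+
  define z where "z = cis (2 * pi / ?m * of_int c)"
  have "(\<Sum>x\<in>(UNIV :: 'm mod_ring set).
           cis (2 * pi / ?m * ((of_int (to_int_mod_ring a) - of_int (to_int_mod_ring b)) * of_int (to_int_mod_ring x))))
        = (\<Sum>k<?m. cis (2 * pi / ?m * (of_int c * of_int (int k))))"
    unfolding c_def of_int_diff by (rule sum_mod_ring[where g = "\<lambda>t. cis (2 * pi / ?m * ((of_int (to_int_mod_ring a) - of_int (to_int_mod_ring b)) * of_int t))"])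
  also have "\<dots> = (\<Sum>k<?m. z ^ k)"
    unfolding z_def by (intro sum.cong refl) (simp add: Complex.DeMoivre mult_ac)
  also have "\<dots> = (if a = b then of_nat ?m else 0)"
  proof (cases "a = b")
    case True
    thus ?thesis by (simp add: z_def c_def)
  next
    case False
    have c0: "c \<noteq> 0" using False by (auto simp: c_def)
    have cm: "\<bar>c\<bar> < int ?m" using ra by (auto simp: c_def)
    have "z \<noteq> 1"
    proof
      assume "z = 1"
      hence "cos (2 * pi / ?m * of_int c) = 1" by (simp add: z_def complex_eq_iff)
      then obtain k :: int where "2 * pi / ?m * of_int c = of_int k * 2 * pi"
        using cos_one_2pi_int by (metis mult.commute mult.left_commute)
      hence "real_of_int c = of_int (k * int ?m)" using m by (simp add: field_simps)
      hence "c = k * int ?m" by linarith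
      hence "\<bar>c\<bar> \<ge> int ?m" using c0 by (cases "k = 0") (auto simp: abs_mult)
      thus False using cm by simp
    qed
    moreover have "z ^ ?m = 1"
    proof -
      have "z ^ ?m = cis (2 * pi * of_int c)" using m by (simp add: z_def Complex.DeMoivre)
      thus ?thesis by (simp add: cis_multiple_2pi)
    qed
    ultimately show ?thesis using False by (simp add: geometric_sum)
  qed
  finally show ?thesis .
qed

lemma char_cyclic_orthogonal:
  fixes n k :: "'m::nontriv mod_ring ^ 'n::finite"
  shows "(\<Sum>\<xi>\<in>UNIV. char_cyclic n \<xi> * cnj (char_cyclic k \<xi>)) =
           (if n = k then of_nat (CARD('m) ^ CARD('n)) else 0)"
proof -
  have cis_sum: "cis (\<Sum>i\<in>UNIV. h i) = (\<Prod>i\<in>UNIV. cis (h i))" for h :: "'n \<Rightarrow> real"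
    by (simp add: cis_conv_exp exp_sum sum_distrib_left)
  have "char_cyclic n \<xi> * cnj (char_cyclic k \<xi>) =
     (\<Prod>i\<in>UNIV. cis (2 * pi / CARD('m) * ((of_int (to_int_mod_ring (n $ i)) - of_int (to_int_mod_ring (k $ i))) * of_int (to_int_mod_ring (\<xi> $ i)))))" for \<xi>
    unfolding cis_sum[symmetric] char_cyclic_def cis_cnj cis_mult
    by (intro arg_cong[of _ _ cis]) (simp add: sum_distrib_left sum_subtractf algebra_simps)
  hence "(\<Sum>\<xi>\<in>UNIV. char_cyclic n \<xi> * cnj (char_cyclic k \<xi>)) =
    (\<Sum>\<xi>\<in>(UNIV :: ('m mod_ring ^ 'n) set). (\<Prod>i\<in>UNIV. cis (2 * pi / CARD('m) * ((of_int (to_int_mod_ring (n $ i)) - of_int (to_int_mod_ring (k $ i))) * of_int (to_int_mod_ring (\<xi> $ i))))))"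
    by simp
  also have "\<dots> = (\<Prod>i\<in>UNIV. if n $ i = k $ i then of_nat CARD('m) else 0)"
    unfolding sum_vec_prod[where g = "\<lambda>i x. cis (2 * pi / CARD('m) * ((of_int (to_int_mod_ring (n $ i)) - of_int (to_int_mod_ring (k $ i))) * of_int (to_int_mod_ring x)))"]
      sum_character_mod_ring ..
  also have "\<dots> = (if n = k then of_nat (CARD('m) ^ CARD('n)) else 0)"
    by (cases "n = k") (auto simp: vec_eq_iff)
  finally show ?thesis .
qed

lemma fourier_cyclic_inversion:
  fixes f :: "'m::nontriv mod_ring ^ 'n::finite \<Rightarrow> real"
  shows "(\<Sum>\<xi>\<in>UNIV. fourier_cyclic f \<xi> * char_cyclic n \<xi>) / of_nat (CARD('m) ^ CARD('n)) = of_real (f n)"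
proof -
  have "(\<Sum>\<xi>\<in>UNIV. fourier_cyclic f \<xi> * char_cyclic n \<xi>) =
        (\<Sum>\<xi>\<in>UNIV. \<Sum>k\<in>UNIV. of_real (f k) * (char_cyclic n \<xi> * cnj (char_cyclic k \<xi>)))"
    by (simp add: fourier_cyclic_def sum_distrib_right sum_distrib_left mult_ac)
  also have "\<dots> = (\<Sum>k\<in>UNIV. of_real (f k) * (\<Sum>\<xi>\<in>UNIV. char_cyclic n \<xi> * cnj (char_cyclic k \<xi>)))"
    by (subst sum.swap) (simp add: sum_distrib_left)
  also have "\<dots> = (\<Sum>k\<in>UNIV. if n = k then of_real (f k) * of_nat (CARD('m) ^ CARD('n)) else 0)"
    by (intro sum.cong refl) (simp add: char_cyclic_orthogonal)
  also have "\<dots> = of_real (f n) * of_nat (CARD('m) ^ CARD('n))" by simp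
  finally show ?thesis by simp
qed

lemma char_cyclic_add_axis:
  fixes n \<xi> :: "'m::nontriv mod_ring ^ 'n::finite"
  shows "char_cyclic (n + axis j 1) \<xi> =
           char_cyclic n \<xi> * cis (2 * pi / CARD('m) * of_int (to_int_mod_ring (\<xi> $ j)))"
proof -
  let ?m = "CARD('m)"
  have m: "?m > 1" by (rule nontriv)
  have "\<exists>q. to_int_mod_ring (n $ j + 1) = to_int_mod_ring (n $ j) + 1 + int ?m * q"
  proof -
    have "to_int_mod_ring (n $ j + 1) = (to_int_mod_ring (n $ j) + 1) mod int ?m"
      by (simp add: plus_mod_ring.rep_eq one_mod_ring.rep_eq to_int_mod_ring.rep_eq)
    also have "\<dots> = to_int_mod_ring (n $ j) + 1 + int ?m * (- ((to_int_mod_ring (n $ j) + 1) div int ?m))"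
      by (simp add: minus_mult_div_eq_mod[symmetric])
    finally show ?thesis by blast
  qed
  then obtain q where q: "to_int_mod_ring (n $ j + 1) = to_int_mod_ring (n $ j) + 1 + int ?m * q" ..
  let ?x = "\<lambda>i. of_int (to_int_mod_ring (\<xi> $ i)) :: real"
  have "(\<Sum>i\<in>UNIV. of_int (to_int_mod_ring ((n + axis j 1) $ i)) * ?x i) =
        (\<Sum>i\<in>UNIV. of_int (to_int_mod_ring (n $ i)) * ?x i + (if i = j then (1 + real ?m * of_int q) * ?x j else 0))"
    by (intro sum.cong refl) (auto simp: axis_def q distrib_right)
  also have "\<dots> = (\<Sum>i\<in>UNIV. of_int (to_int_mod_ring (n $ i)) * ?x i) + (1 + real ?m * of_int q) * ?x j"
    by (simp add: sum.distrib)
  finally have e: "(\<Sum>i\<in>UNIV. of_int (to_int_mod_ring ((n + axis j 1) $ i)) * ?x i) =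
    (\<Sum>i\<in>UNIV. of_int (to_int_mod_ring (n $ i)) * ?x i) + (1 + real ?m * of_int q) * ?x j" .
  have "2 * pi / ?m * ((\<Sum>i\<in>UNIV. of_int (to_int_mod_ring (n $ i)) * ?x i) + (1 + real ?m * of_int q) * ?x j)
     = 2 * pi / ?m * (\<Sum>i\<in>UNIV. of_int (to_int_mod_ring (n $ i)) * ?x i) + 2 * pi / ?m * ?x j + 2 * pi * of_int (q * to_int_mod_ring (\<xi> $ j))"
    using m by (simp add: field_simps)
  moreover have "cis (2 * pi * of_int (q * to_int_mod_ring (\<xi> $ j))) = 1" by (rule cis_multiple_2pi) auto
  ultimately show ?thesis unfolding char_cyclic_def e by (simp add: cis_mult[symmetric])
qed

lemma cis_second_difference: "cis t + cis (- t) - 2 = of_real (- 4 * (sin (t / 2))\<^sup>2)"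
  using cos_double_sin[of "t / 2"] by (simp add: complex_eq_iff)

lemma deriv_plus_deriv_minus:
  "deriv_plus j (deriv_minus j f) n = f (n + axis j 1) + f (n - axis j 1) - 2 * f n"
  by (simp add: deriv_plus_def deriv_minus_def)

lemma fourier_cyclic_second_deriv:
  fixes f :: "'m::nontriv mod_ring ^ 'n::finite \<Rightarrow> real"
  shows "fourier_cyclic (deriv_plus j (deriv_minus j f)) \<xi> =
    of_real (- 4 * (sin (pi / CARD('m) * of_int (to_int_mod_ring (\<xi> $ j))))\<^sup>2) * fourier_cyclic f \<xi>"
proof -
  let ?t = "2 * pi / CARD('m) * of_int (to_int_mod_ring (\<xi> $ j))"
  let ?c = "\<lambda>n. cnj (char_cyclic n \<xi>)"
  have c1: "?c (n + axis j 1) = ?c n * cis (- ?t)" for n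
    by (simp add: char_cyclic_add_axis cis_cnj)
  have c2: "?c (n - axis j 1) = ?c n * cis ?t" for n
    using c1[of "n - axis j 1"] by (simp add: mult.assoc cis_mult)
  have "fourier_cyclic (deriv_plus j (deriv_minus j f)) \<xi> =
     (\<Sum>n\<in>UNIV. of_real (f (n + axis j 1)) * ?c n) + (\<Sum>n\<in>UNIV. of_real (f (n - axis j 1)) * ?c n)
       - 2 * (\<Sum>n\<in>UNIV. of_real (f n) * ?c n)"
    by (simp add: fourier_cyclic_def deriv_plus_deriv_minus algebra_simps sum.distrib sum_subtractf sum_distrib_left)
  also have "(\<Sum>n\<in>UNIV. of_real (f (n + axis j 1)) * ?c n) = (\<Sum>n\<in>UNIV. of_real (f n) * ?c (n - axis j 1))"
    by (rule sum.reindex_bij_witness[of _ "\<lambda>n. n - axis j 1" "\<lambda>n. n + axis j 1"]) auto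
  also have "(\<Sum>n\<in>UNIV. of_real (f (n - axis j 1)) * ?c n) = (\<Sum>n\<in>UNIV. of_real (f n) * ?c (n + axis j 1))"
    by (rule sum.reindex_bij_witness[of _ "\<lambda>n. n + axis j 1" "\<lambda>n. n - axis j 1"]) auto
  finally have e: "fourier_cyclic (deriv_plus j (deriv_minus j f)) \<xi> =
     (\<Sum>n\<in>UNIV. of_real (f n) * ?c (n - axis j 1)) + (\<Sum>n\<in>UNIV. of_real (f n) * ?c (n + axis j 1))
       - 2 * (\<Sum>n\<in>UNIV. of_real (f n) * ?c n)" .
  have "fourier_cyclic (deriv_plus j (deriv_minus j f)) \<xi> = (cis ?t + cis (- ?t) - 2) * fourier_cyclic f \<xi>"
    unfolding e c1 c2
    by (simp add: fourier_cyclic_def algebra_simps sum_distrib_left sum_distrib_right sum.distrib sum_subtractf)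
  thus ?thesis unfolding cis_second_difference by simp
qed

lemma symbol_mult_sum:
  fixes s :: "'n::finite \<Rightarrow> real"
  shows "(- 4 * (s j)\<^sup>2 / (4 * (\<Sum>i\<in>UNIV. (s i)\<^sup>2))) * (- (\<Sum>i\<in>UNIV. - 4 * (s i)\<^sup>2)) = - 4 * (s j)\<^sup>2"
proof (cases "(\<Sum>i\<in>UNIV. (s i)\<^sup>2) = 0")
  case True
  hence "(s j)\<^sup>2 = 0" by (subst (asm) sum_nonneg_eq_0_iff) auto
  thus ?thesis by simp
next
  case False
  thus ?thesis by (simp add: sum_distrib_left[symmetric] sum_negf)
qed

lemma riesz2_cyclic_laplacian:
  fixes f :: "'m::nontriv mod_ring ^ 'n::finite \<Rightarrow> real"
  shows "riesz2_cyclic j (\<lambda>n. - laplacian f n) = deriv_plus j (deriv_minus j f)"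
proof
  fix n :: "'m mod_ring ^ 'n"
  have lap: "fourier_cyclic (\<lambda>n. - laplacian f n) \<xi> =
     - (\<Sum>i\<in>UNIV. fourier_cyclic (deriv_plus i (deriv_minus i f)) \<xi>)" for \<xi>
    unfolding fourier_cyclic_def laplacian_def
    by (subst sum.swap) (simp add: sum_distrib_right sum_negf)
  have "of_real (symbol_cyclic j \<xi>) * fourier_cyclic (\<lambda>n. - laplacian f n) \<xi> =
        fourier_cyclic (deriv_plus j (deriv_minus j f)) \<xi>" for \<xi>
  proof -
    let ?s = "\<lambda>i. sin (pi / CARD('m) * of_int (to_int_mod_ring (\<xi> $ i)))"
    have "of_real (symbol_cyclic j \<xi>) * fourier_cyclic (\<lambda>n. - laplacian f n) \<xi> =
       of_real ((- 4 * (?s j)\<^sup>2 / (4 * (\<Sum>i\<in>UNIV. (?s i)\<^sup>2))) * (- (\<Sum>i\<in>UNIV. - 4 * (?s i)\<^sup>2))) * fourier_cyclic f \<xi>"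
      unfolding lap fourier_cyclic_second_deriv symbol_cyclic_def sum_distrib_right[symmetric]
      by (simp only: of_real_mult of_real_minus of_real_sum mult_minus_left mult_minus_right mult.assoc)
    also have "\<dots> = fourier_cyclic (deriv_plus j (deriv_minus j f)) \<xi>"
      unfolding symbol_mult_sum[of ?s j] fourier_cyclic_second_deriv ..
    finally show ?thesis .
  qed
  thus "riesz2_cyclic j (\<lambda>n. - laplacian f n) n = deriv_plus j (deriv_minus j f) n"
    by (simp only: riesz2_cyclic_def fourier_cyclic_inversion Re_complex_of_real)
qed

lemma fourier_int_superset:
  assumes "finite S" "{n. f n \<noteq> 0} \<subseteq> S"
  shows "fourier_int f \<xi> = (\<Sum>n\<in>S. of_real (f n) * cnj (char_int n \<xi>))"
  unfolding fourier_int_def using assms by (intro sum.mono_neutral_left) auto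

lemma integral_vec_prod:
  fixes g :: "'n::finite \<Rightarrow> real \<Rightarrow> complex"
  assumes "\<And>i. integrable lborel (g i)"
  shows "(\<integral>x. (\<Prod>i\<in>UNIV. g i (x $ i)) \<partial>(lborel :: (real ^ 'n) measure)) = (\<Prod>i\<in>UNIV. \<integral>t. g i t \<partial>lborel)"
proof -
  have [measurable]: "g i \<in> borel_measurable borel" for i using assms[of i] by auto
  interpret product_sigma_finite "\<lambda>_ :: real ^ 'n. lborel :: real measure" by standard
  define idx :: "real ^ 'n \<Rightarrow> 'n" where "idx = inv_into UNIV (\<lambda>i. axis i (1 :: real))"
  have inj: "inj (\<lambda>i :: 'n. axis i (1 :: real))" by (auto simp: inj_on_def axis_eq_axis)
  have idx [simp]: "idx (axis i 1) = i" for i unfolding idx_def by (rule inv_f_f[OF inj])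
  have B: "(Basis :: (real ^ 'n) set) = range (\<lambda>i. axis i 1)" by (auto simp: Basis_vec_def)
  have rew: "(\<Prod>b\<in>Basis. h (idx b) (x b)) = (\<Prod>i\<in>UNIV. h i (x (axis i 1)))" for h :: "'n \<Rightarrow> real \<Rightarrow> complex" and x
    unfolding B by (subst prod.reindex[OF inj]) simp
  have "(\<integral>x. (\<Prod>i\<in>UNIV. g i (x $ i)) \<partial>(lborel :: (real ^ 'n) measure)) =
      (\<integral>f. (\<Prod>i\<in>UNIV. g i ((\<Sum>b\<in>Basis. f b *\<^sub>R b) $ i)) \<partial>(\<Pi>\<^sub>M b\<in>(Basis :: (real^'n) set). lborel))"
    by (subst lborel_eq, subst integral_distr) auto
  also have "\<dots> = (\<integral>f. (\<Prod>b\<in>Basis. g (idx b) (f b)) \<partial>(\<Pi>\<^sub>M b\<in>(Basis :: (real^'n) set). lborel))"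
  proof (intro Bochner_Integration.integral_cong refl)
    fix f :: "real ^ 'n \<Rightarrow> real"
    have "(\<Sum>b\<in>Basis. f b *\<^sub>R b) $ i = f (axis i 1)" for i
      unfolding B by (subst sum.reindex[OF inj]) (simp add: axis_def if_distrib cong: if_cong)
    thus "(\<Prod>i\<in>UNIV. g i ((\<Sum>b\<in>Basis. f b *\<^sub>R b) $ i)) = (\<Prod>b\<in>Basis. g (idx b) (f b))"
      by (simp add: rew)
  qed
  also have "\<dots> = (\<Prod>b\<in>(Basis :: (real^'n) set). \<integral>t. g (idx b) t \<partial>lborel)"
    by (rule product_integral_prod) (auto simp: assms)
  also have "\<dots> = (\<Prod>i\<in>UNIV. \<integral>t. g i t \<partial>lborel)"
    using rew[of "\<lambda>i t. \<integral>t. g i t \<partial>lborel"] by simp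
  finally show ?thesis .
qed

lemma integral_character:
  "(LINT t : {- 1/2..1/2} | lborel. cis (2 * pi * (of_int c * t))) = (if c = 0 then 1 else 0)"
  (is "?L = _")
proof (cases "c = 0")
  case True
  have "(LINT t : {- 1/2..1/2 :: real} | lborel. (1 :: complex)) = of_real (LINT t : {- 1/2..1/2 :: real} | lborel. (1 :: real))"
    unfolding set_integral_complex_of_real[symmetric] by simp
  also have "(LINT t : {- 1/2..1/2 :: real} | lborel. (1 :: real)) = 1"
    by (simp add: set_lebesgue_integral_def)
  finally show ?thesis using True by simp
next
  case False
  have cont: "continuous_on {- 1/2..1/2} (\<lambda>t. cis (2 * pi * (of_int c * t)))"
    by (intro continuous_intros)
  let ?F = "\<lambda>t. cis (2 * pi * (of_int c * t)) / (\<i> * of_real (2 * pi * of_int c))"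
  have "((\<lambda>t. cis (2 * pi * (of_int c * t))) has_integral (?F (1/2) - ?F (- 1/2))) {- 1/2..1/2}"
  proof (rule fundamental_theorem_of_calculus)
    fix x :: real
    have "((\<lambda>t. exp (\<i> * of_real (2 * pi * of_int c) * of_real t) / (\<i> * of_real (2 * pi * of_int c))) has_vector_derivative
           exp (\<i> * of_real (2 * pi * of_int c) * of_real x)) (at x within {- 1/2..1/2})"
      using False by (auto intro!: derivative_eq_intros has_vector_derivative_real_field)
    thus "(?F has_vector_derivative cis (2 * pi * (of_int c * x))) (at x within {- 1/2..1/2})"
      by (simp add: cis_conv_exp mult_ac)
  qed auto
  moreover have "?F (1/2) - ?F (- 1/2) = 0"
  proof -
    have "cis (2 * pi * (of_int c * (1/2))) = cis (2 * pi * (of_int c * (- 1/2))) * cis (2 * pi * of_int c)"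
      by (simp add: cis_mult algebra_simps)
    also have "cis (2 * pi * of_int c) = 1" by (rule cis_multiple_2pi) auto
    finally show ?thesis by simp
  qed
  ultimately have "integral {- 1/2..1/2} (\<lambda>t. cis (2 * pi * (of_int c * t))) = 0"
    by (simp add: integral_unique)
  thus ?thesis using False set_borel_integral_eq_integral(2)[OF borel_integrable_atLeastAtMost'[OF cont]] by simp
qed

lemma integrable_character: "set_integrable lborel {- 1/2..1/2} (\<lambda>t. cis (2 * pi * (of_int c * t)))"
  by (intro borel_integrable_atLeastAtMost' continuous_intros)

lemma char_int_orthogonal:
  fixes n k :: "int ^ 'n::finite"
  shows "(LINT \<xi> : cube | lborel. char_int n \<xi> * cnj (char_int k \<xi>)) = (if n = k then 1 else 0)"
proof -
  have cis_sum: "cis (\<Sum>i\<in>UNIV. h i) = (\<Prod>i\<in>UNIV. cis (h i))" for h :: "'n \<Rightarrow> real"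
    by (simp add: cis_conv_exp exp_sum sum_distrib_left)
  let ?g = "\<lambda>i t. indicator {- 1/2..1/2} t *\<^sub>R cis (2 * pi * (of_int (n $ i - k $ i) * t))"
  have "indicator cube \<xi> *\<^sub>R (char_int n \<xi> * cnj (char_int k \<xi>)) = (\<Prod>i\<in>UNIV. ?g i (\<xi> $ i))" for \<xi> :: "real ^ 'n"
  proof -
    have "char_int n \<xi> * cnj (char_int k \<xi>) = (\<Prod>i\<in>UNIV. cis (2 * pi * (of_int (n $ i - k $ i) * \<xi> $ i)))"
      unfolding cis_sum[symmetric] char_int_def cis_cnj cis_mult
      by (intro arg_cong[of _ _ cis]) (simp add: sum_distrib_left sum_subtractf algebra_simps)
    moreover have "indicator cube \<xi> = (\<Prod>i\<in>UNIV. indicator {- 1/2..1/2} (\<xi> $ i) :: real)"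
      by (auto simp: indicator_def mem_box_cart)
    ultimately show ?thesis by (simp add: scaleR_conv_of_real prod.distrib)
  qed
  hence "(LINT \<xi> : cube | lborel. char_int n \<xi> * cnj (char_int k \<xi>)) = (\<integral>\<xi>. (\<Prod>i\<in>UNIV. ?g i (\<xi> $ i)) \<partial>lborel)"
    by (simp only: set_lebesgue_integral_def)
  also have "\<dots> = (\<Prod>i\<in>UNIV. \<integral>t. ?g i t \<partial>lborel)"
    using integrable_character by (intro integral_vec_prod) (simp only: set_integrable_def)
  also have "\<dots> = (\<Prod>i\<in>UNIV. if n $ i - k $ i = 0 then 1 else 0)"
    using integral_character by (simp only: set_lebesgue_integral_def)
  also have "\<dots> = (if n = k then 1 else 0)"
    by (cases "n = k") (auto simp: vec_eq_iff)
  finally show ?thesis .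
qed

lemma fourier_int_inversion:
  fixes f :: "int ^ 'n::finite \<Rightarrow> real"
  assumes "finsupp f"
  shows "(LINT \<xi> : cube | lborel. fourier_int f \<xi> * char_int n \<xi>) = of_real (f n)"
proof -
  have fin: "finite {n. f n \<noteq> 0}" using assms by (simp add: finsupp_def)
  have int: "set_integrable lborel cube (\<lambda>\<xi>. of_real (f k) * (char_int n \<xi> * cnj (char_int k \<xi>)))" for k
    unfolding char_int_def set_integrable_def
    by (intro borel_integrable_compact continuous_intros) auto
  have "(LINT \<xi> : cube | lborel. fourier_int f \<xi> * char_int n \<xi>) =
     (LINT \<xi> : cube | lborel. \<Sum>k | f k \<noteq> 0. of_real (f k) * (char_int n \<xi> * cnj (char_int k \<xi>)))"
    by (simp add: fourier_int_def sum_distrib_right sum_distrib_left mult_ac)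
  also have "\<dots> = (\<Sum>k | f k \<noteq> 0. LINT \<xi> : cube | lborel. of_real (f k) * (char_int n \<xi> * cnj (char_int k \<xi>)))"
    using int unfolding set_lebesgue_integral_def set_integrable_def
    by (simp add: scaleR_sum_right)
  also have "\<dots> = (\<Sum>k | f k \<noteq> 0. of_real (f k) * (if n = k then 1 else 0))"
    by (simp only: set_integral_mult_right char_int_orthogonal)
  also have "\<dots> = of_real (f n)"
    using fin by (simp add: if_distrib[of "\<lambda>x. _ * x"] cong: if_cong)
  finally show ?thesis .
qed

lemma char_int_add_axis:
  "char_int (n + axis j 1) \<xi> = char_int n \<xi> * cis (2 * pi * \<xi> $ j)"
proof -
  have "(\<Sum>i\<in>UNIV. of_int ((n + axis j 1) $ i) * \<xi> $ i) =
        (\<Sum>i\<in>UNIV. of_int (n $ i) * \<xi> $ i + (if i = j then \<xi> $ j else 0))"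
    by (intro sum.cong refl) (auto simp: axis_def distrib_right)
  also have "\<dots> = (\<Sum>i\<in>UNIV. of_int (n $ i) * \<xi> $ i) + \<xi> $ j" by (simp add: sum.distrib)
  finally show ?thesis unfolding char_int_def by (simp add: cis_mult distrib_left)
qed

lemma finsupp_shift:
  fixes f :: "'g::comm_ring_1 ^ 'n::finite \<Rightarrow> real"
  assumes "finsupp f"
  shows "finsupp (\<lambda>n. f (n + a))"
proof -
  have "{n. f (n + a) \<noteq> 0} = (\<lambda>n. n - a) ` {n. f n \<noteq> 0}"
    by (auto simp: image_iff) (metis add_diff_cancel_right')
  thus ?thesis using assms by (simp add: finsupp_def)
qed

lemma finsupp_second_deriv:
  fixes f :: "'g::comm_ring_1 ^ 'n::finite \<Rightarrow> real"
  assumes "finsupp f"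
  shows "finsupp (deriv_plus j (deriv_minus j f))"
proof -
  have "{n. deriv_plus j (deriv_minus j f) n \<noteq> 0} \<subseteq>
     {n. f (n + axis j 1) \<noteq> 0} \<union> {n. f (n + (- axis j 1)) \<noteq> 0} \<union> {n. f n \<noteq> 0}"
    by (auto simp: deriv_plus_deriv_minus)
  moreover have "finite ({n. f (n + axis j 1) \<noteq> 0} \<union> {n. f (n + (- axis j 1)) \<noteq> 0} \<union> {n. f n \<noteq> 0})"
    using assms finsupp_shift[OF assms, of "axis j 1"] finsupp_shift[OF assms, of "- axis j 1"]
    by (auto simp: finsupp_def)
  ultimately show ?thesis unfolding finsupp_def by (rule finite_subset)
qed

lemma fourier_int_shift:
  fixes f :: "int ^ 'n::finite \<Rightarrow> real"
  shows "(\<Sum>n | f (n + a) \<noteq> 0. of_real (f (n + a)) * h n) = (\<Sum>n | f n \<noteq> 0. of_real (f n) * h (n - a))"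
  by (rule sum.reindex_bij_witness[of _ "\<lambda>n. n - a" "\<lambda>n. n + a"]) auto

lemma fourier_int_second_deriv:
  fixes f :: "int ^ 'n::finite \<Rightarrow> real"
  assumes f: "finsupp f"
  shows "fourier_int (deriv_plus j (deriv_minus j f)) \<xi> =
    of_real (- 4 * (sin (pi * \<xi> $ j))\<^sup>2) * fourier_int f \<xi>"
proof -
  let ?t = "2 * pi * \<xi> $ j" and ?a = "axis j 1 :: int ^ 'n"
  let ?c = "\<lambda>n. cnj (char_int n \<xi>)"
  have c1: "?c (n + ?a) = ?c n * cis (- ?t)" for n
    by (simp add: char_int_add_axis cis_cnj)
  have c2: "?c (n - ?a) = ?c n * cis ?t" for n
    using c1[of "n - ?a"] by (simp add: mult.assoc cis_mult)
  define S where "S = {n. f (n + ?a) \<noteq> 0} \<union> {n. f (n + (- ?a)) \<noteq> 0} \<union> {n. f n \<noteq> 0}"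
  have S: "finite S" using f finsupp_shift[OF f, of ?a] finsupp_shift[OF f, of "- ?a"]
    by (auto simp: finsupp_def S_def)
  have sh: "(\<Sum>n\<in>S. of_real (f (n + a)) * ?c n) = (\<Sum>n | f n \<noteq> 0. of_real (f n) * ?c (n - a))"
    if "{n. f (n + a) \<noteq> 0} \<subseteq> S" for a
    unfolding fourier_int_shift[of f a ?c, symmetric] using S that by (intro sum.mono_neutral_right) auto
  have "fourier_int (deriv_plus j (deriv_minus j f)) \<xi> =
     (\<Sum>n\<in>S. of_real (deriv_plus j (deriv_minus j f) n) * ?c n)"
    by (rule fourier_int_superset[OF S]) (auto simp: S_def deriv_plus_deriv_minus)
  also have "\<dots> = (\<Sum>n\<in>S. of_real (f (n + ?a)) * ?c n) + (\<Sum>n\<in>S. of_real (f (n + (- ?a))) * ?c n)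
       - 2 * (\<Sum>n\<in>S. of_real (f (n + 0)) * ?c n)"
    by (simp add: deriv_plus_deriv_minus algebra_simps sum.distrib sum_subtractf sum_distrib_left)
  also have "\<dots> = (\<Sum>n | f n \<noteq> 0. of_real (f n) * ?c (n - ?a)) + (\<Sum>n | f n \<noteq> 0. of_real (f n) * ?c (n - (- ?a)))
       - 2 * (\<Sum>n | f n \<noteq> 0. of_real (f n) * ?c (n - 0))"
    by (subst (1 2 3) sh) (auto simp: S_def)
  also have "\<dots> = (cis ?t + cis (- ?t) - 2) * fourier_int f \<xi>"
    unfolding c2 diff_minus_eq_add c1 fourier_int_def
    by (simp add: algebra_simps sum_distrib_left sum_distrib_right sum.distrib sum_subtractf)
  finally show ?thesis unfolding cis_second_difference by simp
qed

lemma riesz2_int_laplacian: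
  fixes f :: "int ^ 'n::finite \<Rightarrow> real"
  assumes f: "finsupp f"
  shows "riesz2_int j (\<lambda>n. - laplacian f n) = deriv_plus j (deriv_minus j f)"
proof
  fix n :: "int ^ 'n"
  define S where "S = (\<Union>i. {n. deriv_plus i (deriv_minus i f) n \<noteq> 0})"
  have S: "finite S" using finsupp_second_deriv[OF f] by (auto simp: S_def finsupp_def)
  have "laplacian f n = 0" if "n \<notin> S" for n using that by (auto simp: laplacian_def S_def)
  hence "fourier_int (\<lambda>n. - laplacian f n) \<xi> = (\<Sum>n\<in>S. of_real (- laplacian f n) * cnj (char_int n \<xi>))" for \<xi>
    by (intro fourier_int_superset[OF S]) auto
  moreover have "fourier_int (deriv_plus i (deriv_minus i f)) \<xi> =
      (\<Sum>n\<in>S. of_real (deriv_plus i (deriv_minus i f) n) * cnj (char_int n \<xi>))" for \<xi> i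
    by (intro fourier_int_superset[OF S]) (auto simp: S_def)
  ultimately have lap: "fourier_int (\<lambda>n. - laplacian f n) \<xi> =
     - (\<Sum>i\<in>UNIV. fourier_int (deriv_plus i (deriv_minus i f)) \<xi>)" for \<xi>
    by (simp only: laplacian_def of_real_minus of_real_sum mult_minus_left sum_negf sum_distrib_right)
      (subst sum.swap, rule refl)
  have "of_real (symbol_int j \<xi>) * fourier_int (\<lambda>n. - laplacian f n) \<xi> =
        fourier_int (deriv_plus j (deriv_minus j f)) \<xi>" for \<xi>
  proof -
    let ?s = "\<lambda>i. sin (pi * \<xi> $ i)"
    have "of_real (symbol_int j \<xi>) * fourier_int (\<lambda>n. - laplacian f n) \<xi> =
       of_real ((- 4 * (?s j)\<^sup>2 / (4 * (\<Sum>i\<in>UNIV. (?s i)\<^sup>2))) * (- (\<Sum>i\<in>UNIV. - 4 * (?s i)\<^sup>2))) * fourier_int f \<xi>"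
      unfolding lap fourier_int_second_deriv[OF f] symbol_int_def sum_distrib_right[symmetric]
      by (simp only: of_real_mult of_real_minus of_real_sum mult_minus_left mult_minus_right mult.assoc)
    also have "\<dots> = fourier_int (deriv_plus j (deriv_minus j f)) \<xi>"
      unfolding symbol_mult_sum[of ?s j] fourier_int_second_deriv[OF f] ..
    finally show ?thesis .
  qed
  thus "riesz2_int j (\<lambda>n. - laplacian f n) n = deriv_plus j (deriv_minus j f) n"
    unfolding riesz2_int_def
    by (simp only: fourier_int_inversion[OF finsupp_second_deriv[OF f]] Re_complex_of_real)
qed

lemma char_cyclic_zero [simp]: "char_cyclic n 0 = 1"
  by (simp add: char_cyclic_def)

lemma sum_symbol_cyclic:
  fixes \<xi> :: "'m::nontriv mod_ring ^ 'n::finite"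
  shows "(\<Sum>j\<in>UNIV. symbol_cyclic j \<xi>) = (if \<xi> = 0 then 0 else - 1)"
proof (cases "\<xi> = 0")
  case True
  thus ?thesis by (simp add: symbol_cyclic_def)
next
  case False
  then obtain i where "\<xi> $ i \<noteq> 0" by (auto simp: vec_eq_iff)
  hence i: "to_int_mod_ring (\<xi> $ i) \<noteq> 0" by simp
  have "to_int_mod_ring (\<xi> $ i) \<in> {0..<int CARD('m)}" by (metis range_to_int_mod_ring rangeI)
  hence k: "0 < to_int_mod_ring (\<xi> $ i)" "to_int_mod_ring (\<xi> $ i) < int CARD('m)"
    using i unfolding atLeastLessThan_iff by linarith+
  define t where "t = pi / real CARD('m) * of_int (to_int_mod_ring (\<xi> $ i))"
  have m: "real CARD('m) > 0" by simp
  have "real_of_int (to_int_mod_ring (\<xi> $ i)) < real CARD('m)" using k(2) by linarith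
  hence "0 < t" "t < pi" using k m by (auto simp: t_def field_simps)
  hence "sin t > 0" by (rule sin_gt_zero)
  hence "0 < (sin t)\<^sup>2" by simp
  also have "(sin t)\<^sup>2 \<le> (\<Sum>i\<in>UNIV. (sin (pi / real CARD('m) * of_int (to_int_mod_ring (\<xi> $ i))))\<^sup>2)"
    unfolding t_def by (rule member_le_sum[where f = "\<lambda>i. (sin (pi / real CARD('m) * of_int (to_int_mod_ring (\<xi> $ i))))\<^sup>2"]) auto
  finally show ?thesis using False
    by (simp add: symbol_cyclic_def sum_divide_distrib[symmetric] sum_distrib_left[symmetric] sum_negf)
qed

lemma riesz_cyclic_one:
  fixes f :: "'m::nontriv mod_ring ^ 'n::finite \<Rightarrow> real"
  shows "riesz_cyclic (\<chi> i. 1) f n = (\<Sum>k\<in>UNIV. f k) / (CARD('m) ^ CARD('n)) - f n"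
proof -
  let ?c = "of_nat (CARD('m) ^ CARD('n)) :: complex"
  let ?S = "\<lambda>i. \<Sum>\<xi>\<in>UNIV. of_real (symbol_cyclic i \<xi>) * (fourier_cyclic f \<xi> * char_cyclic n \<xi>)"
  have "riesz_cyclic (\<chi> i. 1) f n = (\<Sum>i\<in>UNIV. Re (?S i / ?c))"
    by (simp only: riesz_cyclic_def riesz2_cyclic_def mult.assoc vec_lambda_beta mult_1_left)
  also have "\<dots> = Re ((\<Sum>i\<in>UNIV. ?S i) / ?c)"
    by (simp only: Re_sum[symmetric] sum_divide_distrib)
  also have "(\<Sum>i\<in>UNIV. ?S i) =
      (\<Sum>\<xi>\<in>UNIV. of_real (\<Sum>i\<in>UNIV. symbol_cyclic i \<xi>) * (fourier_cyclic f \<xi> * char_cyclic n \<xi>))"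
    unfolding of_real_sum sum_distrib_right by (rule sum.swap)
  also have "(\<Sum>\<xi>\<in>UNIV. of_real (\<Sum>i\<in>UNIV. symbol_cyclic i \<xi>) * (fourier_cyclic f \<xi> * char_cyclic n \<xi>))
      = (\<Sum>\<xi>\<in>UNIV. (if \<xi> = 0 then fourier_cyclic f 0 else 0) - fourier_cyclic f \<xi> * char_cyclic n \<xi>)"
    by (intro sum.cong refl) (simp add: sum_symbol_cyclic)
  also have "\<dots> = fourier_cyclic f 0 - (\<Sum>\<xi>\<in>UNIV. fourier_cyclic f \<xi> * char_cyclic n \<xi>)"
    by (simp add: sum_subtractf)
  also have "\<dots> / ?c = fourier_cyclic f 0 / ?c - of_real (f n)"
    unfolding diff_divide_distrib fourier_cyclic_inversion ..
  also have "fourier_cyclic f 0 = of_real (\<Sum>k\<in>UNIV. f k)"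
    by (simp add: fourier_cyclic_def)
  also have "Re (of_real (\<Sum>k\<in>UNIV. f k) / ?c - of_real (f n)) = (\<Sum>k\<in>UNIV. f k) / (CARD('m) ^ CARD('n)) - f n"
  proof -
    have "?c = of_real (real CARD('m) ^ CARD('n))" by simp
    thus ?thesis by (simp only: of_real_divide[symmetric] of_real_diff[symmetric] Re_complex_of_real) simp
  qed
  finally show ?thesis .
qed

lemma riesz2_cyclic_const:
  "riesz2_cyclic j (\<lambda>_ :: 'm::nontriv mod_ring ^ 'n::finite. c) = (\<lambda>_. 0)"
proof
  fix n :: "'m mod_ring ^ 'n"
  have "fourier_cyclic (\<lambda>_. c) \<xi> = 0" if "\<xi> \<noteq> 0" for \<xi> :: "'m mod_ring ^ 'n"
  proof -
    have "char_cyclic k \<xi> = char_cyclic \<xi> k" for k by (simp add: char_cyclic_def mult_ac)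
    hence "fourier_cyclic (\<lambda>_. c) \<xi> = of_real c * (\<Sum>k\<in>UNIV. char_cyclic 0 k * cnj (char_cyclic \<xi> k))"
      by (simp add: fourier_cyclic_def sum_distrib_left char_cyclic_def)
    thus ?thesis using that by (simp only: char_cyclic_orthogonal) simp
  qed
  moreover have "symbol_cyclic j (0 :: 'm mod_ring ^ 'n) = 0" by (simp add: symbol_cyclic_def)
  ultimately have "of_real (symbol_cyclic j \<xi>) * fourier_cyclic (\<lambda>_. c) \<xi> = 0" for \<xi> :: "'m mod_ring ^ 'n"
    by (cases "\<xi> = 0") auto
  thus "riesz2_cyclic j (\<lambda>_. c) n = 0" by (simp only: riesz2_cyclic_def) simp
qed

text \<open>On \<open>(\<int> / m\<int>)\<^sup>N\<close> the nonzero constants are annihilated, so the Choi constant bounds the operator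
  on the mean zero functions but, if \<open>0\<close> lies outside the range \<open>[b, B]\<close> of the multipliers, not
  on the whole space: \<open>\<Sum>\<^sub>i R\<^sub>i\<^sup>2 f\<close> is the mean of \<open>f\<close> minus \<open>f\<close>, and already \<open>m = 2\<close>, \<open>N = 2\<close>,
  \<open>p = 3 / 2\<close> and a point mass \<open>f\<close> violate the bound \<open>choi_const 1 1 p \<le> 1\<close>.\<close>

lemma riesz_cyclic_mean_zero_necessary:
  defines "p \<equiv> 3 / 2"
  shows "\<exists>f :: bool mod_ring ^ bool \<Rightarrow> real.
           choi_const 1 1 p * lp_norm p f < lp_norm p (riesz_cyclic (\<chi> i. 1) f)"
proof
  define f :: "bool mod_ring ^ bool \<Rightarrow> real" where "f n = (if n = 0 then 1 else 0)" for n
  have lpn: "lp_norm p g = (\<Sum>n\<in>UNIV. \<bar>g n\<bar> powr p) powr (1 / p)" for g :: "bool mod_ring ^ bool \<Rightarrow> real"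
    unfolding Lp_norm_def by (subst lebesgue_integral_count_space_finite) auto
  have "(\<Sum>n\<in>UNIV. \<bar>f n\<bar> powr p) = (\<Sum>n\<in>(UNIV :: (bool mod_ring ^ bool) set). if n = 0 then 1 else 0)"
    by (intro sum.cong refl) (simp add: f_def)
  hence "lp_norm p f = 1" by (simp add: lpn)
  moreover have "lp_norm p (riesz_cyclic (\<chi> i. 1) f) > 1"
  proof -
    have half: "x powr p = x * sqrt x" if "x > 0" for x :: real
      using that powr_add[of x 1 "1/2"] by (simp add: p_def powr_half_sqrt)
    have R: "riesz_cyclic (\<chi> i. 1) f n = (if n = 0 then - 3 / 4 else 1 / 4)" for n
      unfolding riesz_cyclic_one by (simp add: f_def)
    have "(\<Sum>n\<in>UNIV. \<bar>riesz_cyclic (\<chi> i. 1) f n\<bar> powr p) =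
       (\<Sum>n\<in>(UNIV :: (bool mod_ring ^ bool) set). (1/4) powr p + (if n = 0 then (3/4) powr p - (1/4) powr p else 0))"
      by (intro sum.cong refl) (simp add: R)
    also have "\<dots> = 4 * (1/4) powr p + ((3/4) powr p - (1/4) powr p)"
      by (simp add: sum.distrib)
    also have "\<dots> = (3 * sqrt 3 + 3) / 8"
      by (simp add: half real_sqrt_divide)
    also have "\<dots> > 1"
    proof -
      have "5 / 3 < sqrt 3" by (rule real_less_rsqrt) (simp add: power2_eq_square)
      thus ?thesis by simp
    qed
    finally show ?thesis unfolding lpn by (rule gr_one_powr) (simp add: p_def)
  qed
  ultimately show "choi_const 1 1 p * lp_norm p f < lp_norm p (riesz_cyclic (\<chi> i. 1) f)"
    using choi_const_one[of p] by simp
qed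

end

theory Submission
  imports Defs "HOL-Real_Asymp.Real_Asymp"
begin

text \<open>
  Upper bound.  The multipliers of the lattice operators are realised by a random walk that moves in
  the coordinate directions one after the other: if \<open>Q\<^sub>k\<close> is the lazy average of step \<open>k\<close> and
  \<open>F\<^sub>k = Q\<^sub>k\<^sub>+\<^sub>1 \<dots> Q\<^sub>n f\<close>, then \<open>F\<^sub>k\<close> along the walk is a martingale, and the transform with the
  predictable multiplier \<open>\<alpha>\<^sub>i\<close> in the steps of direction \<open>i\<close>, conditioned on the end point, is a
  Fourier multiplier whose symbol tends to that of \<open>- R\<^sub>\<alpha>\<^sup>2\<close> as the time step tends to \<open>0\<close> and the time
  to infinity.  Multipliers in \<open>[b, B]\<close> reduce to \<open>{b, B}\<close> by convexity.

  Sharpness.  Write \<open>x = r + s\<close>, \<open>y = b r + B s\<close>, so that martingale transforms with values in \<open>{b, B}\<close>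
  move parallel to the axes of the \<open>(r, s)\<close> plane.  Taking the supremum of the averages of
  \<open>|b r + B s|\<^sup>p - K\<^sup>p |r + s|\<^sup>p\<close> over periodic perturbations of \<open>(r, s)\<close> by the two second differences of a
  function on \<open>\<int>\<^sup>2\<close> gives a majorant that is concave in each variable (by lamination) and, if \<open>K\<close> bounds the
  operator, nonpositive at the origin.  Such a biconcave majorant makes \<open>K\<close> an admissible constant
  for all martingales.
\<close>

section \<open>Biconcave majorants and martingale transforms\<close>

text \<open>Predictability is what forces the coordinate directions to be taken one at a time: if
  the direction were drawn at random in each step, the multiplier would depend on the very step that
  it multiplies. In a fixed rotation it is a function of time alone. Counting measure on the lattice
  is not a probability, so the walk starts uniformly on a finite set that contains every point from
  which the support can be reached. The initial value of the martingale needs a multiplier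
  \<open>t\<close> of its own. On the integer lattice its effect disappears in the limit, since only
  the null set \<open>\<xi> = 0\<close> remembers it; on the finite group it acts on the mean of
  \<open>f\<close>, which is where the mean zero condition, or \<open>0\<close> between
  \<open>b\<close> and \<open>B\<close>, enters. For sharpness the test functions are
  \<open>- laplacian u\<close>, on which the Riesz transforms become second differences, so that no
  continuum limit is taken. Finally, the Choi constant is an infimum, and some finite admissible
  constant has to be exhibited before it can be used; Burkholder's function provides one.\<close>

lemma powr_add_le:
  fixes a b p :: real
  assumes "0 \<le> a" "0 \<le> b" "0 \<le> p"
  shows "(a + b) powr p \<le> 2 powr p * (a powr p + b powr p)"
proof -
  have "(a + b) powr p \<le> (2 * max a b) powr p" using assms by (intro powr_mono2) auto
  also have "\<dots> = 2 powr p * max a b powr p" using assms by (simp add: powr_mult)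
  also have "max a b powr p \<le> a powr p + b powr p" by (auto simp: max_def)
  finally show ?thesis by simp
qed

lemma Lp_add:
  assumes "0 \<le> p" "f \<in> Lp p M" "g \<in> Lp p M"
  shows "(\<lambda>x. f x + g x) \<in> Lp p M"
proof -
  have [measurable]: "f \<in> borel_measurable M" "g \<in> borel_measurable M" using assms by (auto simp: Lp_def)
  have "integrable M (\<lambda>x. \<bar>f x + g x\<bar> powr p)"
  proof (rule Bochner_Integration.integrable_bound)
    show "integrable M (\<lambda>x. 2 powr p * (\<bar>f x\<bar> powr p + \<bar>g x\<bar> powr p))"
      using assms by (auto simp: Lp_def)
    show "AE x in M. norm (\<bar>f x + g x\<bar> powr p) \<le> norm (2 powr p * (\<bar>f x\<bar> powr p + \<bar>g x\<bar> powr p))"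
    proof (rule AE_I2)
      fix x
      have "\<bar>f x + g x\<bar> powr p \<le> (\<bar>f x\<bar> + \<bar>g x\<bar>) powr p" using assms by (intro powr_mono2) auto
      also have "\<dots> \<le> 2 powr p * (\<bar>f x\<bar> powr p + \<bar>g x\<bar> powr p)" using assms by (intro powr_add_le) auto
      finally show "norm (\<bar>f x + g x\<bar> powr p) \<le> norm (2 powr p * (\<bar>f x\<bar> powr p + \<bar>g x\<bar> powr p))"
        by simp
    qed
  qed measurable
  thus ?thesis by (simp add: Lp_def)
qed

lemma Lp_bound:
  assumes "0 \<le> p" "g \<in> Lp p M" and f [measurable]: "f \<in> borel_measurable M"
    and le: "\<And>x. x \<in> space M \<Longrightarrow> \<bar>f x\<bar> \<le> \<bar>g x\<bar>"
  shows "f \<in> Lp p M"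
proof -
  have "integrable M (\<lambda>x. \<bar>f x\<bar> powr p)"
  proof (rule Bochner_Integration.integrable_bound)
    show "integrable M (\<lambda>x. \<bar>g x\<bar> powr p)" using assms by (auto simp: Lp_def)
    show "AE x in M. norm (\<bar>f x\<bar> powr p) \<le> norm (\<bar>g x\<bar> powr p)"
      using le assms by (auto intro!: AE_I2 powr_mono2)
  qed measurable
  thus ?thesis by (simp add: Lp_def)
qed

lemma Lp_zero: "(\<lambda>_. 0) \<in> Lp p M"
  by (simp add: Lp_def)

lemma Lp_sum:
  assumes "0 \<le> p" "\<And>i. i \<in> I \<Longrightarrow> f i \<in> Lp p M"
  shows "(\<lambda>x. \<Sum>i\<in>I. f i x) \<in> Lp p M"
  using assms(2)
proof (induction I rule: infinite_finite_induct)
  case (insert i I)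
  thus ?case using Lp_add[OF assms(1), of "f i" M "\<lambda>x. \<Sum>i\<in>I. f i x"] by simp
qed (auto simp: Lp_zero)

lemma powr_le_cancel_iff_base:
  fixes x y p :: real
  assumes "0 < p" "0 \<le> x" "0 \<le> y"
  shows "x powr p \<le> y powr p \<longleftrightarrow> x \<le> y"
  using assms powr_mono2[of p x y] powr_less_mono2[of p y x] by (meson leD le_less_linear less_imp_le)

lemma Lp_norm_le_iff:
  assumes "0 < p" "0 \<le> K"
  shows "Lp_norm p M f \<le> K * Lp_norm p M g \<longleftrightarrow>
           (\<integral>x. \<bar>f x\<bar> powr p \<partial>M) \<le> K powr p * (\<integral>x. \<bar>g x\<bar> powr p \<partial>M)"
proof -
  let ?F = "\<integral>x. \<bar>f x\<bar> powr p \<partial>M" and ?G = "\<integral>x. \<bar>g x\<bar> powr p \<partial>M"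
  have F: "0 \<le> ?F" and G: "0 \<le> ?G" by (auto intro!: integral_nonneg)
  have "Lp_norm p M f \<le> K * Lp_norm p M g \<longleftrightarrow> (?F powr (1 / p)) powr p \<le> (K * ?G powr (1 / p)) powr p"
    unfolding Lp_norm_def using assms by (intro powr_le_cancel_iff_base[symmetric]) auto
  also have "\<dots> \<longleftrightarrow> ?F \<le> K powr p * ?G"
    using assms F G by (simp add: powr_mult powr_powr)
  finally show ?thesis .
qed

text \<open>The right derivative of a concave function, written as a countable supremum of
  difference quotients so that it stays measurable when \<open>\<phi>\<close> and \<open>r\<close>
  depend measurably on a parameter.\<close>

definition forward_slope :: "(real \<Rightarrow> real) \<Rightarrow> real \<Rightarrow> real" where
  "forward_slope \<phi> r = (SUP k. (\<phi> (r + 1 / real (Suc k)) - \<phi> r) * real (Suc k))"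

context
  fixes \<phi> :: "real \<Rightarrow> real"
  assumes concave: "concave_on UNIV \<phi>"
begin

lemma concave_two_points:
  "\<lbrakk>0 \<le> u; 0 \<le> v; u + v = 1\<rbrakk> \<Longrightarrow> u * \<phi> x + v * \<phi> y \<le> \<phi> (u * x + v * y)"
  using concave unfolding concave_on_iff by auto

lemma concave_slopes_le:
  assumes "0 < s" "0 < t"
  shows "(\<phi> (r + t) - \<phi> r) / t \<le> (\<phi> r - \<phi> (r - s)) / s"
proof -
  have "s / (s + t) * \<phi> (r + t) + t / (s + t) * \<phi> (r - s) \<le> \<phi> (s / (s + t) * (r + t) + t / (s + t) * (r - s))"
    using assms by (intro concave_two_points) (auto simp: add_divide_distrib[symmetric])
  also have "s / (s + t) * (r + t) + t / (s + t) * (r - s) = (r * (s + t)) / (s + t)"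
    by (simp add: add_divide_distrib[symmetric] algebra_simps)
  also have "\<dots> = r" using assms by simp
  finally have "(s * \<phi> (r + t) + t * \<phi> (r - s)) / (s + t) \<le> \<phi> r" by (simp add: add_divide_distrib)
  thus ?thesis using assms by (simp add: field_simps)
qed

lemma concave_slope_antimono:
  assumes "0 < s" "s \<le> t"
  shows "(\<phi> (r + t) - \<phi> r) / t \<le> (\<phi> (r + s) - \<phi> r) / s"
proof -
  have "s / t * \<phi> (r + t) + (1 - s / t) * \<phi> r \<le> \<phi> (s / t * (r + t) + (1 - s / t) * r)"
    using assms by (intro concave_two_points) auto
  also have "s / t * (r + t) + (1 - s / t) * r = r + s"
    using assms by (simp add: field_simps)
  finally show ?thesis using assms by (simp add: field_simps)
qed

lemma bdd_above_forward_slopes: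
  "bdd_above (range (\<lambda>k. (\<phi> (r + 1 / real (Suc k)) - \<phi> r) * real (Suc k)))"
  using concave_slopes_le[of 1 "1 / real (Suc _)" r] by (intro bdd_aboveI2[of _ _ "\<phi> r - \<phi> (r - 1)"]) simp

lemma forward_slope_le: "0 < s \<Longrightarrow> forward_slope \<phi> r \<le> (\<phi> r - \<phi> (r - s)) / s"
  unfolding forward_slope_def using concave_slopes_le[of s "1 / real (Suc _)" r]
  by (intro cSUP_least) simp_all

lemma forward_slope_ge:
  assumes "0 < t"
  shows "(\<phi> (r + t) - \<phi> r) / t \<le> forward_slope \<phi> r"
proof -
  obtain k where k: "inverse (real (Suc k)) < t" using reals_Archimedean[OF assms] by auto
  have "(\<phi> (r + t) - \<phi> r) / t \<le> (\<phi> (r + 1 / real (Suc k)) - \<phi> r) / (1 / real (Suc k))"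
    using k by (intro concave_slope_antimono) (auto simp: field_simps)
  also have "\<dots> \<le> forward_slope \<phi> r"
    unfolding forward_slope_def by (rule cSUP_upper2[OF bdd_above_forward_slopes, of k]) auto
  finally show ?thesis .
qed

lemma forward_slope_supergradient: "\<phi> (r + t) \<le> \<phi> r + forward_slope \<phi> r * t"
proof -
  consider "t = 0" | "t > 0" | "t < 0" by linarith
  thus ?thesis
  proof cases
    case 2
    thus ?thesis using forward_slope_ge[of t r] by (simp add: field_simps)
  next
    case 3
    thus ?thesis using forward_slope_le[of "- t" r] by (simp add: field_simps)
  qed simp
qed

text \<open>Comparison with the chords of length \<open>\<rho>\<close> on either side: a bound of
  order \<open>\<rho> powr p\<close> on the function becomes one of order
  \<open>\<rho> powr (p - 1)\<close> on its slope.\<close>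

lemma abs_forward_slope_le:
  assumes "1 \<le> \<rho>" "\<bar>\<phi> r\<bar> \<le> m" "\<bar>\<phi> (r + \<rho>)\<bar> \<le> m" "\<bar>\<phi> (r - \<rho>)\<bar> \<le> m"
  shows "\<bar>forward_slope \<phi> r\<bar> \<le> 2 * m / \<rho>"
proof (rule abs_leI)
  have "forward_slope \<phi> r \<le> (\<phi> r - \<phi> (r - \<rho>)) / \<rho>" using assms by (intro forward_slope_le) auto
  also have "\<dots> \<le> 2 * m / \<rho>" using assms by (intro divide_right_mono) auto
  finally show "forward_slope \<phi> r \<le> 2 * m / \<rho>" .
  have "- (2 * m) / \<rho> \<le> (\<phi> (r + \<rho>) - \<phi> r) / \<rho>" using assms by (intro divide_right_mono) auto
  also have "\<dots> \<le> forward_slope \<phi> r" using assms by (intro forward_slope_ge) auto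
  finally show "- forward_slope \<phi> r \<le> 2 * m / \<rho>" by simp
qed

end

text \<open>The increment \<open>d k\<close> is added to \<open>R\<close> where the multiplier is
  \<open>b\<close> and to \<open>S\<close> elsewhere, so each step of \<open>(R, S)\<close> is
  parallel to an axis, and in that direction \<open>Q\<close> lies below a tangent line whose slope
  is known before the step. The linear term has mean zero, hence the expectation of \<open>Q\<close>
  along the martingale never exceeds \<open>Q 0 0\<close>, and the majorant turns this into the norm
  inequality. The growth bound provides integrability.\<close>

lemma choi_bound_of_biconcave:
  fixes Q :: "real \<Rightarrow> real \<Rightarrow> real"
  assumes p: "1 < p" and K: "0 \<le> K"
    and meas: "(\<lambda>z. Q (fst z) (snd z)) \<in> borel_measurable borel"
    and concave1: "\<And>s. concave_on UNIV (\<lambda>r. Q r s)"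
    and concave2: "\<And>r. concave_on UNIV (\<lambda>s. Q r s)"
    and growth: "\<And>r s. \<bar>Q r s\<bar> \<le> c * (1 + \<bar>r\<bar> + \<bar>s\<bar>) powr p"
    and majorant: "\<And>r s. \<bar>b * r + B * s\<bar> powr p - K powr p * \<bar>r + s\<bar> powr p \<le> Q r s"
    and zero: "Q 0 0 \<le> 0"
  shows "choi_bound TYPE('a) b B p K"
  unfolding choi_bound_def
proof (intro allI impI)
  fix n :: nat and M :: "'a measure" and F d \<theta>
  assume n: "n \<ge> 1" and mt: "martingale_transform M F d \<theta> b B p"
  from mt interpret prob_space M by (simp add: martingale_transform_def)
  from mt interpret filtration "space M" F by (simp add: martingale_transform_def)
  from mt have subalg: "subalgebra M (F k)" for k by (simp add: martingale_transform_def)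
  from mt have d: "d k \<in> borel_measurable (F k)" "d k \<in> Lp p M"
      "AE \<omega> in M. real_cond_exp M (F (k - 1)) (d k) \<omega> = 0"
      "\<theta> k \<in> borel_measurable (F (k - 1))" "\<And>\<omega>. \<omega> \<in> space M \<Longrightarrow> \<theta> k \<omega> \<in> {b, B}" if "k \<ge> 1" for k
    using that by (auto simp: martingale_transform_def)
  have mono: "f \<in> borel_measurable (F i) \<Longrightarrow> i \<le> j \<Longrightarrow> f \<in> borel_measurable (F j)" for f :: "'a \<Rightarrow> real" and i j
    using sets_F_mono[of i j] space_F by (auto simp: measurable_def)
  have toM: "f \<in> borel_measurable (F i) \<Longrightarrow> f \<in> borel_measurable M" for f :: "'a \<Rightarrow> real" and i
    using subalg measurable_from_subalg by blast
  define e where "e k \<omega> = (if \<theta> k \<omega> = b then 1 else 0 :: real)" for k \<omega>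
  define R where "R k \<omega> = (\<Sum>j=1..k. e j \<omega> * d j \<omega>)" for k \<omega>
  define S where "S k \<omega> = (\<Sum>j=1..k. (1 - e j \<omega>) * d j \<omega>)" for k \<omega>
  have e: "e j \<in> borel_measurable (F (j - 1))" if "j \<ge> 1" for j
  proof -
    note [measurable] = d(4)[OF that]
    show ?thesis unfolding e_def by measurable
  qed
  have ed: "(\<lambda>\<omega>. e j \<omega> * d j \<omega>) \<in> borel_measurable (F k)" "(\<lambda>\<omega>. (1 - e j \<omega>) * d j \<omega>) \<in> borel_measurable (F k)"
    if "j \<ge> 1" "j \<le> k" for j k
    using mono[OF e[OF that(1)], of k] mono[OF d(1)[OF that(1)], of k] that by auto
  have ad: "R k \<in> borel_measurable (F k)" "S k \<in> borel_measurable (F k)" for k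
    unfolding R_def S_def using ed by (auto intro!: borel_measurable_sum)
  have Lp: "R k \<in> Lp p M" "S k \<in> Lp p M" for k
  proof -
    have "(\<lambda>\<omega>. e j \<omega> * d j \<omega>) \<in> Lp p M" "(\<lambda>\<omega>. (1 - e j \<omega>) * d j \<omega>) \<in> Lp p M" if "j \<ge> 1" for j
      using p by (auto intro!: Lp_bound[OF _ d(2)[OF that]] toM[OF ed(1)[OF that order_refl]] toM[OF ed(2)[OF that order_refl]])
        (auto simp: e_def)
    thus "R k \<in> Lp p M" "S k \<in> Lp p M"
      unfolding R_def S_def using p by (auto intro!: Lp_sum)
  qed
  have [measurable]: "R k \<in> borel_measurable M" "S k \<in> borel_measurable M" for k using Lp by (auto simp: Lp_def)
  define \<rho> where "\<rho> k \<omega> = 1 + \<bar>R k \<omega>\<bar> + \<bar>S k \<omega>\<bar>" for k \<omega>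
  have rho1: "1 \<le> \<rho> k \<omega>" for k \<omega> by (simp add: \<rho>_def)
  have rho_meas [measurable]: "\<rho> k \<in> borel_measurable M" for k unfolding \<rho>_def by measurable
  have rho: "\<rho> k \<in> Lp p M" for k
  proof -
    have "(\<lambda>\<omega>. \<bar>f \<omega>\<bar>) \<in> Lp p M" if "f \<in> Lp p M" for f using that by (auto simp: Lp_def)
    moreover have "(\<lambda>_. 1) \<in> Lp p M" by (simp add: Lp_def)
    ultimately show ?thesis unfolding \<rho>_def using Lp p by (intro Lp_add) auto
  qed
  have c: "0 \<le> c" using growth[of 0 0] by simp
  have Qm: "(\<lambda>\<omega>. Q (f \<omega>) (g \<omega>)) \<in> borel_measurable N"
    if "f \<in> borel_measurable N" "g \<in> borel_measurable N" for f g and N :: "'a measure"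
    using measurable_compose[OF borel_measurable_Pair[OF that] meas] by simp
  have intQ: "integrable M (\<lambda>\<omega>. Q (R k \<omega>) (S k \<omega>))" for k
  proof (rule Bochner_Integration.integrable_bound)
    show "integrable M (\<lambda>\<omega>. c * \<bar>\<rho> k \<omega>\<bar> powr p)" using rho by (auto simp: Lp_def)
    show "(\<lambda>\<omega>. Q (R k \<omega>) (S k \<omega>)) \<in> borel_measurable M" by (rule Qm) measurable
    show "AE x in M. norm (Q (R k x) (S k x)) \<le> norm (c * \<bar>\<rho> k x\<bar> powr p)"
      using growth c by (auto intro!: AE_I2 simp: \<rho>_def abs_mult)
  qed
  \<comment> \<open>The slope in the direction of the coming step; it is
    \<open>F k\<close>-measurable because \<open>\<theta> (Suc k)\<close> is.\<close>
  define G where "G k \<omega> = (if \<theta> (Suc k) \<omega> = b then forward_slope (\<lambda>r. Q r (S k \<omega>)) (R k \<omega>)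
      else forward_slope (\<lambda>s. Q (R k \<omega>) s) (S k \<omega>))" for k \<omega>
  have Gm: "G k \<in> borel_measurable (F k)" for k
  proof -
    note [measurable] = ad[of k] Qm
    have [measurable]: "\<theta> (Suc k) \<in> borel_measurable (F k)" using d(4)[of "Suc k"] by simp
    have 1: "(\<lambda>\<omega>. forward_slope (\<lambda>r. Q r (S k \<omega>)) (R k \<omega>)) \<in> borel_measurable (F k)"
      unfolding forward_slope_def
      by (rule borel_measurable_cSUP) (use bdd_above_forward_slopes[OF concave1] in auto)
    have 2: "(\<lambda>\<omega>. forward_slope (\<lambda>s. Q (R k \<omega>) s) (S k \<omega>)) \<in> borel_measurable (F k)"
      unfolding forward_slope_def
      by (rule borel_measurable_cSUP) (use bdd_above_forward_slopes[OF concave2] in auto)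
    show ?thesis unfolding G_def using 1 2 by measurable
  qed
  have Gb: "\<bar>G k \<omega>\<bar> \<le> 2 * (c * (2 * \<rho> k \<omega>) powr p) / \<rho> k \<omega>" for k \<omega>
  proof -
    have Q: "\<bar>Q r s\<bar> \<le> c * (2 * \<rho> k \<omega>) powr p" if "1 + \<bar>r\<bar> + \<bar>s\<bar> \<le> 2 * \<rho> k \<omega>" for r s
    proof -
      have "(1 + \<bar>r\<bar> + \<bar>s\<bar>) powr p \<le> (2 * \<rho> k \<omega>) powr p" using that p by (intro powr_mono2) auto
      thus ?thesis using growth[of r s] c by (meson mult_left_mono order_trans)
    qed
    have b: "\<bar>Q (R k \<omega>) (S k \<omega>)\<bar> \<le> c * (2 * \<rho> k \<omega>) powr p"
      "\<bar>Q (R k \<omega> + \<rho> k \<omega>) (S k \<omega>)\<bar> \<le> c * (2 * \<rho> k \<omega>) powr p"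
      "\<bar>Q (R k \<omega> - \<rho> k \<omega>) (S k \<omega>)\<bar> \<le> c * (2 * \<rho> k \<omega>) powr p"
      "\<bar>Q (R k \<omega>) (S k \<omega> + \<rho> k \<omega>)\<bar> \<le> c * (2 * \<rho> k \<omega>) powr p"
      "\<bar>Q (R k \<omega>) (S k \<omega> - \<rho> k \<omega>)\<bar> \<le> c * (2 * \<rho> k \<omega>) powr p"
      by - (rule Q; unfold \<rho>_def; smt (verit))+
    show ?thesis
      unfolding G_def
      using abs_forward_slope_le[OF concave1 rho1 b(1-3)] abs_forward_slope_le[OF concave2 rho1 b(1,4,5)] by simp
  qed
  have Gd: "integrable M (\<lambda>\<omega>. G k \<omega> * d (Suc k) \<omega>)" for k
  proof (rule Bochner_Integration.integrable_bound)
    have [measurable]: "G k \<in> borel_measurable M" "d (Suc k) \<in> borel_measurable M"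
      using toM[OF Gm] toM[OF d(1)[of "Suc k"]] by auto
    show "(\<lambda>\<omega>. G k \<omega> * d (Suc k) \<omega>) \<in> borel_measurable M" by measurable
    show "integrable M (\<lambda>\<omega>. 2 * c * 2 powr p * (\<bar>\<rho> k \<omega>\<bar> powr p + \<bar>d (Suc k) \<omega>\<bar> powr p))"
      using rho[of k] d(2)[of "Suc k"] by (auto simp: Lp_def)
    show "AE x in M. norm (G k x * d (Suc k) x) \<le> norm (2 * c * 2 powr p * (\<bar>\<rho> k x\<bar> powr p + \<bar>d (Suc k) x\<bar> powr p))"
    proof (rule AE_I2)
      fix x
      let ?d = "\<bar>d (Suc k) x\<bar>" and ?r = "\<rho> k x" and ?m = "max (\<rho> k x) \<bar>d (Suc k) x\<bar>"
      have r: "1 \<le> ?r" by (rule rho1)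
      \<comment> \<open>As \<open>G k\<close> is of order \<open>\<rho> powr (p - 1)\<close>, its
        product with \<open>d (Suc k)\<close> is, up to a constant, at most the \<open>p\<close>-th
        power of the larger of \<open>\<rho> k\<close> and \<open>|d (Suc k)|\<close>.\<close>
      have "?r powr p / ?r * ?d = ?r powr (p - 1) * ?d" using r by (simp add: powr_diff)
      also have "\<dots> \<le> ?m powr (p - 1) * ?m" using r p by (intro mult_mono powr_mono2) auto
      also have "\<dots> = ?m powr p" using r by (simp add: powr_diff)
      also have "\<dots> \<le> \<bar>?r\<bar> powr p + ?d powr p" using r by (auto simp: max_def)
      finally have *: "?r powr p / ?r * ?d \<le> \<bar>?r\<bar> powr p + ?d powr p" .
      have "norm (G k x * d (Suc k) x) \<le> 2 * (c * (2 * ?r) powr p) / ?r * ?d"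
        unfolding real_norm_def abs_mult by (intro mult_right_mono Gb) auto
      also have "\<dots> = 2 * c * 2 powr p * (?r powr p / ?r * ?d)" using r by (simp add: powr_mult)
      also have "\<dots> \<le> 2 * c * 2 powr p * (\<bar>?r\<bar> powr p + ?d powr p)" using c by (intro mult_left_mono *) auto
      finally show "norm (G k x * d (Suc k) x) \<le> norm (2 * c * 2 powr p * (\<bar>?r\<bar> powr p + ?d powr p))"
        by simp
    qed
  qed
  have Gd0: "(\<integral>\<omega>. G k \<omega> * d (Suc k) \<omega> \<partial>M) = 0" for k
  proof -
    interpret S: finite_measure_subalgebra M "F k" by standard (rule subalg)
    have dm: "d (Suc k) \<in> borel_measurable M" using d(2)[of "Suc k"] by (simp add: Lp_def)
    have "(\<integral>\<omega>. G k \<omega> * d (Suc k) \<omega> \<partial>M) = (\<integral>\<omega>. G k \<omega> * real_cond_exp M (F k) (d (Suc k)) \<omega> \<partial>M)"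
      by (rule S.real_cond_exp_intg(2)[symmetric, OF Gd Gm dm])
    also have "\<dots> = (\<integral>\<omega>. 0 \<partial>M)"
      by (rule integral_cong_AE) (use d(3)[of "Suc k"] toM[OF Gm] in auto)
    finally show ?thesis by simp
  qed
  have step: "Q (R (Suc k) \<omega>) (S (Suc k) \<omega>) \<le> Q (R k \<omega>) (S k \<omega>) + G k \<omega> * d (Suc k) \<omega>" for k \<omega>
    using forward_slope_supergradient[OF concave1[of "S k \<omega>"], of "R k \<omega>" "d (Suc k) \<omega>"]
      forward_slope_supergradient[OF concave2[of "R k \<omega>"], of "S k \<omega>" "d (Suc k) \<omega>"]
    by (simp add: R_def S_def G_def e_def)
  have EQ: "(\<integral>\<omega>. Q (R k \<omega>) (S k \<omega>) \<partial>M) \<le> 0" for k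
  proof (induction k)
    case 0
    thus ?case using zero by (simp add: R_def S_def prob_space)
  next
    case (Suc k)
    have "(\<integral>\<omega>. Q (R (Suc k) \<omega>) (S (Suc k) \<omega>) \<partial>M) \<le> (\<integral>\<omega>. Q (R k \<omega>) (S k \<omega>) + G k \<omega> * d (Suc k) \<omega> \<partial>M)"
      using intQ Gd step by (intro integral_mono) auto
    also have "\<dots> = (\<integral>\<omega>. Q (R k \<omega>) (S k \<omega>) \<partial>M)"
      using intQ Gd Gd0 by simp
    finally show ?case using Suc by simp
  qed
  have RS: "(\<Sum>k=1..n. d k \<omega>) = R n \<omega> + S n \<omega>" for \<omega>
    unfolding R_def S_def sum.distrib[symmetric] by (intro sum.cong) (auto simp: algebra_simps)
  have tRS: "(\<Sum>k=1..n. \<theta> k \<omega> * d k \<omega>) = b * R n \<omega> + B * S n \<omega>" if "\<omega> \<in> space M" for \<omega>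
    unfolding R_def S_def sum_distrib_left sum.distrib[symmetric]
    by (intro sum.cong refl) (use d(5)[OF _ that] in \<open>auto simp: e_def\<close>)
  have int: "integrable M (\<lambda>\<omega>. \<bar>R n \<omega> + S n \<omega>\<bar> powr p)" "integrable M (\<lambda>\<omega>. \<bar>b * R n \<omega> + B * S n \<omega>\<bar> powr p)"
  proof -
    have "(\<lambda>\<omega>. a * f \<omega>) \<in> Lp p M" if "f \<in> Lp p M" for a f
      using that by (auto simp: Lp_def abs_mult powr_mult)
    thus "integrable M (\<lambda>\<omega>. \<bar>R n \<omega> + S n \<omega>\<bar> powr p)" "integrable M (\<lambda>\<omega>. \<bar>b * R n \<omega> + B * S n \<omega>\<bar> powr p)"
      using Lp_add[of p "R n" M "S n"] Lp_add[of p "\<lambda>\<omega>. b * R n \<omega>" M "\<lambda>\<omega>. B * S n \<omega>"] Lp p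
      by (auto simp: Lp_def)
  qed
  have "(\<integral>\<omega>. \<bar>\<Sum>k=1..n. \<theta> k \<omega> * d k \<omega>\<bar> powr p \<partial>M) = (\<integral>\<omega>. \<bar>b * R n \<omega> + B * S n \<omega>\<bar> powr p \<partial>M)"
    by (intro Bochner_Integration.integral_cong refl) (simp only: tRS)
  also have "\<dots> \<le> (\<integral>\<omega>. Q (R n \<omega>) (S n \<omega>) + K powr p * \<bar>R n \<omega> + S n \<omega>\<bar> powr p \<partial>M)"
    using int intQ majorant[of "R n _" "S n _"] by (intro integral_mono) (auto simp: diff_le_eq)
  also have "\<dots> \<le> K powr p * (\<integral>\<omega>. \<bar>R n \<omega> + S n \<omega>\<bar> powr p \<partial>M)"
    using int intQ EQ[of n] by simp
  finally show "Lp_norm p M (\<lambda>\<omega>. \<Sum>k=1..n. \<theta> k \<omega> * d k \<omega>) \<le> K * Lp_norm p M (\<lambda>\<omega>. \<Sum>k=1..n. d k \<omega>)"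
    unfolding RS using p K by (subst Lp_norm_le_iff) auto
qed

section \<open>Burkholder's function\<close>

text \<open>Young's inequality for \<open>|a|\<close> and \<open>|c| powr (p - 1)\<close> with the
  exponents \<open>p\<close> and \<open>p / (p - 1)\<close>. In this form convexity later replaces
  the conditional Jensen inequality.\<close>

lemma powr_tangent_line:
  fixes a c p :: real
  assumes "1 < p"
  shows "\<bar>c\<bar> powr p + p * (sgn c * \<bar>c\<bar> powr (p - 1)) * (a - c) \<le> \<bar>a\<bar> powr p"
proof (cases "c = 0")
  case False
  define q where "q = p / (p - 1)"
  have q: "1 / p + 1 / q = 1" "1 < q" using assms by (auto simp: q_def field_simps)
  have "\<bar>a\<bar> * \<bar>c\<bar> powr (p - 1) \<le> \<bar>a\<bar> powr p / p + (\<bar>c\<bar> powr (p - 1)) powr q / q"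
    using assms q by (intro Youngs_inequality) auto
  also have "(\<bar>c\<bar> powr (p - 1)) powr q = \<bar>c\<bar> powr p"
    using assms by (simp add: powr_powr q_def)
  finally have "p * (\<bar>a\<bar> * \<bar>c\<bar> powr (p - 1)) \<le> p * (\<bar>a\<bar> powr p / p + \<bar>c\<bar> powr p / q)"
    using assms by (intro mult_left_mono) auto
  also have "\<dots> = \<bar>a\<bar> powr p + (p - 1) * \<bar>c\<bar> powr p"
    using assms by (simp add: q_def field_simps)
  finally have "p * (\<bar>a\<bar> * \<bar>c\<bar> powr (p - 1)) \<le> \<bar>a\<bar> powr p + (p - 1) * \<bar>c\<bar> powr p" .
  moreover have "p * ((sgn c * a) * \<bar>c\<bar> powr (p - 1)) \<le> p * (\<bar>a\<bar> * \<bar>c\<bar> powr (p - 1))"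
    using assms by (intro mult_left_mono mult_right_mono) (auto simp: sgn_if)
  moreover have "p * (sgn c * \<bar>c\<bar> powr (p - 1)) * (a - c) =
      p * ((sgn c * a) * \<bar>c\<bar> powr (p - 1)) - p * \<bar>c\<bar> powr p"
  proof -
    have "\<bar>c\<bar> powr (p - 1) * (sgn c * c) = \<bar>c\<bar> powr p"
      using False by (simp add: powr_diff abs_sgn[symmetric] mult.commute[of "sgn c"])
    thus ?thesis by (simp add: algebra_simps)
  qed
  ultimately show ?thesis by (simp add: left_diff_distrib)
qed (use assms in auto)

lemma abs_powr_convex:
  fixes a c p u v :: real
  assumes "1 < p" "0 \<le> u" "0 \<le> v" "u + v = 1"
  shows "\<bar>u * a + v * c\<bar> powr p \<le> u * \<bar>a\<bar> powr p + v * \<bar>c\<bar> powr p"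
proof -
  let ?m = "u * a + v * c"
  let ?g = "p * (sgn ?m * \<bar>?m\<bar> powr (p - 1))"
  have "u * (\<bar>?m\<bar> powr p + ?g * (a - ?m)) + v * (\<bar>?m\<bar> powr p + ?g * (c - ?m))
      \<le> u * \<bar>a\<bar> powr p + v * \<bar>c\<bar> powr p"
    using assms powr_tangent_line[of p ?m] by (intro add_mono mult_left_mono) auto
  also have "u * (\<bar>?m\<bar> powr p + ?g * (a - ?m)) + v * (\<bar>?m\<bar> powr p + ?g * (c - ?m))
      = (u + v) * \<bar>?m\<bar> powr p + ?g * (?m - (u + v) * ?m)"
    by (simp add: algebra_simps)
  finally show ?thesis using assms by simp
qed

lemma concave_on_compose_antimono:
  fixes \<psi> m :: "real \<Rightarrow> real"
  assumes \<psi>: "concave_on {s..} \<psi>" and anti: "\<And>x y. s \<le> x \<Longrightarrow> x \<le> y \<Longrightarrow> \<psi> y \<le> \<psi> x"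
    and m: "convex_on UNIV m" "\<And>x. s \<le> m x"
  shows "concave_on UNIV (\<lambda>x. \<psi> (m x))"
  unfolding concave_on_iff
proof (intro conjI ballI allI impI)
  fix x y u v :: real assume uv: "0 \<le> u" "0 \<le> v" "u + v = 1"
  have "u * \<psi> (m x) + v * \<psi> (m y) \<le> \<psi> (u * m x + v * m y)"
    using \<psi> m(2) uv unfolding concave_on_iff by auto
  also have "\<dots> \<le> \<psi> (m (u * x + v * y))"
  proof (rule anti)
    show "s \<le> m (u * x + v * y)" by (rule m)
    show "m (u * x + v * y) \<le> u * m x + v * m y"
      using m(1) uv unfolding convex_on_def by auto
  qed
  finally show "u * \<psi> (m x) + v * \<psi> (m y) \<le> \<psi> (m (u *\<^sub>R x + v *\<^sub>R y))" by simp
qed auto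

text \<open>The branches of Burkholder's function for \<open>|r| > s\<close>, less the linear piece
  on \<open>|r| \<le> s\<close>, have this shape. For \<open>s > 0\<close> the hypothesis on
  \<open>c\<close> makes the derivative at \<open>s\<close> nonpositive, and the second derivative
  nonpositive from \<open>s\<close> on. The case \<open>s = 0\<close> is separate because the
  derivatives involve powers that may be singular at \<open>0\<close>.\<close>

lemma burkholder_branch:
  fixes a c s p k :: real
  assumes p: "1 < p" and s: "0 \<le> s" and a: "0 \<le> a" and c: "c * (p - 2) \<le> a * p"
  defines "\<psi> \<equiv> \<lambda>x. k - a * x powr p + c * s * x powr (p - 1) - c * s powr (p - 1) * x"
  shows "concave_on {s..} \<psi>" "\<And>x y. s \<le> x \<Longrightarrow> x \<le> y \<Longrightarrow> \<psi> y \<le> \<psi> x"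
proof -
  have "concave_on {s..} \<psi> \<and> (\<forall>x y. s \<le> x \<longrightarrow> x \<le> y \<longrightarrow> \<psi> y \<le> \<psi> x)"
  proof (cases "s = 0")
    case True
    have \<psi>: "\<psi> x = k - a * \<bar>x\<bar> powr p" if "x \<ge> s" for x using True p that by (simp add: \<psi>_def)
    have "concave_on {s..} \<psi>"
      unfolding concave_on_iff
    proof (intro conjI ballI allI impI)
      fix x y u v :: real assume uv: "0 \<le> u" "0 \<le> v" "u + v = 1" and xy: "x \<in> {s..}" "y \<in> {s..}"
      have xy': "u * x + v * y \<ge> s" using uv xy True by auto
      have "a * \<bar>u * x + v * y\<bar> powr p \<le> a * (u * \<bar>x\<bar> powr p + v * \<bar>y\<bar> powr p)"
        using a p uv by (intro mult_left_mono abs_powr_convex) auto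
      moreover have "u * k + v * k = k" using uv by (simp add: distrib_right[symmetric])
      ultimately show "u * \<psi> x + v * \<psi> y \<le> \<psi> (u *\<^sub>R x + v *\<^sub>R y)"
        using xy xy' by (simp add: \<psi> algebra_simps)
    qed auto
    moreover have "\<psi> y \<le> \<psi> x" if "s \<le> x" "x \<le> y" for x y
      using that True p a by (auto simp: \<psi> intro!: mult_left_mono powr_mono2)
    ultimately show ?thesis by blast
  next
    case False
    hence s: "0 < s" using s by simp
    define \<psi>' where "\<psi>' x = - a * p * x powr (p - 1) + c * s * (p - 1) * x powr (p - 2) - c * s powr (p - 1)" for x
    define \<psi>'' where "\<psi>'' x = - a * p * (p - 1) * x powr (p - 2) + c * s * (p - 1) * (p - 2) * x powr (p - 3)" for x
    have d1: "(\<psi> has_real_derivative \<psi>' x) (at x)" if "s \<le> x" for x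
    proof -
      have x: "x > 0" using that s by simp
      show ?thesis
        unfolding \<psi>_def \<psi>'_def
        by (rule derivative_eq_intros has_real_derivative_powr[OF x] refl)+ (simp add: algebra_simps)
    qed
    have d2: "(\<psi>' has_real_derivative \<psi>'' x) (at x)" if "s \<le> x" for x
    proof -
      have x: "x > 0" using that s by simp
      show ?thesis
        unfolding \<psi>'_def \<psi>''_def
        by (rule derivative_eq_intros has_real_derivative_powr[OF x] refl)+ (simp add: algebra_simps)
    qed
    have neg: "\<psi>'' x \<le> 0" if "s \<le> x" for x
    proof -
      have x: "x > 0" using that s by simp
      have "c * (p - 2) * s \<le> a * p * x"
      proof (cases "c * (p - 2) \<ge> 0")
        case True
        show ?thesis by (rule mult_mono[OF c that]) (use True c s in auto)
      next
        case False
        hence "c * (p - 2) * s \<le> 0" using s by (simp add: mult_nonpos_nonneg)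
        also have "0 \<le> a * p * x" using a p x by simp
        finally show ?thesis .
      qed
      hence "(p - 1) * x powr (p - 3) * (c * (p - 2) * s - a * p * x) \<le> 0"
        using p by (intro mult_nonneg_nonpos) auto
      moreover have "x powr (p - 2) = x powr (p - 3) * x"
        using x powr_add[of x "p - 3" 1] by simp
      ultimately show ?thesis unfolding \<psi>''_def by (simp add: algebra_simps)
    qed
    have conc: "concave_on {s..} \<psi>"
      by (rule f''_le0_imp_concave[OF _ d1 d2 neg]) auto
    have "\<psi>' s \<le> 0"
    proof -
      have "\<psi>' s = s powr (p - 1) * (c * (p - 2) - a * p)"
        using s powr_add[of s "p - 2" 1] by (simp add: \<psi>'_def algebra_simps)
      thus ?thesis using c by (simp add: mult_nonneg_nonpos)
    qed
    have neg': "\<psi>' x \<le> 0" if "s \<le> x" for x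
    proof -
      have "\<psi>' x \<le> \<psi>' s"
        proof (rule DERIV_nonpos_imp_nonincreasing[OF that])
        fix z assume "s \<le> z" "z \<le> x"
        thus "\<exists>y. (\<psi>' has_real_derivative y) (at z) \<and> y \<le> 0" using d2[of z] neg[of z] by auto
      qed
      thus ?thesis using \<open>\<psi>' s \<le> 0\<close> by simp
    qed
    have "\<psi> y \<le> \<psi> x" if "s \<le> x" "x \<le> y" for x y
    proof (rule DERIV_nonpos_imp_nonincreasing[OF that(2)])
      fix z assume "x \<le> z" "z \<le> y"
      thus "\<exists>y. (\<psi> has_real_derivative y) (at z) \<and> y \<le> 0" using d1[of z] neg'[of z] that by auto
    qed
    thus ?thesis using conc by blast
  qed
  thus "concave_on {s..} \<psi>" "\<And>x y. s \<le> x \<Longrightarrow> x \<le> y \<Longrightarrow> \<psi> y \<le> \<psi> x" by blast+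
qed

text \<open>With \<open>x = r + s\<close> and \<open>y = s - r\<close> one has
  \<open>2 * max |r| |s| = |x| + |y|\<close>, so up to the factor \<open>2 powr (1 - p)\<close> this
  is Burkholder's \<open>(|y| - A * |x|) * (|x| + |y|) powr (p - 1)\<close>. Zigzag moves, with
  \<open>x + y\<close> or \<open>x - y\<close> constant, are moves of a single one of
  \<open>r\<close> and \<open>s\<close>.\<close>

definition burkholder :: "real \<Rightarrow> real \<Rightarrow> real \<Rightarrow> real \<Rightarrow> real" where
  "burkholder p A r s = (\<bar>s - r\<bar> - A * \<bar>r + s\<bar>) * max \<bar>r\<bar> \<bar>s\<bar> powr (p - 1)"

lemma burkholder_commute: "burkholder p A r s = burkholder p A s r"
  by (simp add: burkholder_def abs_minus_commute add.commute max.commute)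

lemma burkholder_minus: "burkholder p A (- r) (- s) = burkholder p A r s"
proof -
  have "\<bar>- s - - r\<bar> = \<bar>s - r\<bar>" "\<bar>- r + - s\<bar> = \<bar>r + s\<bar>" by arith+
  thus ?thesis by (simp add: burkholder_def)
qed

text \<open>On \<open>|r| \<le> s\<close> the function is linear in \<open>r\<close>. Beyond the two
  corners it differs from this linear function by \<open>P\<close> on the right and by
  \<open>M\<close> on the left, both concave, nonincreasing and zero at \<open>s\<close>. The
  condition of \<open>burkholder_branch\<close> reads \<open>1 \<le> A * (p - 1)\<close> for
  \<open>P\<close> and \<open>p - 1 \<le> A\<close> for \<open>M\<close>.\<close>

lemma concave_on_burkholder_nonneg:
  assumes p: "1 < p" and A: "p - 1 \<le> A" "1 \<le> A * (p - 1)" and s: "0 \<le> s"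
  shows "concave_on UNIV (\<lambda>r. burkholder p A r s)"
proof -
  have A1: "1 \<le> A"
  proof (rule ccontr)
    assume "\<not> 1 \<le> A"
    hence "p - 1 < 1" using A by simp
    moreover have "0 < A" using A p by simp
    ultimately have "A * (p - 1) < 1 * 1" using p \<open>\<not> 1 \<le> A\<close> by (intro mult_strict_mono') auto
    thus False using A by simp
  qed
  define \<psi> where "\<psi> k c x = k - (A - 1) * x powr p + c * s * x powr (p - 1) - c * s powr (p - 1) * x" for k c x
  define l where "l r = ((s - r) - A * (r + s)) * s powr (p - 1)" for r
  define P where "P = \<psi> (- ((1 - A) * s powr p)) (- (1 + A))"
  define M where "M = \<psi> (- ((1 - A) * s powr p)) (1 + A)"
  have ss: "s powr (p - 1) * s = s powr p"
    using powr_mult_base[OF s, of "p - 1"] by (simp add: mult.commute)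
  have xx: "x powr (p - 1) * x = x powr p" if "x \<ge> 0" for x :: real
    using powr_mult_base[OF that, of "p - 1"] by (simp add: mult.commute)
  have P: "P x = ((x - s) - A * (x + s)) * x powr (p - 1) - ((s - x) - A * (x + s)) * s powr (p - 1)" if "x \<ge> 0" for x
    unfolding P_def \<psi>_def ss[symmetric] xx[OF that, symmetric] by (simp add: algebra_simps)
  have M: "M x = ((x + s) - A * (x - s)) * x powr (p - 1) - ((s + x) - A * (s - x)) * s powr (p - 1)" if "x \<ge> 0" for x
    unfolding M_def \<psi>_def ss[symmetric] xx[OF that, symmetric] by (simp add: algebra_simps)
  have Ps: "P s = 0" "M s = 0" using P[OF s] M[OF s] by auto
  have eq: "burkholder p A r s = l r + P (max r s) + M (max (- r) s)" for r
  proof -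
    consider "\<bar>r\<bar> \<le> s" | "r > s" | "r < - s" by linarith
    thus ?thesis
    proof cases
      case 1
      thus ?thesis using s Ps by (simp add: burkholder_def l_def max_absorb2)
    next
      case 2
      thus ?thesis using s Ps by (simp add: burkholder_def l_def max_absorb1 max_absorb2 P algebra_simps)
    next
      case 3
      hence "\<bar>r + s\<bar> = - r - s" "\<bar>s - r\<bar> = s - r" "max \<bar>r\<bar> \<bar>s\<bar> = - r" "max r s = s" "max (- r) s = - r" "0 \<le> - r"
        using s by auto
      thus ?thesis using Ps by (simp add: burkholder_def l_def M algebra_simps)
    qed
  qed
  have "- (1 + A) * (p - 2) \<le> (A - 1) * p" using A by (simp add: algebra_simps)
  note P' = burkholder_branch[OF p s _ this, where k = "- ((1 - A) * s powr p)", folded \<psi>_def, folded P_def]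
  have "(1 + A) * (p - 2) \<le> (A - 1) * p" using A by (simp add: algebra_simps)
  note M' = burkholder_branch[OF p s _ this, where k = "- ((1 - A) * s powr p)", folded \<psi>_def, folded M_def]
  have max_le: "max (u * x + v * y) s \<le> u * max x s + v * max y s"
    if "0 \<le> u" "0 \<le> v" "u + v = 1" for u v x y :: real
  proof -
    have "s = u * s + v * s" using that by (simp add: distrib_right[symmetric])
    also have "\<dots> \<le> u * max x s + v * max y s" using that by (intro add_mono mult_left_mono) auto
    finally show ?thesis using that by (auto intro!: add_mono mult_left_mono)
  qed
  have "convex_on UNIV (\<lambda>r. max r s)" "convex_on UNIV (\<lambda>r. max (- r) s)"
    unfolding convex_on_def using max_le max_le[of _ _ "- _" "- _"] by auto
  hence "concave_on UNIV (\<lambda>r. P (max r s))" "concave_on UNIV (\<lambda>r. M (max (- r) s))"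
    using concave_on_compose_antimono[of s P "\<lambda>r. max r s"] concave_on_compose_antimono[of s M "\<lambda>r. max (- r) s"]
      P' M' A1 by auto
  moreover have "concave_on UNIV l"
    unfolding concave_on_iff l_def
  proof (intro conjI ballI allI impI)
    fix x y u v :: real assume "u + v = 1"
    hence v: "v = 1 - u" by simp
    show "u * (((s - x) - A * (x + s)) * s powr (p - 1)) + v * (((s - y) - A * (y + s)) * s powr (p - 1))
      \<le> ((s - (u *\<^sub>R x + v *\<^sub>R y)) - A * (u *\<^sub>R x + v *\<^sub>R y + s)) * s powr (p - 1)"
      unfolding v by (simp add: algebra_simps)
  qed auto
  ultimately show ?thesis unfolding eq by (intro concave_on_add)
qed

lemma concave_on_burkholder:
  assumes "1 < p" "p - 1 \<le> A" "1 \<le> A * (p - 1)"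
  shows "concave_on UNIV (\<lambda>r. burkholder p A r s)" "concave_on UNIV (\<lambda>s. burkholder p A r s)"
proof -
  have "concave_on UNIV (\<lambda>r. burkholder p A r s)" for s
  proof (cases "0 \<le> s")
    case False
    hence "concave_on UNIV (\<lambda>r. burkholder p A r (- s))"
      using assms by (intro concave_on_burkholder_nonneg) auto
    hence *: "u * burkholder p A (- x) (- s) + v * burkholder p A (- y) (- s) \<le> burkholder p A (u * (- x) + v * (- y)) (- s)"
      if "0 \<le> u" "0 \<le> v" "u + v = 1" for u v x y
      using that unfolding concave_on_iff real_scaleR_def by blast
    have e: "u * (- x) + v * (- y) = - (u * x + v * y)" for u v x y :: real by simp
    show ?thesis using *[unfolded e burkholder_minus] unfolding concave_on_iff by simp
  qed (use concave_on_burkholder_nonneg assms in blast)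
  thus "concave_on UNIV (\<lambda>r. burkholder p A r s)" "concave_on UNIV (\<lambda>s. burkholder p A r s)"
    by (auto simp: burkholder_commute[of p A r])
qed

text \<open>Where \<open>y\<close> is at least \<open>2 * A * x\<close>, both
  \<open>y - A * x\<close> and the maximum \<open>m\<close> are at least \<open>y / 2\<close>, which
  explains the constant \<open>2 powr p\<close>. Elsewhere \<open>y\<close> is bounded by a multiple
  of \<open>x\<close>, and the term with \<open>k\<close> pays for \<open>y\<close> as well as for
  the negative part of the function.\<close>

lemma burkholder_majorant:
  assumes p: "1 < p" and A: "0 \<le> A"
  shows "\<exists>c k. 0 \<le> c \<and> 0 \<le> k \<and> (\<forall>r s. \<bar>s - r\<bar> powr p \<le> c * burkholder p A r s + k * \<bar>r + s\<bar> powr p)"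
proof (intro exI conjI allI)
  let ?c = "2 powr p" and ?k = "(2 * A) powr p + 2 powr p * (A * (1 + 2 * A) powr (p - 1))"
  show "0 \<le> ?c" "0 \<le> ?k" using A by auto
  fix r s :: real
  define x y m where "x = \<bar>r + s\<bar>" and "y = \<bar>s - r\<bar>" and "m = max \<bar>r\<bar> \<bar>s\<bar>"
  have xx: "z powr (p - 1) * z = z powr p" if "z \<ge> 0" for z :: real
    using powr_mult_base[OF that, of "p - 1"] by (simp add: mult.commute)
  have m: "y \<le> 2 * m" "2 * m = x + y" "0 \<le> x" "0 \<le> y" by (auto simp: x_def y_def m_def)
  have b: "burkholder p A r s = (y - A * x) * m powr (p - 1)" by (simp add: burkholder_def x_def y_def m_def)
  have "y powr p \<le> ?c * ((y - A * x) * m powr (p - 1)) + ?k * x powr p"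
  proof (cases "2 * A * x \<le> y")
    case True
    have "y powr p = 2 powr p * ((y / 2) * (y / 2) powr (p - 1))"
      using m xx[of "y / 2"] by (simp add: powr_divide mult.commute)
    also have "\<dots> \<le> 2 powr p * ((y - A * x) * m powr (p - 1))"
      using True m A p by (intro mult_left_mono mult_mono powr_mono2) auto
    also have "\<dots> \<le> \<dots> + ?k * x powr p" using A by simp
    finally show ?thesis .
  next
    case False
    have "y powr p \<le> (2 * A * x) powr p" using False m p by (intro powr_mono2) auto
    also have "\<dots> = (2 * A) powr p * x powr p" using A m by (simp add: powr_mult)
    finally have 1: "y powr p \<le> (2 * A) powr p * x powr p" .
    have "A * x * m powr (p - 1) \<le> A * x * ((1 + 2 * A) * x) powr (p - 1)"
      using m False A p by (intro mult_left_mono powr_mono2) (auto simp: algebra_simps)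
    also have "\<dots> = A * (1 + 2 * A) powr (p - 1) * (x powr (p - 1) * x)" using A m by (simp add: powr_mult)
    also have "\<dots> = A * (1 + 2 * A) powr (p - 1) * x powr p" using m by (simp only: xx)
    finally have "2 powr p * (A * x * m powr (p - 1)) \<le> 2 powr p * (A * (1 + 2 * A) powr (p - 1) * x powr p)"
      by (intro mult_left_mono) auto
    moreover have "0 \<le> 2 powr p * (y * m powr (p - 1))" using m by simp
    ultimately show ?thesis using 1 by (simp add: algebra_simps)
  qed
  thus "\<bar>s - r\<bar> powr p \<le> ?c * burkholder p A r s + ?k * \<bar>r + s\<bar> powr p"
    by (simp only: b) (simp add: x_def y_def)
qed

lemma abs_burkholder_le:
  assumes p: "1 < p" and A: "0 \<le> A"
  shows "\<bar>burkholder p A r s\<bar> \<le> (1 + A) * (1 + \<bar>r\<bar> + \<bar>s\<bar>) powr p"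
proof -
  let ?\<rho> = "1 + \<bar>r\<bar> + \<bar>s\<bar>"
  have "\<bar>\<bar>s - r\<bar> - A * \<bar>r + s\<bar>\<bar> \<le> \<bar>s - r\<bar> + A * \<bar>r + s\<bar>" using A by (auto simp: abs_if)
  also have "\<dots> \<le> ?\<rho> + A * ?\<rho>" using A by (intro add_mono mult_left_mono) auto
  finally have "\<bar>burkholder p A r s\<bar> \<le> (?\<rho> + A * ?\<rho>) * ?\<rho> powr (p - 1)"
    unfolding burkholder_def abs_mult
  proof (rule mult_mono)
    have "max \<bar>r\<bar> \<bar>s\<bar> powr (p - 1) \<le> ?\<rho> powr (p - 1)" using p by (intro powr_mono2) auto
    thus "\<bar>max \<bar>r\<bar> \<bar>s\<bar> powr (p - 1)\<bar> \<le> ?\<rho> powr (p - 1)" by simp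
  qed (use A in auto)
  also have "\<dots> = (1 + A) * (?\<rho> powr (p - 1) * ?\<rho> powr 1)" by (simp add: algebra_simps)
  also have "\<dots> = (1 + A) * ?\<rho> powr p" by (simp only: powr_add[symmetric]) simp
  finally show ?thesis .
qed

text \<open>Without an admissible constant, \<open>choi_const\<close> would be the infimum of the
  empty set. In the variables of Burkholder's function, \<open>|b * r + B * s|\<close> is at most
  \<open>(|b| + |B|) * (|x| + |y|)\<close>, so that a multiple of the function is a biconcave
  majorant once \<open>K\<close> is large.\<close>

lemma choi_bound_nonneg_exists:
  assumes p: "1 < p"
  shows "\<exists>K. choi_bound TYPE('a) b B p K"
proof -
  \<comment> \<open>A value above both \<open>p - 1\<close> and \<open>1 / (p - 1)\<close>, the two
    thresholds for biconcavity.\<close>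
  define A where "A = p + 1 / (p - 1)"
  have "0 \<le> 1 / (p - 1)" "A * (p - 1) = p * (p - 1) + 1" using p by (auto simp: A_def distrib_right)
  moreover have "0 \<le> p * (p - 1)" using p by simp
  ultimately have A: "0 \<le> A" "p - 1 \<le> A" "1 \<le> A * (p - 1)" using p by (simp_all only: A_def)
  obtain c k where ck: "0 \<le> c" "0 \<le> k"
    and maj: "\<And>r s. \<bar>s - r\<bar> powr p \<le> c * burkholder p A r s + k * \<bar>r + s\<bar> powr p"
    using burkholder_majorant[OF p A(1)] by blast
  define D where "D = (2 * (\<bar>b\<bar> + \<bar>B\<bar>)) powr p"
  define K where "K = (D * (k + 1)) powr (1 / p)"
  have D: "0 \<le> D" by (simp add: D_def)
  have K: "0 \<le> K" "K powr p = D * (k + 1)" using p D ck by (auto simp: K_def powr_powr)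
  define Q where "Q r s = D * c * burkholder p A r s" for r s
  have "choi_bound TYPE('a) b B p K"
  proof (rule choi_bound_of_biconcave[OF p K(1), of Q "D * c * (1 + A)"])
    show "(\<lambda>z. Q (fst z) (snd z)) \<in> borel_measurable borel"
      unfolding Q_def burkholder_def borel_prod[symmetric] by measurable
    show "concave_on UNIV (\<lambda>r. Q r s)" "concave_on UNIV (\<lambda>s. Q r s)" for r s
      unfolding Q_def using D ck A p by (auto intro!: concave_on_cmul concave_on_burkholder)
    show "\<bar>Q r s\<bar> \<le> D * c * (1 + A) * (1 + \<bar>r\<bar> + \<bar>s\<bar>) powr p" for r s
      unfolding Q_def abs_mult mult.assoc using D ck abs_burkholder_le[OF p A(1), of r s]
      by (auto intro!: mult_left_mono)
    show "Q 0 0 \<le> 0" by (simp add: Q_def burkholder_def)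
    fix r s :: real
    let ?x = "\<bar>r + s\<bar>" and ?y = "\<bar>s - r\<bar>"
    have "\<bar>b * r + B * s\<bar> \<le> \<bar>b\<bar> * \<bar>r\<bar> + \<bar>B\<bar> * \<bar>s\<bar>" by (simp add: abs_mult[symmetric])
    also have "\<dots> \<le> \<bar>b\<bar> * (?x + ?y) + \<bar>B\<bar> * (?x + ?y)" by (intro add_mono mult_left_mono) auto
    finally have "\<bar>b * r + B * s\<bar> powr p \<le> ((\<bar>b\<bar> + \<bar>B\<bar>) * (?x + ?y)) powr p"
      using p by (intro powr_mono2) (auto simp: algebra_simps)
    also have "\<dots> = (\<bar>b\<bar> + \<bar>B\<bar>) powr p * (?x + ?y) powr p" by (simp add: powr_mult)
    also have "\<dots> \<le> (\<bar>b\<bar> + \<bar>B\<bar>) powr p * (2 powr p * (?x powr p + ?y powr p))"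
      using p by (intro mult_left_mono powr_add_le) auto
    also have "\<dots> = D * (?x powr p + ?y powr p)" unfolding D_def by (subst powr_mult) (auto simp: mult_ac)
    also have "\<dots> \<le> D * (?x powr p + (c * burkholder p A r s + k * ?x powr p))"
      using D maj[of s r] by (intro mult_left_mono add_mono) auto
    finally show "\<bar>b * r + B * s\<bar> powr p - K powr p * ?x powr p \<le> Q r s"
      unfolding K Q_def by (simp add: algebra_simps)
  qed
  thus ?thesis ..
qed

section \<open>The Choi constant as an attained infimum\<close>

lemma choi_const_le:
  assumes "choi_bound TYPE(nat \<Rightarrow> real) b B p C"
  shows "choi_const b B p \<le> C"
  unfolding choi_const_def
  by (rule cInf_lower) (use assms choi_bound_nonneg in \<open>auto intro: bdd_belowI[of _ 0]\<close>)

lemma choi_const_nonneg: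
  assumes "1 < p"
  shows "0 \<le> choi_const b B p"
  unfolding choi_const_def
  using choi_bound_nonneg_exists[OF assms] choi_bound_nonneg by (intro cInf_greatest) auto

text \<open>For each single transform the inequality is a closed condition on the constant: divide
  by the norm of the martingale or, if that norm is zero, use that any one admissible constant
  already makes the left side nonpositive.\<close>

lemma choi_bound_choi_const:
  assumes p: "1 < p"
  shows "choi_bound TYPE('a) b B p (choi_const b B p)"
proof -
  have "choi_bound TYPE(nat \<Rightarrow> real) b B p (choi_const b B p)"
    unfolding choi_bound_def
  proof (intro allI impI)
    fix n :: nat and M :: "(nat \<Rightarrow> real) measure" and F d \<theta>
    assume n: "n \<ge> 1" and mt: "martingale_transform M F d \<theta> b B p"
    let ?Y = "Lp_norm p M (\<lambda>\<omega>. \<Sum>k=1..n. \<theta> k \<omega> * d k \<omega>)" and ?X = "Lp_norm p M (\<lambda>\<omega>. \<Sum>k=1..n. d k \<omega>)"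
    have le: "?Y \<le> C * ?X" if "choi_bound TYPE(nat \<Rightarrow> real) b B p C" for C
      using that n mt unfolding choi_bound_def by blast
    have X: "0 \<le> ?X" by (simp add: Lp_norm_def)
    show "?Y \<le> choi_const b B p * ?X"
    proof (cases "?X = 0")
      case True
      thus ?thesis using choi_bound_nonneg_exists[OF p] le by fastforce
    next
      case False
      hence "?Y / ?X \<le> C" if "choi_bound TYPE(nat \<Rightarrow> real) b B p C" for C
        using le[OF that] X by (simp add: field_simps)
      hence "?Y / ?X \<le> choi_const b B p"
        unfolding choi_const_def using choi_bound_nonneg_exists[OF p] by (intro cInf_greatest) auto
      thus ?thesis using False X by (simp add: field_simps)
    qed
  qed
  thus ?thesis by (rule choi_bound_transfer[OF p])
qed

section \<open>Martingale transforms along random walks\<close>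

text \<open>A state is the whole history with the newest entry at the head. Thus
  \<open>drop j\<close> undoes the last \<open>j\<close> steps, and it also generates the
  filtration.\<close>

fun walk :: "('a list \<Rightarrow> 'a pmf) \<Rightarrow> nat \<Rightarrow> 'a list pmf" where
  "walk \<kappa> 0 = return_pmf []"
| "walk \<kappa> (Suc n) = bind_pmf (walk \<kappa> n) (\<lambda>xs. map_pmf (\<lambda>y. y # xs) (\<kappa> xs))"

text \<open>\<open>D\<close> reads the latest increment off a history. The index of
  \<open>\<theta>\<close> is the number of earlier entries and starts at \<open>0\<close>, whereas
  \<open>martingale_transform\<close> counts from \<open>1\<close>.\<close>

fun transform :: "(nat \<Rightarrow> real) \<Rightarrow> ('a list \<Rightarrow> real) \<Rightarrow> 'a list \<Rightarrow> real" where
  "transform \<theta> D [] = 0"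
| "transform \<theta> D (y # xs) = \<theta> (length xs) * D (y # xs) + transform \<theta> D xs"

lemma length_walk: "xs \<in> set_pmf (walk \<kappa> n) \<Longrightarrow> length xs = n"
  by (induction n arbitrary: xs) auto

lemma map_drop_walk: "j \<le> n \<Longrightarrow> map_pmf (drop j) (walk \<kappa> n) = walk \<kappa> (n - j)"
proof (induction n arbitrary: j)
  case (Suc n)
  show ?case
  proof (cases j)
    case 0
    thus ?thesis by (simp add: drop_0[abs_def] map_pmf_ident)
  next
    case (Suc i)
    have "map_pmf (drop j) (walk \<kappa> (Suc n)) = bind_pmf (walk \<kappa> n) (\<lambda>xs. map_pmf (\<lambda>_. drop i xs) (\<kappa> xs))"
      by (simp add: Suc map_bind_pmf map_pmf_comp)
    also have "\<dots> = map_pmf (drop i) (walk \<kappa> n)"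
      by (simp add: map_pmf_const map_pmf_def)
    finally show ?thesis using Suc.IH[of i] Suc.prems Suc by simp
  qed
qed simp

lemma transform_eq_sum:
  "transform \<theta> D xs = (\<Sum>k=1..length xs. \<theta> (k - 1) * D (drop (length xs - k) xs))"
proof (induction xs)
  case (Cons y xs)
  have "(\<Sum>k=1..length xs. \<theta> (k - 1) * D (drop (Suc (length xs) - k) (y # xs))) =
      (\<Sum>k=1..length xs. \<theta> (k - 1) * D (drop (length xs - k) xs))"
    by (intro sum.cong refl) (auto simp: Suc_diff_le)
  thus ?case using Cons by simp
qed simp

lemma transform_convex:
  "transform (\<lambda>k. u * \<theta> k + v * \<eta> k) D xs = u * transform \<theta> D xs + v * transform \<eta> D xs"
  by (induction xs) (auto simp: algebra_simps)

lemma transform_cong: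
  "(\<And>k. k < length xs \<Longrightarrow> \<theta> k = \<eta> k) \<Longrightarrow> transform \<theta> D xs = transform \<eta> D xs"
  by (induction xs) auto

context
  fixes \<kappa> :: "'a list \<Rightarrow> 'a pmf"
  assumes fin: "\<And>xs. finite (set_pmf (\<kappa> xs))"
begin

lemma finite_walk: "finite (set_pmf (walk \<kappa> n))"
  by (induction n) (auto simp: fin)

lemma integrable_walk: "integrable (walk \<kappa> n) (f :: _ \<Rightarrow> real)"
  by (rule integrable_measure_pmf_finite[OF finite_walk])

lemma expectation_walk_Suc:
  "measure_pmf.expectation (walk \<kappa> (Suc n)) (f :: _ \<Rightarrow> real) =
     measure_pmf.expectation (walk \<kappa> n) (\<lambda>xs. measure_pmf.expectation (\<kappa> xs) (\<lambda>y. f (y # xs)))"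
proof -
  have "measure_pmf.expectation (walk \<kappa> (Suc n)) f =
    (\<Sum>xs\<in>set_pmf (walk \<kappa> n). pmf (walk \<kappa> n) xs *\<^sub>R measure_pmf.expectation (map_pmf (\<lambda>y. y # xs) (\<kappa> xs)) f)"
    unfolding walk.simps by (rule pmf_expectation_bind) (auto simp: finite_walk fin)
  also have "\<dots> = measure_pmf.expectation (walk \<kappa> n) (\<lambda>xs. measure_pmf.expectation (\<kappa> xs) (\<lambda>y. f (y # xs)))"
    by (subst integral_measure_pmf[of "set_pmf (walk \<kappa> n)"]) (auto simp: finite_walk)
  finally show ?thesis .
qed

text \<open>The sample space consists of the histories of length \<open>n\<close>;
  \<open>F k\<close> is generated by their \<open>k\<close> oldest entries, and \<open>d k\<close>
  is the increment that these determine. The hypothesis on the means of \<open>D\<close> under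
  \<open>\<kappa>\<close> is the martingale difference property, and finite supports give all
  integrability.\<close>

lemma walk_transform_extreme:
  assumes p: "1 < p" and C: "choi_bound TYPE('a list) b B p C" "0 \<le> C"
    and mean: "\<And>xs. length xs < n \<Longrightarrow> measure_pmf.expectation (\<kappa> xs) (\<lambda>y. D (y # xs)) = 0"
    and \<theta>: "\<And>k. \<theta> k \<in> {b, B}"
  shows "measure_pmf.expectation (walk \<kappa> n) (\<lambda>xs. \<bar>transform \<theta> D xs\<bar> powr p) \<le>
     C powr p * measure_pmf.expectation (walk \<kappa> n) (\<lambda>xs. \<bar>transform (\<lambda>_. 1) D xs\<bar> powr p)"
proof (cases "n = 0")
  case False
  define M where "M = measure_pmf (walk \<kappa> n)"
  define F where "F k = vimage_algebra UNIV (drop (n - k)) (count_space (UNIV :: 'a list set))" for k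
  define d where "d k xs = (if k \<le> n then D (drop (n - k) xs) else 0)" for k xs
  interpret prob_space M unfolding M_def by (rule prob_space_measure_pmf)
  have spF [simp]: "space (F k) = UNIV" for k by (simp add: F_def)
  have setsF: "sets (F k) = {drop (n - k) -` A | A. True}" for k
    unfolding F_def by (subst sets_vimage_algebra2) auto
  have measF: "(\<lambda>xs. g (drop (n - k) xs)) \<in> borel_measurable (F k)" for g :: "'a list \<Rightarrow> real" and k
    by (rule measurable_compose[of "drop (n - k)" "F k" "count_space UNIV"])
      (auto simp: F_def intro: measurable_vimage_algebra1)
  have sub: "subalgebra M (F k)" for k by (auto simp: subalgebra_def M_def)
  have meas: "f \<in> borel_measurable M" for f :: "'a list \<Rightarrow> real" by (simp add: M_def)
  have int: "integrable M f" for f :: "'a list \<Rightarrow> real" unfolding M_def by (rule integrable_walk)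
  have cond: "AE xs in M. real_cond_exp M (F (k - 1)) (d k) xs = 0" if k: "k \<ge> 1" for k
  proof -
    interpret S: finite_measure_subalgebra M "F (k - 1)" by standard (rule sub)
    show ?thesis
    proof (rule S.real_cond_exp_charact)
      fix A assume "A \<in> sets (F (k - 1))"
      then obtain A' where A: "A = drop (n - (k - 1)) -` A'" using setsF by auto
      show "(\<integral>xs\<in>A. d k xs \<partial>M) = (\<integral>xs\<in>A. 0 \<partial>M)"
      proof (cases "k \<le> n")
        case True
        let ?g = "\<lambda>xs. indicator A' (tl xs) * D xs"
        \<comment> \<open>An event of \<open>F (k - 1)\<close> sees one entry less than
          \<open>d k\<close>: on the history of length \<open>k\<close> it is a condition on the
          tail.\<close>
        have "n - (k - 1) = Suc (n - k)" using True k by simp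
        hence "(\<integral>xs\<in>A. d k xs \<partial>M) = (\<integral>xs. ?g (drop (n - k) xs) \<partial>M)"
          unfolding set_lebesgue_integral_def using True
          by (intro Bochner_Integration.integral_cong refl) (simp add: A d_def indicator_def drop_Suc tl_drop)
        also have "\<dots> = measure_pmf.expectation (map_pmf (drop (n - k)) (walk \<kappa> n)) ?g"
          by (simp add: M_def)
        also have "map_pmf (drop (n - k)) (walk \<kappa> n) = walk \<kappa> (Suc (k - 1))"
          using True k by (simp add: map_drop_walk)
        also have "measure_pmf.expectation \<dots> ?g = measure_pmf.expectation (walk \<kappa> (k - 1)) (\<lambda>_. 0)"
          unfolding expectation_walk_Suc
          by (rule integral_cong_AE) (use True k in \<open>auto simp: AE_measure_pmf_iff mean length_walk\<close>)
        finally show ?thesis by (simp add: set_lebesgue_integral_def)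
      qed (simp add: set_lebesgue_integral_def d_def)
    qed (auto intro: int)
  qed
  have "martingale_transform M F d (\<lambda>k _. \<theta> (k - 1)) b B p"
    unfolding martingale_transform_def
  proof (intro conjI allI impI ballI)
    show "filtration (space M) F"
    proof
      fix i j :: nat assume "i \<le> j"
      show "sets (F i) \<subseteq> sets (F j)"
      proof
        fix A assume "A \<in> sets (F i)"
        then obtain A' where "A = drop (n - i) -` A'" using setsF by auto
        also have "n - i = ((n - i) - (n - j)) + (n - j)" using \<open>i \<le> j\<close> by simp
        also have "drop \<dots> -` A' = drop (n - j) -` (drop ((n - i) - (n - j)) -` A')"
          unfolding drop_drop[symmetric] by auto
        finally show "A \<in> sets (F j)" using setsF by auto
      qed
    qed (simp add: M_def)
    fix k :: nat assume "1 \<le> k"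
    show "d k \<in> borel_measurable (F k)" unfolding d_def using measF by simp
    show "d k \<in> Lp p M" using meas int by (simp add: Lp_def)
    show "AE xs in M. real_cond_exp M (F (k - 1)) (d k) xs = 0" by (rule cond) fact
    show "\<theta> (k - 1) \<in> {b, B}" by (rule \<theta>)
  qed (auto simp: sub prob_space_axioms)
  hence "Lp_norm p M (\<lambda>xs. \<Sum>k=1..n. \<theta> (k - 1) * d k xs) \<le> C * Lp_norm p M (\<lambda>xs. \<Sum>k=1..n. d k xs)"
    using C(1) False unfolding choi_bound_def by auto
  hence le: "(\<integral>xs. \<bar>\<Sum>k=1..n. \<theta> (k - 1) * d k xs\<bar> powr p \<partial>M) \<le> C powr p * (\<integral>xs. \<bar>\<Sum>k=1..n. d k xs\<bar> powr p \<partial>M)"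
    using p C(2) by (subst (asm) Lp_norm_le_iff) auto
  have eq: "AE xs in M. transform \<eta> D xs = (\<Sum>k=1..n. \<eta> (k - 1) * d k xs)" for \<eta>
    unfolding M_def AE_measure_pmf_iff
    by (auto simp: transform_eq_sum length_walk d_def intro!: sum.cong)
  hence *: "(\<integral>xs. \<bar>transform \<eta> D xs\<bar> powr p \<partial>M) = (\<integral>xs. \<bar>\<Sum>k=1..n. \<eta> (k - 1) * d k xs\<bar> powr p \<partial>M)" for \<eta>
  proof (intro integral_cong_AE meas)
    show "AE xs in M. \<bar>transform \<eta> D xs\<bar> powr p = \<bar>\<Sum>k=1..n. \<eta> (k - 1) * d k xs\<bar> powr p"
      using eq[of \<eta>] by eventually_elim simp
  qed
  show ?thesis using le *[of \<theta>] *[of "\<lambda>_. 1"] by (simp add: M_def)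
qed simp

text \<open>The transform is affine in each single multiplier, so its \<open>p\<close>-th moment is
  convex in it, and an interior value may be replaced by the two end points. The induction removes
  the interior values one index at a time.\<close>

lemma walk_transform_bound:
  assumes p: "1 < p" and C: "choi_bound TYPE('a list) b B p C" "0 \<le> C"
    and mean: "\<And>xs. length xs < n \<Longrightarrow> measure_pmf.expectation (\<kappa> xs) (\<lambda>y. D (y # xs)) = 0"
    and \<theta>: "\<And>k. \<theta> k \<in> {b..B}"
  shows "measure_pmf.expectation (walk \<kappa> n) (\<lambda>xs. \<bar>transform \<theta> D xs\<bar> powr p) \<le>
     C powr p * measure_pmf.expectation (walk \<kappa> n) (\<lambda>xs. \<bar>transform (\<lambda>_. 1) D xs\<bar> powr p)"
    (is "?E \<theta> \<le> ?R")
proof -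
  have bB: "b \<le> B" using \<theta>[of 0] by simp
  have main: "?E \<eta> \<le> ?R" if "\<forall>k. \<eta> k \<in> {b..B}" "\<forall>k\<ge>m. \<eta> k \<in> {b, B}" for \<eta> m
    using that
  proof (induction m arbitrary: \<eta>)
    case 0
    thus ?case by (intro walk_transform_extreme[OF p C mean]) auto
  next
    case (Suc m)
    have "\<exists>u v. 0 \<le> u \<and> 0 \<le> v \<and> u + v = 1 \<and> \<eta> m = u * b + v * B"
    proof (cases "b = B")
      case True
      thus ?thesis using Suc.prems(1) by (intro exI[of _ 1] exI[of _ 0]) (auto intro: antisym)
    next
      case False
      have "\<eta> m \<in> {b..B}" using Suc.prems by blast
      hence "0 \<le> (B - \<eta> m) / (B - b)" "0 \<le> (\<eta> m - b) / (B - b)"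
        "(B - \<eta> m) / (B - b) + (\<eta> m - b) / (B - b) = 1"
        "\<eta> m = (B - \<eta> m) / (B - b) * b + (\<eta> m - b) / (B - b) * B"
        using False bB by (auto simp: divide_simps) (auto simp: algebra_simps)
      thus ?thesis by blast
    qed
    then obtain u v where uv: "0 \<le> u" "0 \<le> v" "u + v = 1" "\<eta> m = u * b + v * B" by blast
    have eq: "\<eta> = (\<lambda>k. u * (\<eta>(m := b)) k + v * (\<eta>(m := B)) k)"
      using uv by (auto simp: fun_eq_iff distrib_right[symmetric])
    have "?E \<eta> \<le> measure_pmf.expectation (walk \<kappa> n)
        (\<lambda>xs. u * \<bar>transform (\<eta>(m := b)) D xs\<bar> powr p + v * \<bar>transform (\<eta>(m := B)) D xs\<bar> powr p)"
      by (subst (2) eq, unfold transform_convex, intro integral_mono integrable_walk abs_powr_convex p uv)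
    also have "\<dots> = u * ?E (\<eta>(m := b)) + v * ?E (\<eta>(m := B))"
      using integrable_walk by (simp del: fun_upd_apply)
    also have "\<dots> \<le> u * ?R + v * ?R"
      using Suc.prems bB uv by (intro add_mono mult_left_mono Suc.IH) (auto simp: less_Suc_eq_le)
    also have "\<dots> = ?R" using uv by (simp add: distrib_right[symmetric])
    finally show ?case .
  qed
  \<comment> \<open>A walk of length \<open>n\<close> sees only the multipliers below
    \<open>n\<close>; setting the others to \<open>b\<close> leaves finitely many interior
    values.\<close>
  define \<eta> where "\<eta> k = (if k < n then \<theta> k else b)" for k
  have "?E \<theta> = ?E \<eta>"
    by (rule integral_cong_AE) (auto simp: AE_measure_pmf_iff \<eta>_def length_walk intro!: arg_cong[where f = "\<lambda>x. \<bar>x\<bar> powr p"] transform_cong)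
  also have "\<dots> \<le> ?R" by (rule main[of \<eta> n]) (use \<theta> bB in \<open>auto simp: \<eta>_def\<close>)
  finally show ?thesis .
qed

end

section \<open>Lazy steps on an abelian group\<close>

lemma borel_measurable_pmf: "(f :: _ \<Rightarrow> real) \<in> borel_measurable (measure_pmf q)"
  by simp

lemma expectation_return_pmf:
  "measure_pmf.expectation (return_pmf x) (f :: _ \<Rightarrow> real) = f x"
  by (subst integral_measure_pmf[of "{x}"]) auto

definition lazy_average :: "real \<Rightarrow> 'x::ab_group_add \<Rightarrow> ('x \<Rightarrow> real) \<Rightarrow> 'x \<Rightarrow> real" where
  "lazy_average h e f x = (1 - 2 * h) * f x + h * (f (x + e) + f (x - e))"

text \<open>Two coins, one for moving and one for the sign, instead of weights on three points: in
  \<open>Z/2Z\<close> the points \<open>e\<close> and \<open>- e\<close> coincide and their weights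
  have to add up.\<close>

definition lazy_step :: "real \<Rightarrow> 'x::ab_group_add \<Rightarrow> 'x pmf" where
  "lazy_step h e = bind_pmf (bernoulli_pmf (2 * h))
     (\<lambda>m. if m then map_pmf (\<lambda>s. if s then e else - e) (bernoulli_pmf (1 / 2)) else return_pmf 0)"

lemma set_lazy_step: "set_pmf (lazy_step h e) \<subseteq> {0, e, - e}"
  by (auto simp: lazy_step_def split: if_splits)

lemma finite_lazy_step: "finite (set_pmf (lazy_step h e))"
  by (rule finite_subset[OF set_lazy_step]) auto

lemma expectation_lazy_step:
  assumes "0 \<le> h" "h \<le> 1 / 2"
  shows "measure_pmf.expectation (lazy_step h e) (\<lambda>z. g (x + z)) = lazy_average h e g x"
proof -
  have "measure_pmf.expectation (lazy_step h e) (\<lambda>z. g (x + z)) =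
    measure_pmf.expectation (bernoulli_pmf (2 * h)) (\<lambda>m. measure_pmf.expectation
      (if m then map_pmf (\<lambda>s. if s then e else - e) (bernoulli_pmf (1 / 2)) else return_pmf 0) (\<lambda>z. g (x + z)))"
    unfolding lazy_step_def
    by (subst pmf_expectation_bind[of UNIV]) (auto simp: integral_measure_pmf[of UNIV])
  also have "\<dots> = 2 * h * ((g (x + e) + g (x - e)) / 2) + (1 - 2 * h) * g x"
    using assms by (subst integral_bernoulli_pmf) auto
  finally show ?thesis by (simp add: lazy_average_def algebra_simps)
qed

text \<open>Summation by parts, since the lazy average is symmetric. The sums run over finite sets,
  so \<open>A\<close> has to contain \<open>A'\<close> together with its neighbours in direction
  \<open>e\<close>.\<close>

lemma sum_lazy_average:
  fixes g S :: "'x::ab_group_add \<Rightarrow> real"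
  assumes fin: "finite A" and A: "\<And>x. x \<in> A' \<Longrightarrow> x \<in> A \<and> x + e \<in> A \<and> x - e \<in> A"
    and g: "\<And>x. x \<notin> A' \<Longrightarrow> g x = 0"
  shows "(\<Sum>x\<in>A. lazy_average h e g x * S x) = (\<Sum>x\<in>A'. g x * lazy_average h e S x)"
proof -
  have shift: "(\<Sum>x\<in>A. g (x + a) * S x) = (\<Sum>x\<in>A'. g x * S (x - a))" if "\<And>x. x \<in> A' \<Longrightarrow> x - a \<in> A" for a
  proof -
    have "(\<Sum>x\<in>A'. g x * S (x - a)) = (\<Sum>x\<in>(\<lambda>x. x - a) ` A'. g (x + a) * S x)"
      by (subst sum.reindex) (auto simp: inj_on_def)
    also have "\<dots> = (\<Sum>x\<in>A. g (x + a) * S x)"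
    proof (rule sum.mono_neutral_left[OF fin])
      show "\<forall>x\<in>A - (\<lambda>x. x - a) ` A'. g (x + a) * S x = 0"
      proof
        fix x assume "x \<in> A - (\<lambda>x. x - a) ` A'"
        hence "x + a \<notin> A'" by (auto simp: image_iff)
        thus "g (x + a) * S x = 0" by (simp add: g)
      qed
    qed (use that in auto)
    finally show ?thesis ..
  qed
  have "(\<Sum>x\<in>A. lazy_average h e g x * S x) =
      (1 - 2 * h) * (\<Sum>x\<in>A. g (x + 0) * S x) + h * ((\<Sum>x\<in>A. g (x + e) * S x) + (\<Sum>x\<in>A. g (x + (- e)) * S x))"
    by (simp add: lazy_average_def sum.distrib sum_distrib_left distrib_left distrib_right ac_simps)
  also have "\<dots> = (1 - 2 * h) * (\<Sum>x\<in>A'. g x * S (x - 0)) + h * ((\<Sum>x\<in>A'. g x * S (x - e)) + (\<Sum>x\<in>A'. g x * S (x - (- e))))"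
    using A by (subst (1 2 3) shift) auto
  also have "\<dots> = (\<Sum>x\<in>A'. g x * lazy_average h e S x)"
    by (simp add: lazy_average_def sum.distrib sum_distrib_left distrib_left distrib_right ac_simps)
  finally show ?thesis .
qed

text \<open>The walk carries a random sign \<open>\<sigma>\<close> in its state, so that the initial value of the martingale is
  itself a martingale difference.  Conditioning the transform on the final position gives
  the operators \<open>S k\<close>.\<close>

locale lattice_walk =
  fixes h :: real and dir :: "nat \<Rightarrow> 'x::ab_group_add" and n :: nat
    and F S :: "nat \<Rightarrow> 'x \<Rightarrow> real" and \<theta> :: "nat \<Rightarrow> real" and A :: "nat \<Rightarrow> 'x set"
  assumes h: "0 \<le> h" "h \<le> 1 / 2"
    and F: "\<And>k. k < n \<Longrightarrow> F k = lazy_average h (dir k) (F (Suc k))"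
    and S_0: "S 0 = (\<lambda>x. \<theta> 0 * F 0 x)"
    and S_Suc: "\<And>k. k < n \<Longrightarrow> S (Suc k) = (\<lambda>x. lazy_average h (dir k) (S k) x +
           \<theta> (Suc k) * (F (Suc k) x - lazy_average h (dir k) (F k) x))"
    and finite_A: "finite (A k)"
    and A_nonempty: "A 0 \<noteq> {}"
    and A_Suc: "\<And>k x. k < n \<Longrightarrow> x \<in> A (Suc k) \<Longrightarrow> x \<in> A k \<and> x + dir k \<in> A k \<and> x - dir k \<in> A k"
begin

fun \<kappa> :: "(real \<times> 'x) list \<Rightarrow> (real \<times> 'x) pmf" where
  "\<kappa> [] = pmf_of_set ({- 1, 1} \<times> A 0)"
| "\<kappa> ((\<sigma>, x) # xs) = map_pmf (\<lambda>z. (\<sigma>, x + z)) (lazy_step h (dir (length xs)))"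

fun D :: "(real \<times> 'x) list \<Rightarrow> real" where
  "D [] = 0"
| "D [(\<sigma>, x)] = \<sigma> * F 0 x"
| "D ((\<sigma>, x) # (\<tau>, y) # xs) = \<sigma> * F (Suc (length xs)) x - \<tau> * F (length xs) y"

abbreviation "E k f \<equiv> measure_pmf.expectation (walk \<kappa> (Suc k)) f"
abbreviation "site xs \<equiv> snd (hd xs)"
abbreviation "spin xs \<equiv> fst (hd xs)"

lemma finite_\<kappa>: "finite (set_pmf (\<kappa> xs))"
  using finite_A A_nonempty by (cases xs rule: \<kappa>.cases) (auto simp: finite_lazy_step)

lemmas integrable_E = integrable_walk[of \<kappa>, OF finite_\<kappa>]

lemma expectation_\<kappa>_Nil:
  "measure_pmf.expectation (\<kappa> []) g = (\<Sum>x\<in>A 0. g (- 1, x) + g (1, x)) / (2 * real (card (A 0)))"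
proof -
  have "(\<Sum>z\<in>{- 1, 1} \<times> A 0. g z) = (\<Sum>\<sigma>\<in>{- 1, 1 :: real}. \<Sum>x\<in>A 0. g (\<sigma>, x))"
    by (simp add: sum.cartesian_product)
  also have "\<dots> = (\<Sum>x\<in>A 0. g (- 1, x) + g (1, x))" by (simp add: sum.distrib)
  finally show ?thesis
    using finite_A A_nonempty by (simp add: integral_pmf_of_set card_cartesian_product)
qed

lemma expectation_\<kappa>_Cons:
  "measure_pmf.expectation (\<kappa> ((\<sigma>, x) # xs)) g = lazy_average h (dir (length xs)) (\<lambda>x. g (\<sigma>, x)) x"
  using expectation_lazy_step[OF h, of "dir (length xs)" "\<lambda>x. g (\<sigma>, x)" x] by simp

lemma mean_D: "length xs < Suc n \<Longrightarrow> measure_pmf.expectation (\<kappa> xs) (\<lambda>y. D (y # xs)) = 0"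
proof (cases xs)
  case (Cons y ys)
  assume "length xs < Suc n"
  thus ?thesis using Cons F[of "length ys"]
    by (cases y) (simp only: expectation_\<kappa>_Cons, simp add: lazy_average_def algebra_simps)
qed (simp only: expectation_\<kappa>_Nil, simp)

lemma transform_one: "transform (\<lambda>_. 1) D ((\<sigma>, x) # xs) = \<sigma> * F (length xs) x"
proof (induction xs arbitrary: \<sigma> x)
  case (Cons y ys)
  thus ?case by (cases y) simp
qed simp

lemma sign_walk: "xs \<in> set_pmf (walk \<kappa> (Suc k)) \<Longrightarrow> spin xs * spin xs = 1"
proof (induction k arbitrary: xs)
  case 0
  thus ?case using finite_A A_nonempty by auto
next
  case (Suc k)
  then obtain ys y where y: "ys \<in> set_pmf (walk \<kappa> (Suc k))" "xs = y # ys" "y \<in> set_pmf (\<kappa> ys)"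
    unfolding walk.simps(2)[of \<kappa> "Suc k"] by (auto simp del: walk.simps \<kappa>.simps)
  moreover obtain z zs where "ys = z # zs" using length_walk[OF y(1)] by (cases ys) auto
  ultimately show ?case using Suc.IH[OF y(1)] by (cases z) auto
qed

text \<open>Uniform start and symmetric steps give every point of \<open>A k\<close> the same weight
  at time \<open>k\<close>, because all its possible predecessors lie in the earlier sets. The
  factor \<open>card (A 0)\<close> turns this weight into counting measure.\<close>

lemma expectation_position:
  assumes "k \<le> n" "\<And>x. x \<notin> A k \<Longrightarrow> g x = 0"
  shows "real (card (A 0)) * E k (\<lambda>xs. g (site xs)) = (\<Sum>x\<in>A k. g x)"
  using assms
proof (induction k arbitrary: g)
  case 0
  have "card (A 0) > 0" using finite_A A_nonempty by (simp add: card_gt_0_iff)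
  thus ?case
    by (simp only: expectation_walk_Suc[OF finite_\<kappa>] walk.simps(1) expectation_return_pmf expectation_\<kappa>_Nil)
      (simp add: sum_distrib_left[symmetric])
next
  case (Suc k)
  have "E (Suc k) (\<lambda>xs. g (site xs)) = E k (\<lambda>xs. measure_pmf.expectation (\<kappa> xs) (\<lambda>y. g (snd y)))"
    unfolding expectation_walk_Suc[OF finite_\<kappa>, where n = "Suc k"] by (simp only: list.sel)
  also have "\<dots> = E k (\<lambda>xs. lazy_average h (dir k) g (site xs))"
  proof (rule integral_cong_AE)
    show "AE xs in walk \<kappa> (Suc k). measure_pmf.expectation (\<kappa> xs) (\<lambda>y. g (snd y)) = lazy_average h (dir k) g (site xs)"
      unfolding AE_measure_pmf_iff
    proof
      fix xs assume "xs \<in> set_pmf (walk \<kappa> (Suc k))"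
      hence "length xs = Suc k" by (rule length_walk)
      then obtain \<sigma> x ys where "xs = (\<sigma>, x) # ys" "length ys = k" by (cases xs) auto
      thus "measure_pmf.expectation (\<kappa> xs) (\<lambda>y. g (snd y)) = lazy_average h (dir k) g (site xs)"
        by (simp only: expectation_\<kappa>_Cons) simp
    qed
  qed (rule borel_measurable_pmf)+
  also have "real (card (A 0)) * \<dots> = (\<Sum>x\<in>A k. lazy_average h (dir k) g x)"
  proof (rule Suc.IH)
    show "lazy_average h (dir k) g x = 0" if "x \<notin> A k" for x
    proof -
      have "x \<notin> A (Suc k)" "x + dir k \<notin> A (Suc k)" "x - dir k \<notin> A (Suc k)"
        using A_Suc[of k x] A_Suc[of k "x + dir k"] A_Suc[of k "x - dir k"] that Suc.prems(1) by auto
      thus ?thesis by (simp add: lazy_average_def Suc.prems(2))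
    qed
  qed (use Suc.prems in simp)
  also have "\<dots> = (\<Sum>x\<in>A k. lazy_average h (dir k) g x * 1)" by simp
  also have "\<dots> = (\<Sum>x\<in>A (Suc k). g x * lazy_average h (dir k) (\<lambda>_. 1) x)"
    using Suc.prems by (intro sum_lazy_average finite_A A_Suc) auto
  finally show ?case by (simp add: lazy_average_def)
qed

text \<open>On \<open>A k\<close>, the function \<open>S k\<close> is the conditional expectation of
  the spin times the transform given the position at time \<open>k\<close>, expressed here by test
  functions \<open>g\<close>. Seen backwards in time the walk also makes lazy steps, so conditioning
  on the next position averages \<open>S k\<close> and \<open>F k\<close> in the direction
  \<open>dir k\<close>; this is the recursion for \<open>S\<close>.\<close>

lemma expectation_transform:
  assumes "k \<le> n" "\<And>x. x \<notin> A k \<Longrightarrow> g x = 0"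
  shows "real (card (A 0)) * E k (\<lambda>xs. spin xs * g (site xs) * transform \<theta> D xs) = (\<Sum>x\<in>A k. g x * S k x)"
  using assms
proof (induction k arbitrary: g)
  case 0
  have "card (A 0) > 0" using finite_A A_nonempty by (simp add: card_gt_0_iff)
  thus ?case
    by (simp only: expectation_walk_Suc[OF finite_\<kappa>] walk.simps(1) expectation_return_pmf expectation_\<kappa>_Nil)
      (simp add: S_0 sum_distrib_left sum_divide_distrib mult.left_commute)
next
  case (Suc k)
  let ?q = "lazy_average h (dir k)"
  have supp: "?q g' x = 0" if "x \<notin> A k" "\<And>x. x \<notin> A (Suc k) \<Longrightarrow> g' x = 0" for x g'
  proof -
    have "x \<notin> A (Suc k)" "x + dir k \<notin> A (Suc k)" "x - dir k \<notin> A (Suc k)"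
      using A_Suc[of k x] A_Suc[of k "x + dir k"] A_Suc[of k "x - dir k"] that(1) Suc.prems(1) by auto
    thus ?thesis by (simp add: lazy_average_def that(2))
  qed
  let ?G = "\<lambda>x. \<theta> (Suc k) * (?q (\<lambda>x. g x * F (Suc k) x) x - ?q g x * F k x)"
  have "E (Suc k) (\<lambda>xs. spin xs * g (site xs) * transform \<theta> D xs) =
      E k (\<lambda>xs. measure_pmf.expectation (\<kappa> xs) (\<lambda>y. fst y * g (snd y) * transform \<theta> D (y # xs)))"
    unfolding expectation_walk_Suc[OF finite_\<kappa>, where n = "Suc k"] by (simp only: list.sel)
  also have "\<dots> = E k (\<lambda>xs. ?G (site xs) + spin xs * ?q g (site xs) * transform \<theta> D xs)"
  proof (rule integral_cong_AE)
    show "AE xs in walk \<kappa> (Suc k). measure_pmf.expectation (\<kappa> xs) (\<lambda>y. fst y * g (snd y) * transform \<theta> D (y # xs)) =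
        ?G (site xs) + spin xs * ?q g (site xs) * transform \<theta> D xs"
      unfolding AE_measure_pmf_iff
    proof
      fix xs assume xs: "xs \<in> set_pmf (walk \<kappa> (Suc k))"
      hence "length xs = Suc k" by (rule length_walk)
      then obtain \<sigma> x ys where ys: "xs = (\<sigma>, x) # ys" "length ys = k" by (cases xs) auto
      have \<sigma>: "\<sigma> * \<sigma> = 1" using sign_walk[OF xs] ys by simp
      define T where "T = transform \<theta> D xs"
      \<comment> \<open>In the new increment the spin squares to \<open>1\<close> and a function of
        the positions remains; in the older transform the spin stays, as the induction hypothesis
        requires.\<close>
      have e: "\<sigma> * g x' * transform \<theta> D ((\<sigma>, x') # xs) =
          \<theta> (Suc k) * (g x' * F (Suc k) x' - g x' * F k x) + \<sigma> * g x' * T" for x'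
      proof -
        have t: "transform \<theta> D ((\<sigma>, x') # xs) = \<theta> (Suc k) * (\<sigma> * F (Suc k) x' - \<sigma> * F k x) + T"
          using ys by (simp add: T_def)
        have "\<sigma> * g x' * transform \<theta> D ((\<sigma>, x') # xs) =
            \<sigma> * \<sigma> * (\<theta> (Suc k) * (g x' * F (Suc k) x' - g x' * F k x)) + \<sigma> * g x' * T"
          unfolding t by (simp add: algebra_simps)
        thus ?thesis using \<sigma> by simp
      qed
      show "measure_pmf.expectation (\<kappa> xs) (\<lambda>y. fst y * g (snd y) * transform \<theta> D (y # xs)) =
        ?G (site xs) + spin xs * ?q g (site xs) * transform \<theta> D xs"
      proof -
        have "measure_pmf.expectation (\<kappa> xs) (\<lambda>y. fst y * g (snd y) * transform \<theta> D (y # xs)) =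
          lazy_average h (dir k) (\<lambda>x'. \<sigma> * g x' * transform \<theta> D ((\<sigma>, x') # xs)) x"
          by (simp only: ys(1) expectation_\<kappa>_Cons ys(2) fst_conv snd_conv)
        also have "\<dots> = ?G x + \<sigma> * ?q g x * T"
          unfolding e by (simp add: lazy_average_def) (simp add: algebra_simps)
        finally show ?thesis by (simp only: T_def ys(1) list.sel fst_conv snd_conv)
      qed
    qed
  qed (rule borel_measurable_pmf)+
  also have "\<dots> = E k (\<lambda>xs. ?G (site xs)) + E k (\<lambda>xs. spin xs * ?q g (site xs) * transform \<theta> D xs)"
    by (rule Bochner_Integration.integral_add) (rule integrable_E)+
  finally have E: "E (Suc k) (\<lambda>xs. spin xs * g (site xs) * transform \<theta> D xs) =
      E k (\<lambda>xs. ?G (site xs)) + E k (\<lambda>xs. spin xs * ?q g (site xs) * transform \<theta> D xs)" .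
  have E': "real (card (A 0)) * E (Suc k) (\<lambda>xs. spin xs * g (site xs) * transform \<theta> D xs) =
      (\<Sum>x\<in>A k. ?G x) + (\<Sum>x\<in>A k. ?q g x * S k x)"
    unfolding E distrib_left
  proof (rule arg_cong2[where f = "(+)"])
    show "real (card (A 0)) * E k (\<lambda>xs. ?G (site xs)) = (\<Sum>x\<in>A k. ?G x)"
      using Suc.prems by (intro expectation_position) (auto simp: supp)
    show "real (card (A 0)) * E k (\<lambda>xs. spin xs * ?q g (site xs) * transform \<theta> D xs) = (\<Sum>x\<in>A k. ?q g x * S k x)"
      using Suc.prems by (intro Suc.IH) (auto simp: supp)
  qed
  have G: "(\<Sum>x\<in>A k. ?G x) = \<theta> (Suc k) * ((\<Sum>x\<in>A k. ?q (\<lambda>x. g x * F (Suc k) x) x * 1) - (\<Sum>x\<in>A k. ?q g x * F k x))"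
    by (simp add: sum_distrib_left sum_subtractf right_diff_distrib)
  have 1: "(\<Sum>x\<in>A k. ?q (\<lambda>x. g x * F (Suc k) x) x * 1) = (\<Sum>x\<in>A (Suc k). (g x * F (Suc k) x) * ?q (\<lambda>_. 1) x)"
    using Suc.prems by (intro sum_lazy_average finite_A A_Suc) auto
  have 2: "(\<Sum>x\<in>A k. ?q g x * F k x) = (\<Sum>x\<in>A (Suc k). g x * ?q (F k) x)"
    using Suc.prems by (intro sum_lazy_average finite_A A_Suc) auto
  have 3: "(\<Sum>x\<in>A k. ?q g x * S k x) = (\<Sum>x\<in>A (Suc k). g x * ?q (S k) x)"
    using Suc.prems by (intro sum_lazy_average finite_A A_Suc) auto
  have 4: "?q (\<lambda>_. 1) x = 1" for x by (simp add: lazy_average_def)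
  have "(\<Sum>x\<in>A (Suc k). g x * S (Suc k) x) =
      (\<Sum>x\<in>A (Suc k). \<theta> (Suc k) * (g x * F (Suc k) x - g x * ?q (F k) x) + g x * ?q (S k) x)"
    using Suc.prems by (intro sum.cong refl) (simp add: S_Suc algebra_simps)
  also have "\<dots> = \<theta> (Suc k) * ((\<Sum>x\<in>A (Suc k). g x * F (Suc k) x) - (\<Sum>x\<in>A (Suc k). g x * ?q (F k) x)) +
      (\<Sum>x\<in>A (Suc k). g x * ?q (S k) x)"
    by (simp add: sum.distrib sum_distrib_left[symmetric] sum_subtractf)
  finally show ?case unfolding E' G 1 2 3 4 by simp
qed

text \<open>Conditional Jensen by tangent lines: \<open>g\<close> is the slope of the
  \<open>p\<close>-th power at \<open>c\<close>, which is \<open>S n\<close> on \<open>A n\<close>,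
  and the linear term averages to zero because \<open>S n\<close> is the conditional expectation of
  the spin times the transform. With all multipliers \<open>1\<close> the transform telescopes to
  the spin times \<open>F n\<close>.\<close>

lemma lattice_walk_bound:
  assumes p: "1 < p" and C: "choi_bound TYPE((real \<times> 'x) list) b B p C" "0 \<le> C"
    and \<theta>: "\<And>k. \<theta> k \<in> {b..B}" and supp: "\<And>x. x \<notin> A n \<Longrightarrow> F n x = 0"
  shows "(\<Sum>x\<in>A n. \<bar>S n x\<bar> powr p) \<le> C powr p * (\<Sum>x\<in>A n. \<bar>F n x\<bar> powr p)"
proof -
  let ?N = "real (card (A 0))"
  define c where "c x = (if x \<in> A n then S n x else 0)" for x
  define g where "g x = p * (sgn (c x) * \<bar>c x\<bar> powr (p - 1))" for x
  have c: "?N * E n (\<lambda>xs. \<bar>c (site xs)\<bar> powr p) = (\<Sum>x\<in>A n. \<bar>c x\<bar> powr p)"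
    "?N * E n (\<lambda>xs. g (site xs) * c (site xs)) = (\<Sum>x\<in>A n. g x * c x)"
    using p by (intro expectation_position order_refl; simp add: c_def)+
  have s: "?N * E n (\<lambda>xs. spin xs * g (site xs) * transform \<theta> D xs) = (\<Sum>x\<in>A n. g x * S n x)"
    by (intro expectation_transform order_refl) (simp add: c_def g_def)
  have one: "E n (\<lambda>xs. \<bar>transform (\<lambda>_. 1) D xs\<bar> powr p) = E n (\<lambda>xs. \<bar>F n (site xs)\<bar> powr p)"
  proof (rule integral_cong_AE)
    show "AE xs in walk \<kappa> (Suc n). \<bar>transform (\<lambda>_. 1) D xs\<bar> powr p = \<bar>F n (site xs)\<bar> powr p"
      unfolding AE_measure_pmf_iff
    proof
      fix xs assume xs: "xs \<in> set_pmf (walk \<kappa> (Suc n))"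
      then obtain \<sigma> x ys where ys: "xs = (\<sigma>, x) # ys" "length ys = n"
        using length_walk[OF xs] by (cases xs) auto
      have "\<bar>\<sigma>\<bar> = 1" using sign_walk[OF xs] ys by (auto simp: square_eq_1_iff)
      thus "\<bar>transform (\<lambda>_. 1) D xs\<bar> powr p = \<bar>F n (site xs)\<bar> powr p"
        unfolding ys(1) transform_one by (simp add: abs_mult ys(2))
    qed
  qed (rule borel_measurable_pmf)+
  have lower: "(\<Sum>x\<in>A n. \<bar>S n x\<bar> powr p) \<le> ?N * E n (\<lambda>xs. \<bar>transform \<theta> D xs\<bar> powr p)"
  proof -
    have "(\<Sum>x\<in>A n. \<bar>S n x\<bar> powr p) = (\<Sum>x\<in>A n. \<bar>c x\<bar> powr p + (g x * S n x - g x * c x))"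
      by (intro sum.cong refl) (simp add: c_def)
    also have "\<dots> = ?N * E n (\<lambda>xs. \<bar>c (site xs)\<bar> powr p) +
       (?N * E n (\<lambda>xs. spin xs * g (site xs) * transform \<theta> D xs) - ?N * E n (\<lambda>xs. g (site xs) * c (site xs)))"
      unfolding sum.distrib sum_subtractf c s ..
    also have "\<dots> = ?N * E n (\<lambda>xs. \<bar>c (site xs)\<bar> powr p + (spin xs * g (site xs) * transform \<theta> D xs - g (site xs) * c (site xs)))"
      by (simp only: Bochner_Integration.integral_add[OF integrable_E integrable_E]
        Bochner_Integration.integral_diff[OF integrable_E integrable_E] distrib_left right_diff_distrib)
    also have "\<dots> \<le> ?N * E n (\<lambda>xs. \<bar>transform \<theta> D xs\<bar> powr p)"
    proof (intro mult_left_mono integral_mono_AE integrable_E)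
      show "AE xs in walk \<kappa> (Suc n). \<bar>c (site xs)\<bar> powr p + (spin xs * g (site xs) * transform \<theta> D xs - g (site xs) * c (site xs))
          \<le> \<bar>transform \<theta> D xs\<bar> powr p"
        unfolding AE_measure_pmf_iff
      proof
        fix xs assume xs: "xs \<in> set_pmf (walk \<kappa> (Suc n))"
        have "\<bar>spin xs\<bar> = 1" using sign_walk[OF xs] by (auto simp: square_eq_1_iff)
        thus "\<bar>c (site xs)\<bar> powr p + (spin xs * g (site xs) * transform \<theta> D xs - g (site xs) * c (site xs))
          \<le> \<bar>transform \<theta> D xs\<bar> powr p"
          using powr_tangent_line[OF p, of "c (site xs)" "spin xs * transform \<theta> D xs"]
          by (simp add: g_def abs_mult algebra_simps)
      qed
    qed simp
    finally show ?thesis .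
  qed
  also have "\<dots> \<le> ?N * (C powr p * E n (\<lambda>xs. \<bar>transform (\<lambda>_. 1) D xs\<bar> powr p))"
    by (intro mult_left_mono walk_transform_bound[OF finite_\<kappa> p C mean_D \<theta>]) auto
  also have "\<dots> = C powr p * (?N * E n (\<lambda>xs. \<bar>F n (site xs)\<bar> powr p))"
    unfolding one by (simp only: mult_ac)
  also have "?N * E n (\<lambda>xs. \<bar>F n (site xs)\<bar> powr p) = (\<Sum>x\<in>A n. \<bar>F n x\<bar> powr p)"
    using p by (intro expectation_position) (auto simp: supp)
  finally show ?thesis .
qed

end

section \<open>Periodic envelopes\<close>

text \<open>Let \<open>g\<close> be the function minus its chord. In the left half, midpoint
  concavity against the end point where \<open>g\<close> vanishes gives
  \<open>g (2 * s) / 2 \<le> g s\<close>, and the right half is symmetric. Hence the infimum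
  \<open>I\<close> of \<open>g\<close>, finite by the lower bound, satisfies
  \<open>I / 2 \<le> I\<close> and is nonnegative.\<close>

lemma concave_on_midpoint:
  fixes \<phi> :: "real \<Rightarrow> real"
  assumes mid: "\<And>x t. (\<phi> (x + t) + \<phi> (x - t)) / 2 \<le> \<phi> x"
    and lower: "\<And>M. \<exists>L. \<forall>x. \<bar>x\<bar> \<le> M \<longrightarrow> L \<le> \<phi> x"
  shows "concave_on UNIV \<phi>"
  unfolding concave_on_iff
proof (intro conjI ballI allI impI)
  fix x y u v :: real assume uv: "0 \<le> u" "0 \<le> v" "u + v = 1"
  define g where "g s = \<phi> (x + s * (y - x)) - (1 - s) * \<phi> x - s * \<phi> y" for s
  define I where "I = (INF s\<in>{0..1}. g s)"
  obtain L where L: "\<And>z. \<bar>z\<bar> \<le> \<bar>x\<bar> + \<bar>y\<bar> \<Longrightarrow> L \<le> \<phi> z" using lower by blast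
  have bdd: "bdd_below (g ` {0..1})"
  proof (rule bdd_belowI2)
    fix s :: real assume s: "s \<in> {0..1}"
    have "x + s * (y - x) = (1 - s) * x + s * y" by (simp add: algebra_simps)
    moreover have "\<bar>(1 - s) * x + s * y\<bar> \<le> (1 - s) * \<bar>x\<bar> + s * \<bar>y\<bar>"
      using s abs_triangle_ineq[of "(1 - s) * x" "s * y"] by (simp add: abs_mult)
    moreover have "(1 - s) * \<bar>x\<bar> \<le> 1 * \<bar>x\<bar>" "s * \<bar>y\<bar> \<le> 1 * \<bar>y\<bar>" using s by (intro mult_right_mono; simp)+
    ultimately have "L \<le> \<phi> (x + s * (y - x))" by (intro L) linarith
    moreover have "(1 - s) * \<phi> x \<le> \<bar>\<phi> x\<bar>" "s * \<phi> y \<le> \<bar>\<phi> y\<bar>"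
      using s mult_left_le_one_le[of "\<bar>\<phi> x\<bar>" "1 - s"] mult_left_le_one_le[of "\<bar>\<phi> y\<bar>" s]
        mult_left_mono[OF abs_ge_self[of "\<phi> x"], of "1 - s"] mult_left_mono[OF abs_ge_self[of "\<phi> y"], of s] by auto
    ultimately show "L - \<bar>\<phi> x\<bar> - \<bar>\<phi> y\<bar> \<le> g s" by (simp add: g_def)
  qed
  have I: "I \<le> g s" if "s \<in> {0..1}" for s unfolding I_def by (rule cINF_lower[OF bdd that])
  have "I / 2 \<le> g s" if s: "s \<in> {0..1}" for s
  proof (cases "s \<le> 1 / 2")
    case True
    have "(\<phi> (x + s * (y - x) + s * (y - x)) + \<phi> (x + s * (y - x) - s * (y - x))) / 2 \<le> \<phi> (x + s * (y - x))"
      by (rule mid)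
    also have "x + s * (y - x) + s * (y - x) = x + (2 * s) * (y - x)" by (simp add: algebra_simps)
    finally have "g (2 * s) / 2 \<le> g s" unfolding g_def by (simp add: field_simps)
    thus ?thesis using I[of "2 * s"] True s by simp
  next
    case False
    let ?t = "(1 - s) * (y - x)"
    have "(\<phi> (x + s * (y - x) + ?t) + \<phi> (x + s * (y - x) - ?t)) / 2 \<le> \<phi> (x + s * (y - x))"
      by (rule mid)
    also have "x + s * (y - x) + ?t = y" by (simp add: algebra_simps)
    also have "x + s * (y - x) - ?t = x + (2 * s - 1) * (y - x)" by (simp add: algebra_simps)
    finally have "g (2 * s - 1) / 2 \<le> g s" unfolding g_def by (simp add: field_simps)
    thus ?thesis using I[of "2 * s - 1"] False s by simp
  qed
  hence "I / 2 \<le> I" unfolding I_def by (intro cINF_greatest) auto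
  hence "0 \<le> g v" using I[of v] uv by simp
  moreover have u: "u = 1 - v" using uv by simp
  ultimately show "u * \<phi> x + v * \<phi> y \<le> \<phi> (u *\<^sub>R x + v *\<^sub>R y)"
    unfolding u by (simp add: g_def algebra_simps)
qed auto

section \<open>Averages over periodic perturbations\<close>

definition periodic :: "nat \<Rightarrow> (int \<Rightarrow> int \<Rightarrow> real) \<Rightarrow> bool" where
  "periodic m w \<longleftrightarrow> 0 < m \<and> (\<forall>x y. w (x + int m) y = w x y \<and> w x (y + int m) = w x y)"

definition diff2_fst :: "(int \<Rightarrow> int \<Rightarrow> real) \<Rightarrow> int \<Rightarrow> int \<Rightarrow> real" where
  "diff2_fst w x y = w (x + 1) y + w (x - 1) y - 2 * w x y"

definition diff2_snd :: "(int \<Rightarrow> int \<Rightarrow> real) \<Rightarrow> int \<Rightarrow> int \<Rightarrow> real" where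
  "diff2_snd w x y = w x (y + 1) + w x (y - 1) - 2 * w x y"

definition periodic_integrand ::
    "(real \<Rightarrow> real \<Rightarrow> real) \<Rightarrow> (int \<Rightarrow> int \<Rightarrow> real) \<Rightarrow> real \<Rightarrow> real \<Rightarrow> int \<Rightarrow> int \<Rightarrow> real" where
  "periodic_integrand h w r s x y = h (r + diff2_fst w x y) (s + diff2_snd w x y)"

definition periodic_average ::
    "(real \<Rightarrow> real \<Rightarrow> real) \<Rightarrow> (int \<Rightarrow> int \<Rightarrow> real) \<Rightarrow> nat \<Rightarrow> real \<Rightarrow> real \<Rightarrow> real" where
  "periodic_average h w m r s =
     (\<Sum>x<m. \<Sum>y<m. periodic_integrand h w r s (int x) (int y)) / (real m)\<^sup>2"

text \<open>Both second differences of \<open>w\<close> have mean zero over a period, so these are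
  averages of \<open>h\<close> over perturbations around \<open>(r, s)\<close>. Their supremum is
  the discrete analogue of the quasiconvex envelope in the calculus of variations, with the sign
  reversed.\<close>

definition attainable :: "(real \<Rightarrow> real \<Rightarrow> real) \<Rightarrow> real \<Rightarrow> real \<Rightarrow> real set" where
  "attainable h r s = {periodic_average h w m r s | w m. periodic m w}"

lemma periodic_shift:
  assumes "periodic m w"
  shows "w (x + int m * k) y = w x y" "w x (y + int m * k) = w x y"
proof -
  have 1: "w (x + int m * int n) y = w x y" "w x (y + int m * int n) = w x y" for n x y
  proof (induction n)
    case (Suc n)
    have "z + int m * int (Suc n) = z + int m * int n + int m" for z by (simp add: algebra_simps)
    thus "w (x + int m * int (Suc n)) y = w x y" "w x (y + int m * int (Suc n)) = w x y"
      using Suc assms unfolding periodic_def by metis+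
  qed auto
  have 2: "w (x - int m * int n) y = w x y" "w x (y - int m * int n) = w x y" for n
    using 1(1)[where n = n and x = "x - int m * int n" and y = y]
      1(2)[where n = n and x = x and y = "y - int m * int n"] by auto
  show "w (x + int m * k) y = w x y" "w x (y + int m * k) = w x y"
    using 1[where n = "nat k" and x = x and y = y] 2[of "nat (- k)"] by (cases "0 \<le> k"; simp)+
qed

lemma periodic_mult: "periodic m w \<Longrightarrow> 0 < k \<Longrightarrow> periodic (m * k) w"
  using periodic_shift[of m w, where k = "int k"] by (auto simp: periodic_def)

lemma periodic_bounded:
  assumes "periodic m w"
  shows "\<exists>c. \<forall>x y. \<bar>w x y\<bar> \<le> c"
proof -
  have m: "0 < m" using assms by (simp add: periodic_def)
  let ?A = "(\<lambda>(x, y). \<bar>w x y\<bar>) ` ({0..<int m} \<times> {0..<int m})"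
  have "\<bar>w x y\<bar> \<le> Max ?A" for x y
  proof (rule Max_ge)
    have "w x y = w (x mod int m) (y mod int m)"
      using periodic_shift(1)[OF assms, where x = "x mod int m" and k = "x div int m" and y = y]
        periodic_shift(2)[OF assms, where x = "x mod int m" and y = "y mod int m" and k = "y div int m"] by simp
    thus "\<bar>w x y\<bar> \<in> ?A" using m by (intro image_eqI[of _ _ "(x mod int m, y mod int m)"]) auto
  qed auto
  thus ?thesis by blast
qed

lemma periodic_integrand:
  assumes "periodic m w"
  shows "periodic m (periodic_integrand h w r s)"
proof -
  have p: "w (x + int m) y = w x y" "w x (y + int m) = w x y" for x y
    using assms by (auto simp: periodic_def)
  have "w (x + int m + 1) y = w (x + 1) y" "w (x + int m - 1) y = w (x - 1) y"
    "w x (y + int m + 1) = w x (y + 1)" "w x (y + int m - 1) = w x (y - 1)" for x y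
    using p(1)[of "x + 1" y] p(1)[of "x - 1" y] p(2)[of x "y + 1"] p(2)[of x "y - 1"] by (auto simp: algebra_simps)
  thus ?thesis using assms p by (simp add: periodic_def periodic_integrand_def diff2_fst_def diff2_snd_def)
qed

lemma sum_periodic:
  fixes f :: "int \<Rightarrow> real"
  assumes "\<And>x. f (x + int m) = f x"
  shows "(\<Sum>x<k * m. f (int x)) = real k * (\<Sum>x<m. f (int x))"
proof -
  have per: "f (int x + int (i * m)) = f (int x)" for x i
  proof (induction i)
    case (Suc i)
    have "f (int x + int (Suc i * m)) = f (int x + int (i * m) + int m)" by (simp add: algebra_simps)
    thus ?case using Suc assms by simp
  qed simp
  have "(\<Sum>x=i * m..<i * m + m. f (int x)) = (\<Sum>x<m. f (int x))" for i
  proof -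
    have "(\<Sum>x=i * m..<i * m + m. f (int x)) = (\<Sum>x=0..<m. f (int (x + i * m)))"
      using sum.shift_bounds_nat_ivl[of "\<lambda>x. f (int x)" 0 "i * m" m] by (simp add: add.commute)
    also have "\<dots> = (\<Sum>x<m. f (int x))" using per by (simp add: lessThan_atLeast0)
    finally show ?thesis .
  qed
  thus ?thesis using sum.nat_group[of "\<lambda>x. f (int x)" m k] by simp
qed

lemma sum_periodic2:
  assumes "periodic m w"
  shows "(\<Sum>x<k * m. \<Sum>y<l * m. w (int x) (int y)) = real k * real l * (\<Sum>x<m. \<Sum>y<m. w (int x) (int y))"
proof -
  have "(\<Sum>y<l * m. w x (int y)) = real l * (\<Sum>y<m. w x (int y))" for x
    using assms by (intro sum_periodic) (simp add: periodic_def)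
  hence "(\<Sum>x<k * m. \<Sum>y<l * m. w (int x) (int y)) = (\<Sum>x<k * m. real l * (\<Sum>y<m. w (int x) (int y)))" by simp
  also have "\<dots> = real k * (\<Sum>x<m. real l * (\<Sum>y<m. w (int x) (int y)))"
    using assms by (intro sum_periodic[of "\<lambda>x. real l * (\<Sum>y<m. w x (int y))"]) (simp add: periodic_def)
  finally show ?thesis by (simp add: sum_distrib_left mult_ac)
qed

lemma periodic_average_mult:
  assumes "periodic m w" "0 < k"
  shows "periodic_average h w (m * k) r s = periodic_average h w m r s"
proof -
  have "0 < m" using assms(1) by (simp add: periodic_def)
  thus ?thesis
    using assms(2) unfolding periodic_average_def mult.commute[of m k]
    by (subst sum_periodic2[OF periodic_integrand[OF assms(1)]]) (simp add: power2_eq_square)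
qed

lemma attainable_self: "h r s \<in> attainable h r s"
proof -
  have "periodic 1 (\<lambda>_ _. 0)" by (simp add: periodic_def)
  moreover have "periodic_average h (\<lambda>_ _. 0) 1 r s = h r s"
    by (simp add: periodic_average_def periodic_integrand_def diff2_fst_def diff2_snd_def)
  ultimately show ?thesis unfolding attainable_def by force
qed

lemma attainable_swap: "attainable h r s = attainable (\<lambda>s r. h r s) s r"
proof -
  have "attainable h r s \<subseteq> attainable (\<lambda>s r. h r s) s r" for h and r s :: real
  proof
    fix a assume "a \<in> attainable h r s"
    then obtain w m where w: "periodic m w" "a = periodic_average h w m r s" by (auto simp: attainable_def)
    have "periodic m (\<lambda>x y. w y x)" using w by (simp add: periodic_def)
    moreover have "a = periodic_average (\<lambda>s r. h r s) (\<lambda>x y. w y x) m s r"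
      unfolding w(2) periodic_average_def periodic_integrand_def diff2_fst_def diff2_snd_def
      by (subst sum.swap) simp
    ultimately show "a \<in> attainable (\<lambda>s r. h r s) s r" unfolding attainable_def by blast
  qed
  from this[of h r s] this[of "\<lambda>s r. h r s" s r] show ?thesis by auto
qed

text \<open>A laminate: the parabolic sawtooth \<open>W\<close> has second difference \<open>t\<close> and \<open>- t\<close> on alternating
  strips of width \<open>l\<close>, into which periodic competitors for \<open>r + t\<close> and \<open>r - t\<close> are pasted.
  Only the two sites at either end of a strip see the junction.\<close>

lemma attainable_midpoint:
  assumes bounded: "\<And>M. \<exists>H. \<forall>r s. \<bar>r\<bar> \<le> M \<and> \<bar>s\<bar> \<le> M \<longrightarrow> \<bar>h r s\<bar> \<le> H"
    and a: "a \<in> attainable h (r + t) s" and a': "a' \<in> attainable h (r - t) s" and \<epsilon>: "0 < \<epsilon>"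
  shows "\<exists>a''\<in>attainable h r s. (a + a') / 2 - \<epsilon> \<le> a''"
proof -
  obtain m1 w1 m2 w2 where w: "periodic m1 w1" "a = periodic_average h w1 m1 (r + t) s"
    "periodic m2 w2" "a' = periodic_average h w2 m2 (r - t) s"
    using a a' by (auto simp: attainable_def)
  define m where "m = m1 * m2"
  have m12: "0 < m1" "0 < m2" using w by (auto simp: periodic_def)
  hence m: "0 < m" by (simp add: m_def)
  have per: "periodic m w1" "periodic m w2"
    using periodic_mult[OF w(1) m12(2)] periodic_mult[OF w(3) m12(1)] by (simp_all add: m_def mult.commute)
  have av: "a = periodic_average h w1 m (r + t) s" "a' = periodic_average h w2 m (r - t) s"
    using periodic_average_mult[OF w(1) m12(2)] periodic_average_mult[OF w(3) m12(1)] w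
    by (simp_all add: m_def mult.commute)
  obtain c1 c2 where "\<And>x y. \<bar>w1 x y\<bar> \<le> c1" "\<And>x y. \<bar>w2 x y\<bar> \<le> c2"
    using periodic_bounded[OF per(1)] periodic_bounded[OF per(2)] by blast
  then obtain c where c: "\<And>x y. \<bar>w1 x y\<bar> \<le> c" "\<And>x y. \<bar>w2 x y\<bar> \<le> c"
    using that[of "max c1 c2"] by (meson max.coboundedI1 max.coboundedI2)
  have c0: "0 \<le> c" using c(1)[of 0 0] by linarith
  obtain H where H: "\<And>r' s'. \<bar>r'\<bar> \<le> \<bar>r\<bar> + \<bar>s\<bar> + \<bar>t\<bar> + 4 * c \<Longrightarrow> \<bar>s'\<bar> \<le> \<bar>r\<bar> + \<bar>s\<bar> + \<bar>t\<bar> + 4 * c \<Longrightarrow> \<bar>h r' s'\<bar> \<le> H"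
    using bounded[of "\<bar>r\<bar> + \<bar>s\<bar> + \<bar>t\<bar> + 4 * c"] by blast
  have H0: "0 \<le> H" using H[of 0 0] c0 by linarith
  \<comment> \<open>Four exceptional columns out of \<open>2 * l\<close> cost at most
    \<open>4 * H / l\<close> in the average, and \<open>l\<close> is at least
    \<open>k\<close>.\<close>
  obtain k :: nat where k: "4 * H / \<epsilon> < real k" "3 \<le> k"
    by (metis (no_types) max.cobounded1 max.cobounded2 of_nat_mono order_less_le_trans reals_Archimedean2)
  \<comment> \<open>A multiple of the common period, so that both competitors complete whole periods
    in their strips.\<close>
  define l where "l = int k * int m"
  have "3 * 1 \<le> k * m" using k(2) m by (intro mult_le_mono) auto
  hence "int 3 \<le> int (k * m)" by (intro of_nat_mono) simp
  hence l: "3 \<le> l" by (simp add: l_def)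
  \<comment> \<open>Two opposite parabolic arcs with zeros at \<open>0\<close>, \<open>l\<close> and
    \<open>2 * l\<close>. Point symmetry at these junctions makes the second difference there
    \<open>0\<close>.\<close>
  define W where "W x = (let j = x mod (2 * l) in
     if j < l then t * of_int j * of_int (j - l) / 2 else - t * of_int (j - l) * of_int (j - 2 * l) / 2)" for x :: int
  define u where "u x y = W x + (if x mod (2 * l) < l then w1 x y else w2 x y)" for x y
  have W_per: "W (x + 2 * l) = W x" for x by (simp add: W_def)
  have W1: "W x = t * of_int x * of_int (x - l) / 2" if "0 \<le> x" "x \<le> l" for x
    using that l by (cases "x = l") (auto simp: W_def mod_pos_pos_trivial)
  have W2: "W x = - t * of_int (x - l) * of_int (x - 2 * l) / 2" if "l \<le> x" "x \<le> 2 * l" for x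
    using that l by (cases "x = 2 * l") (auto simp: W_def mod_pos_pos_trivial)
  have dW: "W (x + 1) + W (x - 1) - 2 * W x = (if x = 0 \<or> x = l then 0 else if x < l then t else - t)"
    if x: "0 \<le> x" "x < 2 * l" for x
  proof -
    consider "x = 0" | "x = l" | "0 < x" "x < l" | "l < x" using x by linarith
    thus ?thesis
    proof cases
      case 1
      thus ?thesis using l W_per[of "- 1"] by (simp add: W1 W2 field_simps)
    next
      case 2
      thus ?thesis using l by (simp add: W1 W2 field_simps)
    next
      case 3
      thus ?thesis using l by (simp add: W1 field_simps)
    next
      case 4
      thus ?thesis using l x by (simp add: W2 field_simps)
    qed
  qed
  let ?L = "nat l"
  have L: "int ?L = l" "0 < ?L" "?L = k * m" "2 * ?L = (2 * k) * m" using l m k(2) by (auto simp: l_def of_nat_mult[symmetric] simp del: of_nat_mult)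
  have "periodic (2 * ?L) u"
  proof -
    have "w1 (x + 2 * l) y = w1 x y" "w2 (x + 2 * l) y = w2 x y" "w1 x (y + 2 * l) = w1 x y" "w2 x (y + 2 * l) = w2 x y" for x y
      using periodic_shift[OF per(1), where k = "2 * int k"] periodic_shift[OF per(2), where k = "2 * int k"]
      by (simp_all add: l_def mult_ac)
    thus ?thesis using L W_per by (simp add: periodic_def u_def)
  qed
  hence mem: "periodic_average h u (2 * ?L) r s \<in> attainable h r s" unfolding attainable_def by blast
  let ?I = "periodic_integrand h u r s"
  let ?G1 = "periodic_integrand h w1 (r + t) s" and ?G2 = "periodic_integrand h w2 (r - t) s"
  define G where "G x y = (if x < l then ?G1 x y else ?G2 x y)" for x y
  \<comment> \<open>The columns with a horizontal neighbour in the other strip; in all others only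
    one competitor is seen.\<close>
  define bad where "bad = {0, l - 1, l, 2 * l - 1}"
  have w_le: "\<bar>w1 x y + w1 x' y' - 2 * w1 z z'\<bar> \<le> 4 * c" "\<bar>w2 x y + w2 x' y' - 2 * w2 z z'\<bar> \<le> 4 * c" for x y x' y' z z'
    using c(1)[of x y] c(1)[of x' y'] c(1)[of z z'] c(2)[of x y] c(2)[of x' y'] c(2)[of z z'] by linarith+
  have mix_le: "\<bar>(if P then w1 x y else w2 x y) + (if P' then w1 x' y' else w2 x' y') - 2 * (if P'' then w1 z z' else w2 z z')\<bar> \<le> 4 * c"
    for P P' P'' x y x' y' z z'
    using c(1)[of x y] c(1)[of x' y'] c(1)[of z z'] c(2)[of x y] c(2)[of x' y'] c(2)[of z z'] by (auto split: if_splits)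
  have compare: "G x y - (if x \<in> bad then 2 * H else 0) \<le> ?I x y" if x: "0 \<le> x" "x < 2 * l" for x y
  proof (cases "x \<in> bad")
    case True
    have tri: "\<bar>a + b + d\<bar> \<le> \<bar>a\<bar> + \<bar>z\<bar> + \<bar>b\<bar> + 4 * c" "\<bar>a - b + d\<bar> \<le> \<bar>a\<bar> + \<bar>z\<bar> + \<bar>b\<bar> + 4 * c"
      "\<bar>z + d\<bar> \<le> \<bar>a\<bar> + \<bar>z\<bar> + \<bar>b\<bar> + 4 * c" if "\<bar>d\<bar> \<le> 4 * c" for a b d z :: real
      using that by linarith+
    have "\<bar>?G1 x y\<bar> \<le> H" "\<bar>?G2 x y\<bar> \<le> H"
      unfolding periodic_integrand_def diff2_fst_def diff2_snd_def by (intro H tri w_le)+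
    hence "\<bar>G x y\<bar> \<le> H" by (simp add: G_def)
    moreover have "\<bar>?I x y\<bar> \<le> H"
      unfolding periodic_integrand_def
    proof (rule H)
      have "\<bar>W (x + 1) + W (x - 1) - 2 * W x\<bar> \<le> \<bar>t\<bar>" by (simp add: dW[OF x])
      moreover have "diff2_fst u x y = (W (x + 1) + W (x - 1) - 2 * W x) +
         ((if (x + 1) mod (2 * l) < l then w1 (x + 1) y else w2 (x + 1) y) +
          (if (x - 1) mod (2 * l) < l then w1 (x - 1) y else w2 (x - 1) y) -
          2 * (if x mod (2 * l) < l then w1 x y else w2 x y))"
        unfolding diff2_fst_def u_def by (simp only: distrib_left)
      ultimately show "\<bar>r + diff2_fst u x y\<bar> \<le> \<bar>r\<bar> + \<bar>s\<bar> + \<bar>t\<bar> + 4 * c"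
        using mix_le[of "(x + 1) mod (2 * l) < l" "x + 1" y "(x - 1) mod (2 * l) < l" "x - 1" y "x mod (2 * l) < l" x y]
        by linarith
      have "diff2_snd u x y = (if x mod (2 * l) < l then w1 x (y + 1) + w1 x (y - 1) - 2 * w1 x y else w2 x (y + 1) + w2 x (y - 1) - 2 * w2 x y)"
        by (simp add: diff2_snd_def u_def)
      thus "\<bar>s + diff2_snd u x y\<bar> \<le> \<bar>r\<bar> + \<bar>s\<bar> + \<bar>t\<bar> + 4 * c"
        using w_le(1)[of x "y + 1" x "y - 1" x y] w_le(2)[of x "y + 1" x "y - 1" x y] by (auto split: if_splits)
    qed
    ultimately show ?thesis using True by (simp add: abs_le_iff)
  next
    case False
    have md: "z mod (2 * l) = z" if "z \<in> {x - 1, x, x + 1}" for z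
      using that False x by (intro mod_pos_pos_trivial) (auto simp: bad_def)
    have br: "x - 1 < l \<longleftrightarrow> x < l" "x + 1 < l \<longleftrightarrow> x < l" using False by (auto simp: bad_def)
    note md = md[of "x - 1", simplified] md[of x, simplified] md[of "x + 1", simplified]
    have "diff2_fst u x y = (W (x + 1) + W (x - 1) - 2 * W x) + (if x < l then diff2_fst w1 x y else diff2_fst w2 x y)"
      "diff2_snd u x y = (if x < l then diff2_snd w1 x y else diff2_snd w2 x y)"
      by (simp_all add: diff2_fst_def diff2_snd_def u_def md br)
    moreover have "x \<noteq> 0" "x \<noteq> l" using False by (auto simp: bad_def)
    ultimately have "?I x y = G x y"
      unfolding dW[OF x] by (simp add: periodic_integrand_def G_def algebra_simps)
    thus ?thesis using False by simp
  qed
  have sumG: "(\<Sum>x<2 * ?L. \<Sum>y<2 * ?L. G (int x) (int y)) = 2 * (real ?L)\<^sup>2 * (a + a')"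
  proof -
    let ?row = "\<lambda>x. \<Sum>y<2 * ?L. G (int x) (int y)"
    have "sum ?row {..<?L} = (\<Sum>x<k * m. \<Sum>y<(2 * k) * m. ?G1 (int x) (int y))"
      unfolding L(4)[symmetric] L(3)[symmetric] using L(1) by (intro sum.cong refl) (auto simp: G_def)
    also have "\<dots> = real k * real (2 * k) * ((real m)\<^sup>2 * a)"
      using m by (subst sum_periodic2[OF periodic_integrand[OF per(1)]]) (simp add: av periodic_average_def)
    finally have 1: "sum ?row {..<?L} = real k * real (2 * k) * ((real m)\<^sup>2 * a)" .
    have "sum ?row {?L..<?L + ?L} = (\<Sum>x<?L. ?row (x + ?L))"
      using sum.shift_bounds_nat_ivl[of ?row 0 ?L ?L] by (simp add: lessThan_atLeast0)
    also have "\<dots> = (\<Sum>x<k * m. \<Sum>y<(2 * k) * m. ?G2 (int x) (int y))"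
      unfolding L(4)[symmetric] L(3)[symmetric]
    proof (intro sum.cong refl)
      fix x y
      have "?G2 (int (x + ?L)) (int y) = ?G2 (int x + int m * int k) (int y)" using L by (simp add: l_def mult.commute)
      also have "\<dots> = ?G2 (int x) (int y)" by (rule periodic_shift[OF periodic_integrand[OF per(2)]])
      finally show "G (int (x + ?L)) (int y) = ?G2 (int x) (int y)" using L(1) by (simp add: G_def)
    qed
    also have "\<dots> = real k * real (2 * k) * ((real m)\<^sup>2 * a')"
      using m by (subst sum_periodic2[OF periodic_integrand[OF per(2)]]) (simp add: av periodic_average_def)
    finally have 2: "sum ?row {?L..<?L + ?L} = real k * real (2 * k) * ((real m)\<^sup>2 * a')" .
    have "sum ?row {..<2 * ?L} = sum ?row {..<?L} + sum ?row {?L..<?L + ?L}"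
      unfolding lessThan_atLeast0 mult_2 by (rule sum.atLeastLessThan_concat[symmetric]) auto
    thus ?thesis unfolding 1 2 unfolding L(3) by (simp add: power2_eq_square algebra_simps)
  qed
  have bad: "(\<Sum>x<2 * ?L. \<Sum>y<2 * ?L. if int x \<in> bad then 2 * H else 0) \<le> 4 * (real (2 * ?L) * (2 * H))"
  proof -
    let ?B = "{x \<in> {..<2 * ?L}. int x \<in> bad}"
    have "?B \<subseteq> nat ` bad" by force
    hence "card ?B \<le> card (nat ` bad)" by (intro card_mono) (auto simp: bad_def)
    moreover have "card (nat ` bad) \<le> card bad" by (rule card_image_le) (simp add: bad_def)
    moreover have "card bad \<le> 4" by (simp add: bad_def card_insert_if)
    ultimately have card: "real (card ?B) \<le> 4" by simp
    have "(\<Sum>x<2 * ?L. \<Sum>y<2 * ?L. if int x \<in> bad then 2 * H else 0) =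
        (\<Sum>x<2 * ?L. if int x \<in> bad then real (2 * ?L) * (2 * H) else 0)"
      by (intro sum.cong refl) auto
    moreover have "(\<Sum>x<2 * ?L. if int x \<in> bad then real (2 * ?L) * (2 * H) else 0) = real (card ?B) * (real (2 * ?L) * (2 * H))"
      by (subst sum.inter_filter[symmetric]) auto
    moreover have "real (card ?B) * (real (2 * ?L) * (2 * H)) \<le> 4 * (real (2 * ?L) * (2 * H))"
      using card H0 by (intro mult_right_mono) auto
    ultimately show ?thesis by linarith
  qed
  have cmp: "(\<Sum>x<2 * ?L. \<Sum>y<2 * ?L. G (int x) (int y)) - (\<Sum>x<2 * ?L. \<Sum>y<2 * ?L. if int x \<in> bad then 2 * H else 0)
      \<le> (\<Sum>x<2 * ?L. \<Sum>y<2 * ?L. ?I (int x) (int y))"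
    unfolding sum_subtractf[symmetric] using L(1) by (intro sum_mono compare) auto
  have avg: "(\<Sum>x<2 * ?L. \<Sum>y<2 * ?L. ?I (int x) (int y)) = 4 * (real ?L)\<^sup>2 * periodic_average h u (2 * ?L) r s"
    using L(2) by (simp add: periodic_average_def power2_eq_square)
  have main: "2 * (real ?L)\<^sup>2 * (a + a') - 16 * real ?L * H \<le> 4 * (real ?L)\<^sup>2 * periodic_average h u (2 * ?L) r s"
    using bad cmp unfolding avg sumG by simp
  have "4 * H < \<epsilon> * real k" using k \<epsilon> by (simp add: field_simps)
  also have "\<dots> \<le> \<epsilon> * real ?L" using \<epsilon> m mult_left_mono[of 1 "real m" "real k"] unfolding L(3) by simp
  finally have "16 * real ?L * H \<le> 4 * (real ?L)\<^sup>2 * \<epsilon>" using L(2) by (simp add: power2_eq_square)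
  hence "4 * (real ?L)\<^sup>2 * ((a + a') / 2 - \<epsilon>) \<le> 4 * (real ?L)\<^sup>2 * periodic_average h u (2 * ?L) r s"
    using main by (simp add: algebra_simps)
  hence "(a + a') / 2 - \<epsilon> \<le> periodic_average h u (2 * ?L) r s" using L(2) by (subst (asm) mult_le_cancel_left_pos) auto
  thus ?thesis using mem by blast
qed

lemma concave_on_Sup_midpoint:
  fixes A :: "real \<Rightarrow> real set" and \<phi> :: "real \<Rightarrow> real"
  assumes bdd: "\<And>x. bdd_above (A x)" and mem: "\<And>x. \<phi> x \<in> A x"
    and lower: "\<And>M. \<exists>L. \<forall>x. \<bar>x\<bar> \<le> M \<longrightarrow> L \<le> \<phi> x"
    and mid: "\<And>a x t a' \<epsilon>. \<lbrakk>a \<in> A (x + t); a' \<in> A (x - t); 0 < \<epsilon>\<rbrakk> \<Longrightarrow> \<exists>a''\<in>A x. (a + a') / 2 - \<epsilon> \<le> a''"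
  shows "concave_on UNIV (\<lambda>x. Sup (A x))"
proof (rule concave_on_midpoint)
  have "\<phi> x \<le> Sup (A x)" for x by (rule cSup_upper[OF mem bdd])
  thus "\<exists>L. \<forall>x. \<bar>x\<bar> \<le> M \<longrightarrow> L \<le> Sup (A x)" for M
    using lower[of M] by (meson order_trans)
  show "(Sup (A (x + t)) + Sup (A (x - t))) / 2 \<le> Sup (A x)" for x t
  proof (rule field_le_epsilon)
    fix e :: real assume e: "0 < e"
    have approx: "\<exists>a\<in>A y. Sup (A y) - e / 2 < a" for y
      using mem[of y] e by (intro less_cSupD) auto
    obtain a a' where a: "a \<in> A (x + t)" "Sup (A (x + t)) - e / 2 < a"
      "a' \<in> A (x - t)" "Sup (A (x - t)) - e / 2 < a'"
      using approx by blast
    obtain a'' where a'': "a'' \<in> A x" "(a + a') / 2 - e / 2 \<le> a''"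
      using mid[OF a(1,3), of "e / 2"] e by auto
    thus "(Sup (A (x + t)) + Sup (A (x - t))) / 2 \<le> Sup (A x) + e"
      using cSup_upper[OF a''(1) bdd] a by argo
  qed
qed

section \<open>The biconcave envelope\<close>

context
  fixes h :: "real \<Rightarrow> real \<Rightarrow> real"
  assumes continuous: "continuous_on UNIV (\<lambda>z. h (fst z) (snd z))"
    and nonpos: "\<And>a. a \<in> attainable h 0 0 \<Longrightarrow> a \<le> 0"
begin

lemma locally_bounded: "\<exists>H. \<forall>r s. \<bar>r\<bar> \<le> M \<and> \<bar>s\<bar> \<le> M \<longrightarrow> \<bar>h r s\<bar> \<le> H"
proof -
  have "compact ((\<lambda>z. h (fst z) (snd z)) ` ({- M..M} \<times> {- M..M}))"
    by (intro compact_continuous_image continuous_on_subset[OF continuous] compact_Times compact_Icc) auto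
  then obtain H where H: "\<forall>x\<in>(\<lambda>z. h (fst z) (snd z)) ` ({- M..M} \<times> {- M..M}). norm x \<le> H"
    using compact_imp_bounded bounded_iff by blast
  have "\<bar>h r s\<bar> \<le> H" if "\<bar>r\<bar> \<le> M" "\<bar>s\<bar> \<le> M" for r s
  proof -
    have "(r, s) \<in> {- M..M} \<times> {- M..M}" using that by (auto simp: abs_le_iff)
    from H[rule_format, OF imageI, OF this] have "norm (h (fst (r, s)) (snd (r, s))) \<le> H" .
    thus ?thesis by simp
  qed
  thus ?thesis by blast
qed

lemma attainable_midpoint_fst:
  "\<lbrakk>a \<in> attainable h (r + t) s; a' \<in> attainable h (r - t) s; 0 < \<epsilon>\<rbrakk>
    \<Longrightarrow> \<exists>a''\<in>attainable h r s. (a + a') / 2 - \<epsilon> \<le> a''"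
  by (rule attainable_midpoint[OF locally_bounded])

lemma attainable_midpoint_snd:
  assumes "a \<in> attainable h r (s + t)" "a' \<in> attainable h r (s - t)" "0 < \<epsilon>"
  shows "\<exists>a''\<in>attainable h r s. (a + a') / 2 - \<epsilon> \<le> a''"
proof -
  have "\<exists>H. \<forall>r s. \<bar>r\<bar> \<le> M \<and> \<bar>s\<bar> \<le> M \<longrightarrow> \<bar>h s r\<bar> \<le> H" for M
    using locally_bounded[of M] by blast
  from attainable_midpoint[OF this assms[unfolded attainable_swap[of h r]]]
  show ?thesis unfolding attainable_swap[of h r] .
qed

text \<open>The bound at the origin alone makes the envelope finite everywhere: the origin is the
  midpoint of \<open>(r, 0)\<close> and \<open>(- r, 0)\<close>, and \<open>(r, 0)\<close> is that
  of \<open>(r, s)\<close> and \<open>(r, - s)\<close>. Too large an attainable value at one end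
  would produce a positive one at the origin.\<close>

lemma attainable_le:
  assumes "a \<in> attainable h r s"
  shows "a \<le> - 2 * h (- r) 0 - h r (- s)"
proof -
  have axis: "a \<le> - h (- r) 0" if a: "a \<in> attainable h r 0" for a
  proof (rule field_le_epsilon)
    fix e :: real assume "0 < e"
    then obtain a'' where a'': "a'' \<in> attainable h 0 0" "(a + h (- r) 0) / 2 - e / 2 \<le> a''"
      using attainable_midpoint_fst[of a 0 r 0 "h (- r) 0" "e / 2"] a attainable_self[of h "- r" 0] by auto
    thus "a \<le> - h (- r) 0 + e" using nonpos[OF a''(1)] a''(2) by argo
  qed
  show ?thesis
  proof (rule field_le_epsilon)
    fix e :: real assume "0 < e"
    then obtain a'' where a'': "a'' \<in> attainable h r 0" "(a + h r (- s)) / 2 - e / 2 \<le> a''"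
      using attainable_midpoint_snd[of a r 0 s "h r (- s)" "e / 2"] assms attainable_self[of h r "- s"] by auto
    thus "a \<le> - 2 * h (- r) 0 - h r (- s) + e" using axis[OF a''(1)] a''(2) by argo
  qed
qed

definition envelope :: "real \<Rightarrow> real \<Rightarrow> real" where
  "envelope r s = Sup (attainable h r s)"

lemma bdd_above_attainable: "bdd_above (attainable h r s)"
  by (rule bdd_aboveI) (rule attainable_le)

lemma envelope_upper: "a \<in> attainable h r s \<Longrightarrow> a \<le> envelope r s"
  unfolding envelope_def by (rule cSup_upper[OF _ bdd_above_attainable])

lemma envelope_least: "(\<And>a. a \<in> attainable h r s \<Longrightarrow> a \<le> c) \<Longrightarrow> envelope r s \<le> c"
  unfolding envelope_def using attainable_self[of h r s] by (intro cSup_least) auto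

lemma le_envelope: "h r s \<le> envelope r s"
  by (rule envelope_upper[OF attainable_self])

lemma concave_envelope: "concave_on UNIV (\<lambda>r. envelope r s)" "concave_on UNIV (\<lambda>s. envelope r s)"
proof -
  have lower: "\<exists>L. \<forall>r s. \<bar>r\<bar> \<le> M \<and> \<bar>s\<bar> \<le> M \<longrightarrow> L \<le> h r s" for M
  proof -
    obtain H where "\<forall>r s. \<bar>r\<bar> \<le> M \<and> \<bar>s\<bar> \<le> M \<longrightarrow> \<bar>h r s\<bar> \<le> H" using locally_bounded by blast
    hence "- H \<le> h r s" if "\<bar>r\<bar> \<le> M" "\<bar>s\<bar> \<le> M" for r s
      using that by (meson abs_le_D2 minus_le_iff)
    thus ?thesis by blast
  qed
  show "concave_on UNIV (\<lambda>r. envelope r s)"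
    unfolding envelope_def
  proof (rule concave_on_Sup_midpoint[OF bdd_above_attainable attainable_self _ attainable_midpoint_fst])
    show "\<exists>L. \<forall>r. \<bar>r\<bar> \<le> M \<longrightarrow> L \<le> h r s" for M
      using lower[of "max M \<bar>s\<bar>"] by (meson max.cobounded2 max.coboundedI1)
  qed
  show "concave_on UNIV (\<lambda>s. envelope r s)"
    unfolding envelope_def
  proof (rule concave_on_Sup_midpoint[OF bdd_above_attainable attainable_self _ attainable_midpoint_snd])
    show "\<exists>L. \<forall>s. \<bar>s\<bar> \<le> M \<longrightarrow> L \<le> h r s" for M
      using lower[of "max M \<bar>r\<bar>"] by (meson max.cobounded2 max.coboundedI1)
  qed
qed

text \<open>Each periodic average is continuous in \<open>(r, s)\<close>, so the envelope is lower
  semicontinuous as a supremum of continuous functions, although the family of all \<open>w\<close>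
  is uncountable.\<close>

lemma borel_measurable_envelope: "(\<lambda>z. envelope (fst z) (snd z)) \<in> borel_measurable borel"
proof (rule borel_measurableI_greater)
  fix c
  have "open {z. c < periodic_average h w m (fst z) (snd z)}" for w m
  proof -
    have "continuous_on UNIV (\<lambda>z. h (fst z + a) (snd z + b))" for a b
    proof -
      have "continuous_on UNIV (\<lambda>z. (fst z + a, snd z + b))" by (intro continuous_intros)
      from continuous_on_compose2[OF continuous this subset_UNIV] show ?thesis by simp
    qed
    hence "continuous_on UNIV (\<lambda>z. \<Sum>x<m. \<Sum>y<m. periodic_integrand h w (fst z) (snd z) (int x) (int y))"
      unfolding periodic_integrand_def by (intro continuous_on_sum)
    hence "continuous_on UNIV (\<lambda>z. periodic_average h w m (fst z) (snd z))"
      unfolding periodic_average_def divide_inverse by (rule continuous_on_mult[OF _ continuous_on_const])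
    thus ?thesis by (intro open_Collect_less continuous_on_const)
  qed
  hence "open (\<Union>w. \<Union>m\<in>{m. periodic m w}. {z. c < periodic_average h w m (fst z) (snd z)})"
    by (intro open_UN ballI)
  also have "(\<Union>w. \<Union>m\<in>{m. periodic m w}. {z. c < periodic_average h w m (fst z) (snd z)}) =
      {z. c < envelope (fst z) (snd z)}"
  proof -
    have "c < envelope r s \<longleftrightarrow> (\<exists>a\<in>attainable h r s. c < a)" for r s
      unfolding envelope_def using attainable_self[of h r s] by (intro less_cSup_iff bdd_above_attainable) auto
    hence eq: "z \<in> {z. c < envelope (fst z) (snd z)} \<longleftrightarrow>
        (\<exists>w m. periodic m w \<and> c < periodic_average h w m (fst z) (snd z))" for z
      unfolding attainable_def by blast
    show ?thesis by (rule Set.set_eqI, unfold eq, simp)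
  qed
  finally show "{z \<in> space borel. c < envelope (fst z) (snd z)} \<in> sets borel" by simp
qed

end

text \<open>The envelope serves as \<open>Q\<close> in \<open>choi_bound_of_biconcave\<close>. Its
  upper growth bound comes from \<open>attainable_le\<close>, in which values of \<open>h\<close>
  enter three times, each bounded below by the negative term of \<open>h\<close>; hence the constant
  \<open>3 * K powr p\<close>.\<close>

lemma choi_bound_of_attainable:
  assumes p: "1 < p" and K: "0 \<le> K"
    and nonpos: "\<And>a. a \<in> attainable (\<lambda>r s. \<bar>b * r + B * s\<bar> powr p - K powr p * \<bar>r + s\<bar> powr p) 0 0 \<Longrightarrow> a \<le> 0"
  shows "choi_bound TYPE('a) b B p K"
proof -
  define h where "h r s = \<bar>b * r + B * s\<bar> powr p - K powr p * \<bar>r + s\<bar> powr p" for r s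
  have nonpos': "a \<le> 0" if "a \<in> attainable h 0 0" for a
    using nonpos that unfolding h_def[abs_def] .
  have cont: "continuous_on UNIV (\<lambda>z. h (fst z) (snd z))"
  proof -
    have "continuous_on UNIV (\<lambda>x :: real. \<bar>x\<bar> powr p)"
      using p by (intro continuous_on_powr' continuous_on_rabs continuous_on_id continuous_on_const) auto
    note powr = continuous_on_compose2[OF this _ subset_UNIV]
    have lin: "continuous_on UNIV (\<lambda>z :: real \<times> real. x * fst z + y * snd z)" for x y
      by (intro continuous_intros)
    show ?thesis
      unfolding h_def using lin[of 1 1]
      by (intro continuous_on_diff continuous_on_mult continuous_on_const powr[OF lin] powr) simp
  qed
  have least: "envelope h r s \<le> c" if "\<And>a. a \<in> attainable h r s \<Longrightarrow> a \<le> c" for r s c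
  proof (rule envelope_least)
    show "continuous_on UNIV (\<lambda>z. h (fst z) (snd z))" by (rule cont)
    show "a \<le> 0" if "a \<in> attainable h 0 0" for a by (rule nonpos'[OF that])
    show "a \<le> c" if "a \<in> attainable h r s" for a by (rule \<open>\<And>a. a \<in> attainable h r s \<Longrightarrow> a \<le> c\<close>[OF that])
  qed
  note env = le_envelope[of h, OF cont nonpos'] attainable_le[of h, OF cont nonpos']
  show ?thesis
  proof (rule choi_bound_of_biconcave[OF p K, of "envelope h" "3 * K powr p"])
    fix r s :: real
    let ?\<rho> = "1 + \<bar>r\<bar> + \<bar>s\<bar>"
    have le: "K powr p * \<bar>x\<bar> powr p \<le> K powr p * ?\<rho> powr p" if "\<bar>x\<bar> \<le> ?\<rho>" for x
      using that p by (intro mult_left_mono powr_mono2) auto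
    have Y: "0 \<le> K powr p * ?\<rho> powr p" by simp
    have h: "- (K powr p * \<bar>r + s\<bar> powr p) \<le> h r s" for r s by (simp add: h_def)
    have "envelope h r s \<le> - 2 * h (- r) 0 - h r (- s)"
      by (rule least) (rule env(2))
    also have "\<dots> \<le> 3 * K powr p * ?\<rho> powr p"
      using h[of "- r" 0] h[of r "- s"] le[of "- r"] le[of "r + - s"] abs_triangle_ineq4[of r s] by simp
    finally have "envelope h r s \<le> 3 * K powr p * ?\<rho> powr p" .
    moreover have "- (3 * K powr p * ?\<rho> powr p) \<le> envelope h r s"
      using h[of r s] le[of "r + s"] env(1)[of r s] abs_triangle_ineq[of r s] Y by linarith
    ultimately show "\<bar>envelope h r s\<bar> \<le> 3 * K powr p * ?\<rho> powr p" by (simp add: abs_le_iff)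
    show "\<bar>b * r + B * s\<bar> powr p - K powr p * \<bar>r + s\<bar> powr p \<le> envelope h r s"
      using env(1)[of r s] by (simp add: h_def)
    show "envelope h 0 0 \<le> 0" by (rule least) (rule nonpos')
    show "concave_on UNIV (\<lambda>r. envelope h r s)" by (rule concave_envelope(1)[OF cont nonpos'])
    show "concave_on UNIV (\<lambda>s. envelope h r s)" by (rule concave_envelope(2)[OF cont nonpos'])
    show "(\<lambda>z. envelope h (fst z) (snd z)) \<in> borel_measurable borel"
      by (rule borel_measurable_envelope[OF cont nonpos'])
  qed
qed

section \<open>Transfer to finitely supported functions on the lattice\<close>

lemma sum_periodic_shift:
  fixes f :: "int \<Rightarrow> real"
  assumes "\<And>x. f (x + int m) = f x"
  shows "(\<Sum>x<m. f (int x + z)) = (\<Sum>x<m. f (int x))"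
proof -
  have step: "(\<Sum>x<m. f (int x + (z + 1))) = (\<Sum>x<m. f (int x + z))" for z
  proof -
    have "(\<Sum>x<m. f (int (Suc x) + z) - f (int x + z)) = f (int m + z) - f (int 0 + z)"
      by (rule sum_lessThan_telescope)
    also have "f (int m + z) = f z" using assms[of z] by (simp add: add.commute)
    finally have "(\<Sum>x<m. f (int (Suc x) + z)) = (\<Sum>x<m. f (int x + z))"
      by (simp add: sum_subtractf)
    thus ?thesis by (simp add: ac_simps)
  qed
  show ?thesis
  proof (induction z rule: int_induct[of _ 0])
    case (step1 i)
    thus ?case using step[of i] by simp
  next
    case (step2 i)
    thus ?case using step[of "i - 1"] by simp
  qed simp
qed

lemma card_vec_box:
  fixes A :: "'a set"
  assumes "finite A"
  shows "finite {n :: 'a ^ 'n::finite. \<forall>l. n $ l \<in> A}" "card {n :: 'a ^ 'n. \<forall>l. n $ l \<in> A} = card A ^ CARD('n)"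
proof -
  have eq: "{n :: 'a ^ 'n. \<forall>l. n $ l \<in> A} = vec_lambda ` (Pi\<^sub>E UNIV (\<lambda>_. A))"
  proof (intro Set.set_eqI iffI)
    fix n :: "'a ^ 'n" assume "n \<in> {n. \<forall>l. n $ l \<in> A}"
    thus "n \<in> vec_lambda ` (Pi\<^sub>E UNIV (\<lambda>_. A))" by (intro image_eqI[of _ _ "($) n"]) auto
  qed auto
  show "finite {n :: 'a ^ 'n. \<forall>l. n $ l \<in> A}" unfolding eq using assms by (intro finite_imageI finite_PiE) auto
  have "inj_on vec_lambda (Pi\<^sub>E (UNIV :: 'n set) (\<lambda>_. A))" by (auto intro!: inj_onI)
  thus "card {n :: 'a ^ 'n. \<forall>l. n $ l \<in> A} = card A ^ CARD('n)"
    unfolding eq by (subst card_image) (auto simp: card_PiE)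
qed

text \<open>A periodic function on \<open>\<int>\<^sup>2\<close> is read off the coordinates \<open>i, j\<close> and cut off sharply outside a large
  box.  Averaging over all translates replaces the sum over the interior of the box by the
  mean over a period.\<close>

lemma attainable_nonpos_of_lattice:
  fixes \<alpha> :: "real ^ 'n::finite"
  assumes ij: "i \<noteq> j" and p: "0 \<le> p"
    and op: "\<And>(u :: int ^ 'n \<Rightarrow> real) S. finite S \<Longrightarrow> {n. u n \<noteq> 0} \<subseteq> S \<Longrightarrow>
        (\<And>n l. n \<notin> S \<Longrightarrow> deriv_plus l (deriv_minus l u) n = 0) \<Longrightarrow>
        (\<Sum>n\<in>S. \<bar>\<Sum>l\<in>UNIV. \<alpha> $ l * deriv_plus l (deriv_minus l u) n\<bar> powr p) \<le>
        K powr p * (\<Sum>n\<in>S. \<bar>laplacian u n\<bar> powr p)"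
    and a: "a \<in> attainable (\<lambda>r s. \<bar>\<alpha> $ i * r + \<alpha> $ j * s\<bar> powr p - K powr p * \<bar>r + s\<bar> powr p) 0 0"
  shows "a \<le> 0"
proof -
  define h where "h r s = \<bar>\<alpha> $ i * r + \<alpha> $ j * s\<bar> powr p - K powr p * \<bar>r + s\<bar> powr p" for r s
  obtain w m where w: "periodic m w" "a = periodic_average h w m 0 0"
    using a unfolding attainable_def h_def by auto
  have m: "0 < m" using w by (simp add: periodic_def)
  obtain c where c: "\<And>x y. \<bar>w x y\<bar> \<le> c" using periodic_bounded[OF w(1)] by blast
  have c0: "0 \<le> c" using c[of 0 0] by linarith
  define \<phi> where "\<phi> = periodic_integrand h w 0 0"
  have per: "\<phi> (x + int m) y = \<phi> x y" "\<phi> x (y + int m) = \<phi> x y" for x y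
    using periodic_integrand[OF w(1), of h 0 0] by (auto simp: periodic_def \<phi>_def)
  have mean: "(\<Sum>x<m. \<Sum>y<m. \<phi> (int x + z) (int y + z')) = (real m)\<^sup>2 * a" for z z'
  proof -
    have "(\<Sum>x<m. \<Sum>y<m. \<phi> (int x + z) (int y + z')) = (\<Sum>x<m. \<Sum>y<m. \<phi> (int x + z) (int y))"
      by (intro sum.cong refl sum_periodic_shift per)
    also have "\<dots> = (\<Sum>x<m. \<Sum>y<m. \<phi> (int x) (int y))"
      by (intro sum_periodic_shift[of "\<lambda>x. \<Sum>y<m. \<phi> x (int y)"] sum.cong refl per)
    finally show ?thesis using m by (simp add: w(2) periodic_average_def \<phi>_def)
  qed
  \<comment> \<open>Largest possible negative part of the integrand at one site: a second difference
    of a function bounded by \<open>c\<close> is at most \<open>4 * c\<close>, and the Laplacian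
    adds \<open>CARD('n)\<close> of them.\<close>
  define E where "E = K powr p * (real CARD('n) * (4 * c)) powr p"
  have E: "0 \<le> E" by (simp add: E_def)
  have main: "a * (real k + 1) ^ CARD('n) \<le> E * ((real k + 5) ^ CARD('n) - (real k + 1) ^ CARD('n))" for k :: nat
  proof -
    \<comment> \<open>In the inner box \<open>I\<close> the second differences do not see the cut,
      and outside the outer box \<open>S\<close> they all vanish. The sides of these boxes have
      \<open>k + 1\<close> and \<open>k + 5\<close> sites, so the layer between them is of lower
      order.\<close>
    define R where "R = int k + 2"
    define box S I where "box = {n :: int ^ 'n. \<forall>l. n $ l \<in> {0..R}}"
      and "S = {n :: int ^ 'n. \<forall>l. n $ l \<in> {- 1..R + 1}}" and "I = {n :: int ^ 'n. \<forall>l. n $ l \<in> {1..R - 1}}"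
    have fin: "finite S" "finite I"
      unfolding S_def I_def by (rule card_vec_box(1), simp)+
    have card: "card S = (k + 5) ^ CARD('n)" "card I = (k + 1) ^ CARD('n)"
      unfolding S_def I_def card_vec_box(2)[OF finite_atLeastAtMost_int]
      by (simp_all add: R_def nat_add_distrib add.commute)
    have IS: "I \<subseteq> S"
    proof
      fix n assume "n \<in> I"
      hence "1 \<le> n $ l \<and> n $ l \<le> R - 1" for l by (simp add: I_def)
      hence "- 1 \<le> n $ l \<and> n $ l \<le> R + 1" for l by (smt (verit))
      thus "n \<in> S" by (simp add: S_def)
    qed
    have ax: "axis l (1 :: int) $ q = (if q = l then 1 else 0)" for l q :: 'n by (simp add: axis_def)
    have inI: "n \<in> box" "n + axis l 1 \<in> box" "n - axis l 1 \<in> box" if "n \<in> I" for n l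
    proof -
      have b: "1 \<le> n $ q" "n $ q \<le> R - 1" for q using that by (simp_all add: I_def)
      have "0 \<le> n $ q \<and> n $ q \<le> R" for q using b[of q] by linarith
      moreover have "0 \<le> (n + axis l 1) $ q \<and> (n + axis l 1) $ q \<le> R" for q using b[of q] by (cases "q = l") (simp_all add: ax)
      moreover have "0 \<le> (n - axis l 1) $ q \<and> (n - axis l 1) $ q \<le> R" for q using b[of q] by (cases "q = l") (simp_all add: ax)
      ultimately show "n \<in> box" "n + axis l 1 \<in> box" "n - axis l 1 \<in> box"
        unfolding box_def mem_Collect_eq atLeastAtMost_iff by blast+
    qed
    have outS: "n \<notin> box" "n + axis l 1 \<notin> box" "n - axis l 1 \<notin> box" if "n \<notin> S" for n l
    proof -
      have "\<exists>q. n $ q < - 1 \<or> R + 1 < n $ q" using that by (simp add: S_def de_Morgan_conj not_le)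
      then obtain q where q: "n $ q < - 1 \<or> R + 1 < n $ q" by blast
      have "\<not> (0 \<le> n $ q \<and> n $ q \<le> R)" "\<not> (0 \<le> (n + axis l 1) $ q \<and> (n + axis l 1) $ q \<le> R)"
        "\<not> (0 \<le> (n - axis l 1) $ q \<and> (n - axis l 1) $ q \<le> R)"
        using q by (cases "q = l"; simp add: ax; linarith)+
      thus "n \<notin> box" "n + axis l 1 \<notin> box" "n - axis l 1 \<notin> box"
        unfolding box_def mem_Collect_eq atLeastAtMost_iff by blast+
    qed
    have shift: "(\<Sum>n\<in>I. \<phi> (n $ i + int x) (n $ j + int y)) \<le> E * (real (card S) - real (card I))" for x y
    proof -
      define u where "u n = (if n \<in> box then w (n $ i + int x) (n $ j + int y) else 0)" for n
      let ?D = "\<lambda>l n. deriv_plus l (deriv_minus l u) n"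
      have u: "\<bar>u n\<bar> \<le> c" for n using c c0 by (simp add: u_def)
      have D: "\<bar>?D l n\<bar> \<le> 4 * c" for l n
        using u[of "n + axis l 1"] u[of "n - axis l 1"] u[of n] unfolding deriv_plus_deriv_minus by linarith
      let ?v = "\<lambda>n. \<bar>\<Sum>l\<in>UNIV. \<alpha> $ l * ?D l n\<bar> powr p - K powr p * \<bar>laplacian u n\<bar> powr p"
      have "(\<Sum>n\<in>S. \<bar>\<Sum>l\<in>UNIV. \<alpha> $ l * ?D l n\<bar> powr p) \<le> K powr p * (\<Sum>n\<in>S. \<bar>laplacian u n\<bar> powr p)"
      proof (rule op[OF fin(1)])
        show "{n. u n \<noteq> 0} \<subseteq> S" using outS(1) by (auto simp: u_def)
        show "?D l n = 0" if "n \<notin> S" for n l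
          unfolding deriv_plus_deriv_minus using outS(1)[OF that] outS(2,3)[OF that, of l] by (simp add: u_def)
      qed
      hence v: "(\<Sum>n\<in>S. ?v n) \<le> 0" by (simp add: sum_subtractf sum_distrib_left)
      have vI: "?v n = \<phi> (n $ i + int x) (n $ j + int y)" if "n \<in> I" for n
      proof -
        let ?d1 = "diff2_fst w (n $ i + int x) (n $ j + int y)" and ?d2 = "diff2_snd w (n $ i + int x) (n $ j + int y)"
        have Dn: "?D l n = (if l = i then ?d1 else if l = j then ?d2 else 0)" for l
        proof -
          have "u (n + axis l 1) = w (n $ i + int x + (if l = i then 1 else 0)) (n $ j + int y + (if l = j then 1 else 0))"
            "u (n - axis l 1) = w (n $ i + int x - (if l = i then 1 else 0)) (n $ j + int y - (if l = j then 1 else 0))"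
            "u n = w (n $ i + int x) (n $ j + int y)"
            unfolding u_def using inI(1)[OF that] inI(2,3)[OF that, of l] by (auto simp: ax algebra_simps)
          thus ?thesis using ij by (simp add: deriv_plus_deriv_minus diff2_fst_def diff2_snd_def)
        qed
        have s: "(\<Sum>l\<in>UNIV. \<beta> l * ?D l n) = \<beta> i * ?d1 + \<beta> j * ?d2" for \<beta>
        proof -
          have "(\<Sum>l\<in>UNIV. \<beta> l * ?D l n) = (\<Sum>l\<in>{i, j}. \<beta> l * ?D l n)"
            by (intro sum.mono_neutral_right) (auto simp: Dn)
          thus ?thesis using ij by (simp add: Dn)
        qed
        show ?thesis
          using s[of "\<lambda>l. \<alpha> $ l"] s[of "\<lambda>_. 1"] unfolding laplacian_def
          by (simp add: \<phi>_def periodic_integrand_def h_def)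
      qed
      have vS: "- E \<le> ?v n" for n
      proof -
        have "\<bar>laplacian u n\<bar> \<le> (\<Sum>l\<in>UNIV. \<bar>?D l n\<bar>)" unfolding laplacian_def by (rule sum_abs)
        also have "\<dots> \<le> (\<Sum>l\<in>(UNIV :: 'n set). 4 * c)" by (intro sum_mono D)
        finally have "\<bar>laplacian u n\<bar> powr p \<le> (real CARD('n) * (4 * c)) powr p" using p by (intro powr_mono2) auto
        hence "K powr p * \<bar>laplacian u n\<bar> powr p \<le> E" unfolding E_def by (intro mult_left_mono) auto
        moreover have "0 \<le> \<bar>\<Sum>l\<in>UNIV. \<alpha> $ l * ?D l n\<bar> powr p" by simp
        ultimately show ?thesis by linarith
      qed
      have "(\<Sum>n\<in>S - I. - E) \<le> (\<Sum>n\<in>S - I. ?v n)" by (intro sum_mono vS)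
      moreover have "(\<Sum>n\<in>S - I. - E) = - E * (real (card S) - real (card I))"
        using fin IS by (simp add: card_Diff_subset of_nat_diff card_mono)
      moreover have "(\<Sum>n\<in>S. ?v n) = (\<Sum>n\<in>S - I. ?v n) + (\<Sum>n\<in>I. ?v n)"
        by (rule sum.subset_diff[OF IS fin(1)])
      moreover have "(\<Sum>n\<in>I. ?v n) = (\<Sum>n\<in>I. \<phi> (n $ i + int x) (n $ j + int y))"
        by (intro sum.cong refl vI)
      ultimately show ?thesis using v by linarith
    qed
    have "real (card I) * ((real m)\<^sup>2 * a) = (\<Sum>n\<in>I. \<Sum>x<m. \<Sum>y<m. \<phi> (int x + n $ i) (int y + n $ j))"
      by (simp add: mean)
    also have "\<dots> = (\<Sum>x<m. \<Sum>y<m. \<Sum>n\<in>I. \<phi> (int x + n $ i) (int y + n $ j))"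
      by (subst sum.swap, intro sum.cong refl, rule sum.swap)
    also have "\<dots> \<le> (\<Sum>x<m. \<Sum>y<m. E * (real (card S) - real (card I)))"
      using shift by (intro sum_mono) (simp add: add.commute)
    also have "\<dots> = (real m)\<^sup>2 * (E * (real (card S) - real (card I)))" by (simp add: power2_eq_square)
    finally have "(real m)\<^sup>2 * (a * real (card I)) \<le> (real m)\<^sup>2 * (E * (real (card S) - real (card I)))"
      by (simp only: mult_ac)
    hence "a * real (card I) \<le> E * (real (card S) - real (card I))"
      using m by (subst (asm) mult_le_cancel_left_pos) auto
    thus ?thesis by (simp add: card algebra_simps)
  qed
  have "a \<le> E * (((real k + 5) / (real k + 1)) ^ CARD('n) - 1)" for k
  proof -
    have pos: "(real k + 1) ^ CARD('n) > 0" by simp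
    have "a \<le> E * ((real k + 5) ^ CARD('n) - (real k + 1) ^ CARD('n)) / (real k + 1) ^ CARD('n)"
      using main[of k] pos by (simp add: pos_le_divide_eq)
    also have "\<dots> = E * (((real k + 5) / (real k + 1)) ^ CARD('n) - 1)"
      using pos by (simp add: power_divide diff_divide_distrib right_diff_distrib)
    finally show ?thesis .
  qed
  moreover have "(\<lambda>k. E * (((real k + 5) / (real k + 1)) ^ CARD('n) - 1)) \<longlonglongrightarrow> E * (1 ^ CARD('n) - 1)"
  proof (intro tendsto_intros)
    show "(\<lambda>k. (real k + 5) / (real k + 1)) \<longlonglongrightarrow> 1" by real_asymp
  qed
  ultimately have "a \<le> E * (1 ^ CARD('n) - 1)" by (intro LIMSEQ_le_const) auto
  thus ?thesis by simp
qed

section \<open>The spaces of p-summable functions\<close>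

lemma Lp_norm_nonneg [simp]: "0 \<le> Lp_norm p M f"
  by (simp add: Lp_norm_def)

lemma Lp_norm_powr: "0 < p \<Longrightarrow> Lp_norm p M f powr p = (\<integral>x. \<bar>f x\<bar> powr p \<partial>M)"
  unfolding Lp_norm_def by (subst powr_powr) (auto intro!: integral_nonneg)

lemma Lp_norm_cmult: "Lp_norm p M (\<lambda>x. a * f x) = \<bar>a\<bar> * Lp_norm p M f" if "0 < p"
proof -
  have "(\<integral>x. \<bar>a * f x\<bar> powr p \<partial>M) = \<bar>a\<bar> powr p * (\<integral>x. \<bar>f x\<bar> powr p \<partial>M)"
    by (simp add: abs_mult powr_mult)
  thus ?thesis using that unfolding Lp_norm_def by (simp add: powr_mult powr_powr)
qed

lemma Lp_cmult: "f \<in> Lp p M \<Longrightarrow> (\<lambda>x. a * f x) \<in> Lp p M"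
  by (auto simp: Lp_def abs_mult powr_mult)

lemma Lp_diff: "0 \<le> p \<Longrightarrow> f \<in> Lp p M \<Longrightarrow> g \<in> Lp p M \<Longrightarrow> (\<lambda>x. f x - g x) \<in> Lp p M"
  using Lp_add[of p f M "\<lambda>x. (- 1) * g x"] Lp_cmult[of g p M "- 1"] by simp

lemma Lp_norm_minus_commute: "Lp_norm p M (\<lambda>x. f x - g x) = Lp_norm p M (\<lambda>x. g x - f x)"
  by (simp add: Lp_norm_def abs_minus_commute)

lemma Lp_norm_leI:
  assumes "0 < p" "0 \<le> c" "(\<integral>x. \<bar>f x\<bar> powr p \<partial>M) \<le> c powr p"
  shows "Lp_norm p M f \<le> c"
proof -
  have "Lp_norm p M f powr p \<le> c powr p" using assms by (simp add: Lp_norm_powr)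
  thus ?thesis using powr_le_cancel_iff_base[of p "Lp_norm p M f" c] assms by simp
qed

text \<open>Convexity of the \<open>p\<close>-th power with the weights \<open>a / (a + c)\<close>
  and \<open>c / (a + c)\<close>, where \<open>a\<close> and \<open>c\<close> are positive upper
  bounds of the two norms; letting them decrease to the norms covers norms equal to zero.\<close>

lemma Minkowski:
  assumes p: "1 < p" and f: "f \<in> Lp p M" and g: "g \<in> Lp p M"
  shows "Lp_norm p M (\<lambda>x. f x + g x) \<le> Lp_norm p M f + Lp_norm p M g"
proof -
  have aux: "Lp_norm p M (\<lambda>x. f x + g x) \<le> a + c" if a: "Lp_norm p M f \<le> a" "0 < a" and c: "Lp_norm p M g \<le> c" "0 < c" for a c
  proof (rule Lp_norm_leI)
    have int: "integrable M (\<lambda>x. \<bar>f x\<bar> powr p)" "integrable M (\<lambda>x. \<bar>g x\<bar> powr p)" using f g by (auto simp: Lp_def)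
    have fa: "(\<integral>x. \<bar>f x\<bar> powr p \<partial>M) \<le> a powr p" and gc: "(\<integral>x. \<bar>g x\<bar> powr p \<partial>M) \<le> c powr p"
      using a c p by (simp_all add: Lp_norm_powr[symmetric] powr_mono2)
    let ?u = "a / (a + c)" and ?v = "c / (a + c)"
    have uv: "0 \<le> ?u" "0 \<le> ?v" "?u + ?v = 1" using a c by (auto simp: add_divide_distrib[symmetric])
    have pt: "\<bar>f x + g x\<bar> powr p \<le> (a + c) powr p * (?u * (\<bar>f x\<bar> powr p / a powr p) + ?v * (\<bar>g x\<bar> powr p / c powr p))" for x
    proof -
      have "?u * (f x / a) = f x / (a + c)" "?v * (g x / c) = g x / (a + c)" using a c by auto
      hence "f x + g x = (a + c) * (?u * (f x / a) + ?v * (g x / c))"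
        using a c by (simp only: add_divide_distrib[symmetric]) simp
      hence "\<bar>f x + g x\<bar> powr p = (a + c) powr p * \<bar>?u * (f x / a) + ?v * (g x / c)\<bar> powr p"
        using a c by (simp add: abs_mult powr_mult)
      also have "\<dots> \<le> (a + c) powr p * (?u * \<bar>f x / a\<bar> powr p + ?v * \<bar>g x / c\<bar> powr p)"
        by (intro mult_left_mono abs_powr_convex[OF p uv]) auto
      finally show ?thesis using a c by (simp add: powr_divide)
    qed
    have "(\<integral>x. \<bar>f x + g x\<bar> powr p \<partial>M) \<le> (\<integral>x. (a + c) powr p * (?u * (\<bar>f x\<bar> powr p / a powr p) + ?v * (\<bar>g x\<bar> powr p / c powr p)) \<partial>M)"
      using Lp_add[OF _ f g] p int pt by (intro integral_mono) (auto simp: Lp_def)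
    also have "\<dots> = (a + c) powr p * (?u * ((\<integral>x. \<bar>f x\<bar> powr p \<partial>M) / a powr p) + ?v * ((\<integral>x. \<bar>g x\<bar> powr p \<partial>M) / c powr p))"
      using int by simp
    also have "\<dots> \<le> (a + c) powr p * (?u * 1 + ?v * 1)"
      using fa gc a c by (intro mult_left_mono add_mono) (auto simp: divide_le_eq_1)
    finally show "(\<integral>x. \<bar>f x + g x\<bar> powr p \<partial>M) \<le> (a + c) powr p" using uv by simp
  qed (use p a c in auto)
  show ?thesis
  proof (rule field_le_epsilon)
    fix e :: real assume e: "0 < e"
    have "Lp_norm p M (\<lambda>x. f x + g x) \<le> (Lp_norm p M f + e / 2) + (Lp_norm p M g + e / 2)"
      using e by (intro aux) (auto intro: add_nonneg_pos)
    thus "Lp_norm p M (\<lambda>x. f x + g x) \<le> Lp_norm p M f + Lp_norm p M g + e" by simp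
  qed
qed

lemma Lp_norm_triangle:
  assumes "1 < p" "f \<in> Lp p M" "g \<in> Lp p M" "h \<in> Lp p M"
  shows "Lp_norm p M (\<lambda>x. f x - h x) \<le> Lp_norm p M (\<lambda>x. f x - g x) + Lp_norm p M (\<lambda>x. g x - h x)"
  using Minkowski[OF assms(1) Lp_diff[OF _ assms(2,3)] Lp_diff[OF _ assms(3,4)]] assms(1) by simp

text \<open>Takes the place of Fatou's lemma for pointwise limits: finite partial sums, which pass
  to the limit, control both summability and the integral.\<close>

lemma lp_of_finite_sums:
  assumes "\<And>B. finite B \<Longrightarrow> (\<Sum>x\<in>B. \<bar>g x\<bar> powr p) \<le> c"
  shows "g \<in> lp p" "(\<integral>x. \<bar>g x\<bar> powr p \<partial>count_space UNIV) \<le> c"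
proof -
  let ?f = "\<lambda>x. \<bar>g x\<bar> powr p"
  have s: "?f summable_on UNIV"
    using assms by (intro nonneg_bdd_above_summable_on bdd_aboveI2[of _ _ c]) auto
  hence a: "Infinite_Set_Sum.abs_summable_on ?f UNIV"
    using abs_summable_equivalent[of ?f UNIV] by simp
  hence "integrable (count_space UNIV) ?f" by (simp add: Infinite_Set_Sum.abs_summable_on_def)
  thus "g \<in> lp p" by (simp add: Lp_def)
  have "(\<integral>x. ?f x \<partial>count_space UNIV) = infsum ?f UNIV"
    using infsetsum_infsum[OF a] by (simp add: infsetsum_def)
  also have "\<dots> \<le> c" by (rule infsum_le_finite_sums[OF s]) (use assms in auto)
  finally show "(\<integral>x. ?f x \<partial>count_space UNIV) \<le> c" .
qed

lemma lp_finite_support: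
  assumes "finite S" "\<And>x. x \<notin> S \<Longrightarrow> f x = 0"
  shows "(f :: 'a \<Rightarrow> real) \<in> lp p" "(\<integral>x. \<bar>f x\<bar> powr p \<partial>count_space UNIV) = (\<Sum>x\<in>S. \<bar>f x\<bar> powr p)"
proof -
  have fin: "finite {x. \<bar>f x\<bar> powr p \<noteq> 0}" by (rule finite_subset[OF _ assms(1)]) (use assms(2) in force)
  show "f \<in> lp p"
  proof (rule lp_of_finite_sums(1))
    fix B :: "'a set" assume "finite B"
    have "(\<Sum>x\<in>B. \<bar>f x\<bar> powr p) = (\<Sum>x\<in>B \<inter> S. \<bar>f x\<bar> powr p)"
      using assms(2) \<open>finite B\<close> by (intro sum.mono_neutral_right) auto
    also have "\<dots> \<le> (\<Sum>x\<in>S. \<bar>f x\<bar> powr p)" using assms(1) by (intro sum_mono2) auto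
    finally show "(\<Sum>x\<in>B. \<bar>f x\<bar> powr p) \<le> (\<Sum>x\<in>S. \<bar>f x\<bar> powr p)" .
  qed
  have "(\<integral>x. \<bar>f x\<bar> powr p \<partial>count_space UNIV) = (\<Sum>x | x \<in> UNIV \<and> \<bar>f x\<bar> powr p \<noteq> 0. \<bar>f x\<bar> powr p)"
    using fin by (subst lebesgue_integral_count_space_finite_support) auto
  also have "\<dots> = (\<Sum>x\<in>S. \<bar>f x\<bar> powr p)"
    using assms by (intro sum.mono_neutral_left) force+
  finally show "(\<integral>x. \<bar>f x\<bar> powr p \<partial>count_space UNIV) = (\<Sum>x\<in>S. \<bar>f x\<bar> powr p)" .
qed

lemma finsupp_lp: "finsupp f \<Longrightarrow> f \<in> lp p"
  by (rule lp_finite_support(1)[of "{x. f x \<noteq> 0}"]) (auto simp: finsupp_def)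

lemma lp_finite_sum_le:
  assumes "g \<in> lp p" "finite B"
  shows "(\<Sum>x\<in>B. \<bar>g x\<bar> powr p) \<le> (\<integral>x. \<bar>g x\<bar> powr p \<partial>count_space UNIV)"
proof -
  let ?h = "\<lambda>x. if x \<in> B then g x else 0"
  have "(\<Sum>x\<in>B. \<bar>g x\<bar> powr p) = (\<Sum>x\<in>B. \<bar>?h x\<bar> powr p)" by (intro sum.cong) auto
  also have "\<dots> = (\<integral>x. \<bar>?h x\<bar> powr p \<partial>count_space UNIV)"
    using assms(2) by (subst lp_finite_support(2)[of B]) auto
  also have "\<dots> \<le> (\<integral>x. \<bar>g x\<bar> powr p \<partial>count_space UNIV)"
    using assms lp_finite_support(1)[of B ?h p] by (intro integral_mono) (auto simp: Lp_def)
  finally show ?thesis .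
qed

lemma abs_le_lp_norm:
  assumes "0 < p" "g \<in> lp p"
  shows "\<bar>g x\<bar> \<le> lp_norm p g"
proof -
  have "\<bar>g x\<bar> powr p \<le> lp_norm p g powr p"
    using lp_finite_sum_le[OF assms(2), of "{x}"] assms(1) by (simp add: Lp_norm_powr)
  thus ?thesis using powr_le_cancel_iff_base[of p "\<bar>g x\<bar>" "lp_norm p g"] assms by simp
qed

lemma lp_norm_eq_0D: "0 < p \<Longrightarrow> g \<in> lp p \<Longrightarrow> lp_norm p g \<le> 0 \<Longrightarrow> g x = 0"
  using abs_le_lp_norm[of p g x] by simp

lemma finsupp_linear:
  assumes "finsupp f" "finsupp g"
  shows "finsupp (\<lambda>x. a * f x + c * g x)"
proof -
  have "{x. a * f x + c * g x \<noteq> 0} \<subseteq> {x. f x \<noteq> 0} \<union> {x. g x \<noteq> 0}" by auto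
  thus ?thesis using assms unfolding finsupp_def by (meson finite_UnI finite_subset)
qed

lemma finsupp_dense:
  assumes p: "1 < p" and f: "f \<in> lp p"
  shows "\<exists>h :: nat \<Rightarrow> 'a \<Rightarrow> real. (\<forall>k. finsupp (h k)) \<and> (\<lambda>k. lp_norm p (\<lambda>x. h k x - f x)) \<longlonglongrightarrow> 0"
proof -
  let ?I = "\<integral>x. \<bar>f x\<bar> powr p \<partial>count_space UNIV"
  have "\<exists>B. finite B \<and> ?I - (1 / real (Suc k)) powr p < (\<Sum>x\<in>B. \<bar>f x\<bar> powr p)" for k
  proof (rule ccontr)
    assume "\<not> ?thesis"
    hence "?I \<le> ?I - (1 / real (Suc k)) powr p" by (intro lp_of_finite_sums(2)) force
    moreover have "0 < (1 / real (Suc k)) powr p" by simp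
    ultimately show False by linarith
  qed
  then obtain B where B: "\<And>k. finite (B k)" "\<And>k. ?I - (1 / real (Suc k)) powr p < (\<Sum>x\<in>B k. \<bar>f x\<bar> powr p)"
    by metis
  define h where "h k x = (if x \<in> B k then f x else 0)" for k x
  have fin: "finsupp (h k)" for k
    unfolding finsupp_def by (rule finite_subset[OF _ B(1)[of k]]) (auto simp: h_def)
  have le: "lp_norm p (\<lambda>x. h k x - f x) \<le> 1 / real (Suc k)" for k
  proof (rule Lp_norm_leI)
    have hl: "h k \<in> lp p" by (rule finsupp_lp[OF fin])
    have "(\<integral>x. \<bar>h k x - f x\<bar> powr p \<partial>count_space UNIV) = (\<integral>x. \<bar>f x\<bar> powr p - \<bar>h k x\<bar> powr p \<partial>count_space UNIV)"
      by (intro Bochner_Integration.integral_cong refl) (use p in \<open>auto simp: h_def\<close>)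
    also have "\<dots> = ?I - (\<integral>x. \<bar>h k x\<bar> powr p \<partial>count_space UNIV)"
      using f hl by (intro Bochner_Integration.integral_diff) (auto simp: Lp_def)
    also have "(\<integral>x. \<bar>h k x\<bar> powr p \<partial>count_space UNIV) = (\<Sum>x\<in>B k. \<bar>f x\<bar> powr p)"
      using B(1) by (subst lp_finite_support(2)[of "B k"]) (auto simp: h_def)
    finally show "(\<integral>x. \<bar>h k x - f x\<bar> powr p \<partial>count_space UNIV) \<le> (1 / real (Suc k)) powr p" using B(2)[of k] by simp
  qed (use p in auto)
  have "(\<lambda>k. lp_norm p (\<lambda>x. h k x - f x)) \<longlonglongrightarrow> 0"
    by (rule tendsto_sandwich[OF _ _ tendsto_const LIMSEQ_inverse_real_of_nat]) (use le in \<open>auto simp: inverse_eq_divide\<close>)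
  thus ?thesis using fin by blast
qed

section \<open>Extension of bounded operators from the finitely supported functions\<close>

context
  fixes p C :: real and T :: "('a \<Rightarrow> real) \<Rightarrow> 'a \<Rightarrow> real"
  assumes p: "1 < p" and C: "0 \<le> C"
    and linear: "\<And>f g a c. finsupp f \<Longrightarrow> finsupp g \<Longrightarrow> T (\<lambda>x. a * f x + c * g x) = (\<lambda>x. a * T f x + c * T g x)"
    and T_lp: "\<And>f. finsupp f \<Longrightarrow> T f \<in> lp p"
    and T_le: "\<And>f. finsupp f \<Longrightarrow> lp_norm p (T f) \<le> C * lp_norm p f"
begin

lemma extension_diff_le:
  assumes "finsupp f" "finsupp g"
  shows "lp_norm p (\<lambda>x. T f x - T g x) \<le> C * lp_norm p (\<lambda>x. f x - g x)"
  using linear[OF assms, of 1 "- 1"] T_le[OF finsupp_linear[OF assms, of 1 "- 1"]] by simp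

text \<open>The predicate under the description operator of \<open>lp_extension\<close>, which is
  thus evaluated by existence and uniqueness of such a \<open>g\<close>.\<close>

definition limit_of :: "('a \<Rightarrow> real) \<Rightarrow> ('a \<Rightarrow> real) \<Rightarrow> bool" where
  "limit_of f g \<longleftrightarrow> g \<in> lp p \<and>
     (\<forall>h. (\<forall>k::nat. finsupp (h k)) \<and> (\<lambda>k. lp_norm p (\<lambda>x. h k x - f x)) \<longlonglongrightarrow> 0 \<longrightarrow>
          (\<lambda>k. lp_norm p (\<lambda>x. T (h k) x - g x)) \<longlonglongrightarrow> 0)"

lemma lp_limit_unique:
  assumes lp: "\<And>k. h k \<in> lp p" "g \<in> lp p" "g' \<in> lp p"
    and lim: "(\<lambda>k. lp_norm p (\<lambda>x. h k x - g x)) \<longlonglongrightarrow> 0" "(\<lambda>k. lp_norm p (\<lambda>x. h k x - g' x)) \<longlonglongrightarrow> 0"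
  shows "g = g'"
proof
  fix x
  have "(\<lambda>k. lp_norm p (\<lambda>x. h k x - g x) + lp_norm p (\<lambda>x. h k x - g' x)) \<longlonglongrightarrow> 0 + 0"
    by (intro tendsto_add lim)
  moreover have "lp_norm p (\<lambda>x. g x - g' x) \<le> lp_norm p (\<lambda>x. h k x - g x) + lp_norm p (\<lambda>x. h k x - g' x)" for k
    using Lp_norm_triangle[OF p lp(2) lp(1)[of k] lp(3)] Lp_norm_minus_commute[of p "count_space UNIV" g "h k"] by simp
  ultimately have "lp_norm p (\<lambda>x. g x - g' x) \<le> 0 + 0" by (intro LIMSEQ_le_const) auto
  thus "g x = g' x" using lp_norm_eq_0D[of p "\<lambda>x. g x - g' x" x] Lp_diff[of p g _ g'] lp p by simp
qed

lemma limit_of_lp: "limit_of f g \<Longrightarrow> g \<in> lp p"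
  by (simp add: limit_of_def)

lemma limit_ofD:
  "\<lbrakk>limit_of f g; \<And>k::nat. finsupp (h k); (\<lambda>k. lp_norm p (\<lambda>x. h k x - f x)) \<longlonglongrightarrow> 0\<rbrakk>
    \<Longrightarrow> (\<lambda>k. lp_norm p (\<lambda>x. T (h k) x - g x)) \<longlonglongrightarrow> 0"
  by (simp add: limit_of_def)

lemma limit_of_unique:
  assumes "f \<in> lp p" "limit_of f g" "limit_of f g'"
  shows "g = g'"
proof -
  obtain h where h: "\<And>k :: nat. finsupp (h k)" and lim: "(\<lambda>k. lp_norm p (\<lambda>x. h k x - f x)) \<longlonglongrightarrow> 0"
    using finsupp_dense[OF p assms(1)] by blast
  show ?thesis
    by (rule lp_limit_unique[OF T_lp[OF h] limit_of_lp[OF assms(2)] limit_of_lp[OF assms(3)]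
        limit_ofD[OF assms(2) h lim] limit_ofD[OF assms(3) h lim]])
qed

text \<open>\<open>T (h k)\<close> is Cauchy in norm, hence pointwise, and \<open>g\<close> is the
  pointwise limit. Letting the second index tend to infinity in finite partial sums gives
  convergence in norm, so that completeness is obtained along the way; comparison with
  \<open>h\<close> shows that every other approximating sequence leads to the same limit.\<close>

lemma limit_of_exists:
  assumes f: "f \<in> lp p"
  shows "\<exists>g. limit_of f g \<and> lp_norm p g \<le> C * lp_norm p f"
proof -
  obtain h where h: "\<And>k :: nat. finsupp (h k)" and lim: "(\<lambda>k. lp_norm p (\<lambda>x. h k x - f x)) \<longlonglongrightarrow> 0"
    using finsupp_dense[OF p f] by blast
  define e where "e k = lp_norm p (\<lambda>x. h k x - f x)" for k
  have e: "e \<longlonglongrightarrow> 0" using lim by (simp add: e_def[abs_def])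
  have hlp: "h k \<in> lp p" for k by (rule finsupp_lp[OF h])
  have hh: "lp_norm p (\<lambda>x. h' x - h k x) \<le> lp_norm p (\<lambda>x. h' x - f x) + e k" if "h' \<in> lp p" for h' k
    using Lp_norm_triangle[OF p that f hlp[of k]] Lp_norm_minus_commute[of p "count_space UNIV" f "h k"]
    by (simp add: e_def)
  have e0: "0 \<le> e k" for k by (simp add: e_def)
  have Tlp: "(\<lambda>x. T (h k) x - T (h l) x) \<in> lp p" for k l
    using Lp_diff[OF _ T_lp[OF h[of k]] T_lp[OF h[of l]]] p by simp
  have TT: "lp_norm p (\<lambda>x. T (h k) x - T (h l) x) \<le> C * (e k + e l)" for k l
    by (rule order_trans[OF extension_diff_le[OF h h] mult_left_mono[OF _ C]]) (use hh[OF hlp, of k l] in \<open>simp add: e_def\<close>)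
  have "Cauchy (\<lambda>k. T (h k) x)" for x
  proof (rule CauchyI)
    fix \<epsilon> :: real assume \<epsilon>: "0 < \<epsilon>"
    have "(\<lambda>k. C * e k) \<longlonglongrightarrow> C * 0" by (intro tendsto_intros e)
    hence "eventually (\<lambda>k. C * e k < \<epsilon> / 2) sequentially" using \<epsilon> by (intro order_tendstoD(2)) auto
    then obtain N where N: "\<And>k. N \<le> k \<Longrightarrow> C * e k < \<epsilon> / 2" by (auto simp: eventually_sequentially)
    have "\<bar>T (h k) x - T (h l) x\<bar> < \<epsilon>" if "N \<le> k" "N \<le> l" for k l
    proof -
      have "\<bar>T (h k) x - T (h l) x\<bar> \<le> C * (e k + e l)"
        using order_trans[OF abs_le_lp_norm[OF _ Tlp] TT] p by simp
      moreover have "2 * (C * e k) < \<epsilon>" "2 * (C * e l) < \<epsilon>" using N[OF that(1)] N[OF that(2)] by simp_all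
      moreover have "C * (e k + e l) = C * e k + C * e l" by (rule distrib_left)
      ultimately show ?thesis by linarith
    qed
    thus "\<exists>M. \<forall>m\<ge>M. \<forall>n\<ge>M. norm (T (h m) x - T (h n) x) < \<epsilon>" by auto
  qed
  hence "\<exists>l. (\<lambda>k. T (h k) x) \<longlonglongrightarrow> l" for x by (simp add: Cauchy_convergent_iff convergent_def)
  then obtain g where g: "\<And>x. (\<lambda>k. T (h k) x) \<longlonglongrightarrow> g x" by metis
  have pw: "(\<lambda>l. \<bar>u l\<bar> powr p) \<longlonglongrightarrow> \<bar>v\<bar> powr p" if "u \<longlonglongrightarrow> v" for u and v :: real
    by (rule tendsto_powr'[OF tendsto_rabs[OF that] tendsto_const]) (use p in auto)
  have sums: "(\<Sum>x\<in>B. \<bar>T (h k) x - g x\<bar> powr p) \<le> \<bar>C * (e k + 0)\<bar> powr p" if "finite B" for B k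
  proof (rule LIMSEQ_le)
    show "(\<lambda>l. \<Sum>x\<in>B. \<bar>T (h k) x - T (h l) x\<bar> powr p) \<longlonglongrightarrow> (\<Sum>x\<in>B. \<bar>T (h k) x - g x\<bar> powr p)"
      by (intro tendsto_sum pw tendsto_diff tendsto_const g)
    show "(\<lambda>l. \<bar>C * (e k + e l)\<bar> powr p) \<longlonglongrightarrow> \<bar>C * (e k + 0)\<bar> powr p"
      by (intro pw tendsto_mult tendsto_add tendsto_const e)
    have "(\<Sum>x\<in>B. \<bar>T (h k) x - T (h l) x\<bar> powr p) \<le> \<bar>C * (e k + e l)\<bar> powr p" for l
    proof -
      have "(\<Sum>x\<in>B. \<bar>T (h k) x - T (h l) x\<bar> powr p) \<le> lp_norm p (\<lambda>x. T (h k) x - T (h l) x) powr p"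
        using lp_finite_sum_le[OF Tlp that] p by (simp add: Lp_norm_powr)
      also have "\<dots> \<le> \<bar>C * (e k + e l)\<bar> powr p"
        using p order_trans[OF TT abs_ge_self] by (intro powr_mono2) auto
      finally show ?thesis .
    qed
    thus "\<exists>N. \<forall>l\<ge>N. (\<Sum>x\<in>B. \<bar>T (h k) x - T (h l) x\<bar> powr p) \<le> \<bar>C * (e k + e l)\<bar> powr p" by blast
  qed
  have diff: "(\<lambda>x. T (h k) x - g x) \<in> lp p" for k by (rule lp_of_finite_sums(1)[OF sums])
  have diff_le: "lp_norm p (\<lambda>x. T (h k) x - g x) \<le> C * e k" for k
    using lp_of_finite_sums(2)[OF sums, of k] p C e0[of k] by (intro Lp_norm_leI) auto
  have glp: "g \<in> lp p" using Lp_diff[OF _ T_lp[OF h[of 0]] diff[of 0]] p by simp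
  have "limit_of f g"
    unfolding limit_of_def
  proof (intro conjI allI impI glp, elim conjE)
    fix h' assume h': "\<forall>k::nat. finsupp (h' k)" "(\<lambda>k. lp_norm p (\<lambda>x. h' k x - f x)) \<longlonglongrightarrow> 0"
    have le: "lp_norm p (\<lambda>x. T (h' k) x - g x) \<le> C * (lp_norm p (\<lambda>x. h' k x - f x) + e k) + C * e k" for k
    proof -
      have "lp_norm p (\<lambda>x. T (h' k) x - g x) \<le> lp_norm p (\<lambda>x. T (h' k) x - T (h k) x) + lp_norm p (\<lambda>x. T (h k) x - g x)"
        using h' h by (intro Lp_norm_triangle p T_lp glp) auto
      moreover have "lp_norm p (\<lambda>x. T (h' k) x - T (h k) x) \<le> C * lp_norm p (\<lambda>x. h' k x - h k x)"
        using h' h by (intro extension_diff_le) auto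
      moreover have "C * lp_norm p (\<lambda>x. h' k x - h k x) \<le> C * (lp_norm p (\<lambda>x. h' k x - f x) + e k)"
        using h' by (intro mult_left_mono hh C finsupp_lp) auto
      ultimately show ?thesis using diff_le[of k] by linarith
    qed
    have lim': "(\<lambda>k. C * (lp_norm p (\<lambda>x. h' k x - f x) + e k) + C * e k) \<longlonglongrightarrow> C * (0 + 0) + C * 0"
      by (intro tendsto_add tendsto_mult tendsto_const h'(2) e)
    show "(\<lambda>k. lp_norm p (\<lambda>x. T (h' k) x - g x)) \<longlonglongrightarrow> 0"
      by (rule tendsto_sandwich[OF _ _ tendsto_const lim'[simplified]])
        (simp_all only: Lp_norm_nonneg le eventually_True)
  qed
  moreover have "lp_norm p g \<le> C * lp_norm p f"
  proof -
    have zero: "(\<lambda>_. 0) \<in> lp p" by (rule Lp_zero)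
    have "lp_norm p g \<le> C * (e k + lp_norm p f) + C * e k" for k
    proof -
      have "lp_norm p (\<lambda>x. g x - 0) \<le> lp_norm p (\<lambda>x. g x - T (h k) x) + lp_norm p (\<lambda>x. T (h k) x - 0)"
        by (intro Lp_norm_triangle p T_lp glp zero h)
      moreover have "lp_norm p (\<lambda>x. h k x - 0) \<le> lp_norm p (\<lambda>x. h k x - f x) + lp_norm p (\<lambda>x. f x - 0)"
        by (intro Lp_norm_triangle p hlp f zero)
      hence "C * lp_norm p (h k) \<le> C * (e k + lp_norm p f)" using C by (intro mult_left_mono) (auto simp: e_def)
      ultimately show ?thesis
        using T_le[OF h, of k] diff_le[of k] Lp_norm_minus_commute[of p "count_space UNIV" g "T (h k)"] by simp
    qed
    moreover have "(\<lambda>k. C * (e k + lp_norm p f) + C * e k) \<longlonglongrightarrow> C * (0 + lp_norm p f) + C * 0"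
      by (intro tendsto_add tendsto_mult tendsto_const e)
    ultimately have "lp_norm p g \<le> C * (0 + lp_norm p f) + C * 0" by (intro LIMSEQ_le_const) auto
    thus ?thesis by simp
  qed
  ultimately show ?thesis by blast
qed

lemma lp_extension_limit:
  assumes "f \<in> lp p"
  shows "limit_of f (lp_extension p T f)" "lp_norm p (lp_extension p T f) \<le> C * lp_norm p f"
proof -
  obtain g where g: "limit_of f g" "lp_norm p g \<le> C * lp_norm p f" using limit_of_exists[OF assms] by blast
  have "lp_extension p T f = g"
    unfolding lp_extension_def limit_of_def[symmetric]
    by (rule the_equality[where P = "limit_of f", OF g(1)]) (rule limit_of_unique[OF assms _ g(1)])
  thus "limit_of f (lp_extension p T f)" "lp_norm p (lp_extension p T f) \<le> C * lp_norm p f" using g by auto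
qed

lemma lp_extension_finsupp:
  assumes "finsupp f"
  shows "lp_extension p T f = T f"
proof -
  have f: "f \<in> lp p" by (rule finsupp_lp[OF assms])
  have lim: "limit_of f (lp_extension p T f)" by (rule lp_extension_limit[OF f])
  have "(\<lambda>k::nat. lp_norm p (\<lambda>x. f x - f x)) \<longlonglongrightarrow> 0" using p by (simp add: Lp_norm_def)
  hence "(\<lambda>k::nat. lp_norm p (\<lambda>x. T f x - lp_extension p T f x)) \<longlonglongrightarrow> 0"
    by (rule limit_ofD[OF lim assms])
  moreover have "(\<lambda>k::nat. lp_norm p (\<lambda>x. T f x - T f x)) \<longlonglongrightarrow> 0" using p by (simp add: Lp_norm_def)
  ultimately show ?thesis
    using lp_limit_unique[of "\<lambda>_. T f", OF T_lp[OF assms] limit_of_lp[OF lim] T_lp[OF assms]] by blast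
qed

lemma lp_extension_bounded_linear: "lp_bounded_linear (lp p) p (lp_extension p T)"
  unfolding lp_bounded_linear_def
proof (intro conjI ballI allI)
  fix f g :: "'a \<Rightarrow> real" and a c :: real assume fg: "f \<in> lp p" "g \<in> lp p"
  let ?E = "lp_extension p T"
  show f: "?E f \<in> lp p" using lp_extension_limit(1)[OF fg(1)] by (simp add: limit_of_def)
  have g: "?E g \<in> lp p" using lp_extension_limit(1)[OF fg(2)] by (simp add: limit_of_def)
  have sc: "\<And>u. u \<in> lp p \<Longrightarrow> (\<lambda>x. d * u x) \<in> lp p" for d by (rule Lp_cmult)
  have add: "\<And>u v. u \<in> lp p \<Longrightarrow> v \<in> lp p \<Longrightarrow> (\<lambda>x. u x + v x) \<in> lp p" using p by (intro Lp_add) auto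
  have le: "lp_norm p (\<lambda>x. (a * u x + c * v x) - (a * u' x + c * v' x)) \<le>
      \<bar>a\<bar> * lp_norm p (\<lambda>x. u x - u' x) + \<bar>c\<bar> * lp_norm p (\<lambda>x. v x - v' x)"
    if "u \<in> lp p" "v \<in> lp p" "u' \<in> lp p" "v' \<in> lp p" for u v u' v' :: "'a \<Rightarrow> real"
  proof -
    have "lp_norm p (\<lambda>x. a * (u x - u' x) + c * (v x - v' x)) \<le>
        lp_norm p (\<lambda>x. a * (u x - u' x)) + lp_norm p (\<lambda>x. c * (v x - v' x))"
      using that p by (intro Minkowski sc Lp_diff) auto
    moreover have "(\<lambda>x. a * (u x - u' x) + c * (v x - v' x)) = (\<lambda>x. (a * u x + c * v x) - (a * u' x + c * v' x))"
      by (simp add: fun_eq_iff algebra_simps)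
    ultimately show ?thesis using p by (simp only: Lp_norm_cmult[OF less_trans[OF zero_less_one p]])
  qed
  obtain h where h: "\<And>k :: nat. finsupp (h k)" and hl: "(\<lambda>k. lp_norm p (\<lambda>x. h k x - f x)) \<longlonglongrightarrow> 0"
    using finsupp_dense[OF p fg(1)] by blast
  obtain h' where h': "\<And>k :: nat. finsupp (h' k)" and hl': "(\<lambda>k. lp_norm p (\<lambda>x. h' k x - g x)) \<longlonglongrightarrow> 0"
    using finsupp_dense[OF p fg(2)] by blast
  have Th: "(\<lambda>k. lp_norm p (\<lambda>x. T (h k) x - ?E f x)) \<longlonglongrightarrow> 0"
    by (rule limit_ofD[OF lp_extension_limit(1)[OF fg(1)] h hl])
  have Th': "(\<lambda>k. lp_norm p (\<lambda>x. T (h' k) x - ?E g x)) \<longlonglongrightarrow> 0"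
    by (rule limit_ofD[OF lp_extension_limit(1)[OF fg(2)] h' hl'])
  have sum: "(\<lambda>x. a * f x + c * g x) \<in> lp p" by (intro add sc fg)
  have z: "(\<lambda>k. \<bar>a\<bar> * u k + \<bar>c\<bar> * v k) \<longlonglongrightarrow> 0" if "u \<longlonglongrightarrow> 0" "v \<longlonglongrightarrow> 0" for u v :: "nat \<Rightarrow> real"
    using tendsto_add[OF tendsto_mult[OF tendsto_const that(1)] tendsto_mult[OF tendsto_const that(2)], of "\<bar>a\<bar>" "\<bar>c\<bar>"] by simp
  have "(\<lambda>k. lp_norm p (\<lambda>x. (a * h k x + c * h' k x) - (a * f x + c * g x))) \<longlonglongrightarrow> 0"
    by (rule tendsto_sandwich[OF _ _ tendsto_const z[OF hl hl']])
      (intro always_eventually allI Lp_norm_nonneg le fg finsupp_lp h h')+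
  hence 1: "(\<lambda>k. lp_norm p (\<lambda>x. T (\<lambda>x. a * h k x + c * h' k x) x - ?E (\<lambda>x. a * f x + c * g x) x)) \<longlonglongrightarrow> 0"
    by (rule limit_ofD[OF lp_extension_limit(1)[OF sum] finsupp_linear[OF h h']])
  have 2: "(\<lambda>k. lp_norm p (\<lambda>x. T (\<lambda>x. a * h k x + c * h' k x) x - (a * ?E f x + c * ?E g x))) \<longlonglongrightarrow> 0"
    unfolding linear[OF h h']
    by (rule tendsto_sandwich[OF _ _ tendsto_const z[OF Th Th']])
      (intro always_eventually allI Lp_norm_nonneg le f g T_lp h h')+
  show "?E (\<lambda>x. a * f x + c * g x) = (\<lambda>x. a * ?E f x + c * ?E g x)"
    by (rule lp_limit_unique[OF T_lp[OF finsupp_linear[OF h h']] limit_of_lp[OF lp_extension_limit(1)[OF sum]] _ 1 2])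
      (intro add sc f g)
next
  show "\<exists>K. \<forall>f\<in>lp p. lp_norm p (lp_extension p T f) \<le> K * lp_norm p f"
    using lp_extension_limit(2) by blast
qed

end

section \<open>Symbols of the walk operators\<close>

text \<open>The ratio of the Fourier transforms of \<open>S k\<close> and \<open>F k\<close>. One
  factor \<open>q k\<close> comes from averaging \<open>S k\<close>, the other from
  \<open>F k\<close>, which is the average of \<open>F (Suc k)\<close>; the new increment
  contributes \<open>1 - (q k)\<^sup>2\<close>.\<close>

fun walk_symbol :: "real \<Rightarrow> (nat \<Rightarrow> real) \<Rightarrow> (nat \<Rightarrow> real) \<Rightarrow> nat \<Rightarrow> real" where
  "walk_symbol t q a 0 = t"
| "walk_symbol t q a (Suc k) = (q k)\<^sup>2 * walk_symbol t q a k + a k * (1 - (q k)\<^sup>2)"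

lemma walk_symbol_affine:
  "walk_symbol t q a k = (\<Prod>j<k. (q j)\<^sup>2) * t + walk_symbol 0 q a k"
  by (induction k) (auto simp: algebra_simps)

lemma walk_symbol_add:
  "walk_symbol t q a (j + k) = walk_symbol (walk_symbol t q a j) (\<lambda>i. q (j + i)) (\<lambda>i. a (j + i)) k"
  by (induction k) auto

text \<open>With all multipliers equal to \<open>1\<close>, the initial one included, the symbol is
  \<open>1\<close>. The denominator of the geometric series over the rounds is therefore itself a
  walk symbol and has the same kind of asymptotics as the numerator.\<close>

lemma one_minus_prod: "1 - (\<Prod>j<k. (q j)\<^sup>2) = walk_symbol 0 q (\<lambda>_. 1) k" for q :: "nat \<Rightarrow> real"
proof -
  have "walk_symbol 1 q (\<lambda>_. 1) k = 1" by (induction k) auto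
  thus ?thesis using walk_symbol_affine[of 1 q "\<lambda>_. 1" k] by simp
qed

text \<open>One round acts on the symbol by a fixed affine map, whose iterates give a geometric
  series.\<close>

lemma walk_symbol_cycles:
  assumes "\<And>k. q (N + k) = q k" "\<And>k. a (N + k) = a k"
  shows "walk_symbol t q a (N * M) =
    (\<Prod>j<N. (q j)\<^sup>2) ^ M * t + walk_symbol 0 q a N * (\<Sum>j<M. (\<Prod>j<N. (q j)\<^sup>2) ^ j)"
proof (induction M)
  case (Suc M)
  have per: "q (N * M + k) = q k" "a (N * M + k) = a k" for k
  proof (induction M)
    case (Suc M)
    case 1 show ?case using Suc assms(1)[of "N * M + k"] by (simp add: algebra_simps)
    case 2 show ?case using Suc assms(2)[of "N * M + k"] by (simp add: algebra_simps)
  qed auto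
  have "walk_symbol t q a (N * Suc M) = walk_symbol (walk_symbol t q a (N * M)) q a N"
    using walk_symbol_add[of t q a "N * M" N] unfolding per by (simp add: add.commute)
  also have "\<dots> = (\<Prod>j<N. (q j)\<^sup>2) * walk_symbol t q a (N * M) + walk_symbol 0 q a N"
    by (rule walk_symbol_affine)
  finally show ?case
    unfolding Suc by (simp add: algebra_simps sum_distrib_left sum.lessThan_Suc_shift del: sum.lessThan_Suc)
qed simp

lemma abs_walk_symbol_le:
  assumes "\<bar>t\<bar> \<le> m" "\<And>k. \<bar>a k\<bar> \<le> m" "\<And>k. (q k)\<^sup>2 \<le> 1"
  shows "\<bar>walk_symbol t q a k\<bar> \<le> m"
proof (induction k)
  case (Suc k)
  have "\<bar>walk_symbol t q a (Suc k)\<bar> \<le> (q k)\<^sup>2 * \<bar>walk_symbol t q a k\<bar> + \<bar>a k\<bar> * (1 - (q k)\<^sup>2)"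
    using assms(3)[of k] abs_triangle_ineq[of "(q k)\<^sup>2 * walk_symbol t q a k" "a k * (1 - (q k)\<^sup>2)"]
    by (simp add: abs_mult)
  also have "\<dots> \<le> (q k)\<^sup>2 * m + m * (1 - (q k)\<^sup>2)"
    using assms(2,3)[of k] Suc by (intro add_mono mult_left_mono mult_right_mono) auto
  finally show ?case by (simp add: algebra_simps)
qed (use assms in simp)

text \<open>With time step \<open>h\<close> and \<open>h\<^sup>-\<^sup>2\<close> rounds through the \<open>N\<close> coordinates, the symbols converge to the
  quotient defining the Riesz transforms.\<close>

lemma walk_symbol_limit:
  fixes \<mu> a :: "nat \<Rightarrow> real" and t :: real and N :: nat
  assumes per: "\<And>k. \<mu> (N + k) = \<mu> k" "\<And>k. a (N + k) = a k"
    and \<mu>: "\<And>k. 0 \<le> \<mu> k" "\<And>k. \<mu> k \<le> 4" and pos: "j < N" "0 < \<mu> j"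
  shows "(\<lambda>l. walk_symbol t (\<lambda>k. 1 - \<mu> k / real (l + 8)) a (N * (l + 8)\<^sup>2))
           \<longlonglongrightarrow> (\<Sum>k<N. a k * \<mu> k) / (\<Sum>k<N. \<mu> k)"
proof -
  \<comment> \<open>The shift by \<open>8\<close> keeps \<open>h l * \<mu> k\<close> at most
    \<open>1 / 2\<close>, so that all factors \<open>q l k\<close> lie in
    \<open>[0, 1]\<close>.\<close>
  define h where "h l = 1 / real (l + 8)" for l
  define q where "q l k = 1 - h l * \<mu> k" for l k
  define P where "P l = (\<Prod>j<N. (q l j)\<^sup>2)" for l
  have h0: "0 < h l" "h l \<le> 1 / 8" for l by (auto simp: h_def)
  have h: "h \<longlonglongrightarrow> 0" unfolding h_def[abs_def] by real_asymp
  have q01: "0 \<le> q l k" "q l k \<le> 1" for l k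
  proof -
    have "h l * \<mu> k \<le> 1 / 8 * 4" using h0(1)[of l] h0(2)[of l] \<mu>[of k] by (intro mult_mono) auto
    thus "0 \<le> q l k" by (simp add: q_def)
    show "q l k \<le> 1" using h0(1)[of l] \<mu>(1)[of k] by (simp add: q_def)
  qed
  have ql: "(\<lambda>l. q l k) \<longlonglongrightarrow> 1" for k
    using tendsto_diff[OF tendsto_const tendsto_mult[OF h tendsto_const], of 1 "\<mu> k"] by (simp add: q_def)
  have ratio: "(\<lambda>l. walk_symbol 0 (q l) b k / h l) \<longlonglongrightarrow> (\<Sum>j<k. 2 * b j * \<mu> j)" for b k
  proof (induction k)
    case (Suc k)
    have "walk_symbol 0 (q l) b (Suc k) / h l = (q l k)\<^sup>2 * (walk_symbol 0 (q l) b k / h l) + b k * (\<mu> k * (2 - h l * \<mu> k))" for l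
      using h0(1)[of l] by (simp add: q_def field_simps power2_eq_square)
    moreover have "(\<lambda>l. (q l k)\<^sup>2 * (walk_symbol 0 (q l) b k / h l) + b k * (\<mu> k * (2 - h l * \<mu> k)))
        \<longlonglongrightarrow> 1\<^sup>2 * (\<Sum>j<k. 2 * b j * \<mu> j) + b k * (\<mu> k * (2 - 0 * \<mu> k))"
      by (intro tendsto_add tendsto_mult tendsto_power tendsto_diff tendsto_const ql Suc h)
    ultimately show ?case by (simp add: mult_ac)
  qed simp
  have P1: "P l < 1" and Pexp: "P l \<le> exp (- (h l * \<mu> j))" and P0: "0 \<le> P l" for l
  proof -
    have "P l = (q l j)\<^sup>2 * (\<Prod>i\<in>{..<N} - {j}. (q l i)\<^sup>2)"
      unfolding P_def using pos(1) by (intro prod.remove) auto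
    also have "\<dots> \<le> (q l j)\<^sup>2 * 1"
      using q01 by (intro mult_left_mono prod_le_1) (auto simp: power_le_one)
    also have "\<dots> \<le> q l j * 1" unfolding power2_eq_square using q01[of l j] by (simp add: mult_left_le)
    finally have Pq: "P l \<le> 1 - h l * \<mu> j" by (simp add: q_def)
    also have "\<dots> \<le> exp (- (h l * \<mu> j))" using exp_ge_add_one_self[of "- (h l * \<mu> j)"] by simp
    finally show "P l \<le> exp (- (h l * \<mu> j))" .
    have "0 < h l * \<mu> j" using h0(1) pos(2) by simp
    thus "P l < 1" using Pq by simp
    show "0 \<le> P l" unfolding P_def by (intro prod_nonneg) auto
  qed
  \<comment> \<open>Each round multiplies by at most \<open>exp (- (h l * \<mu> j))\<close>. After
    \<open>1 / (h l)\<^sup>2\<close> rounds at most \<open>exp (- \<mu> j / h l)\<close> is left,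
    which tends to \<open>0\<close> and erases the initial multiplier \<open>t\<close>.\<close>
  have PM: "(\<lambda>l. P l ^ (l + 8)\<^sup>2) \<longlonglongrightarrow> 0"
  proof (rule tendsto_sandwich[OF _ _ tendsto_const])
    have "P l ^ (l + 8)\<^sup>2 \<le> exp (- \<mu> j * real (l + 8))" for l
    proof -
      have "P l ^ (l + 8)\<^sup>2 \<le> exp (- (h l * \<mu> j)) ^ (l + 8)\<^sup>2" by (intro power_mono Pexp P0)
      also have "\<dots> = exp (real ((l + 8)\<^sup>2) * (- (h l * \<mu> j)))" by (rule exp_of_nat_mult[symmetric])
      also have "real ((l + 8)\<^sup>2) * (- (h l * \<mu> j)) = - \<mu> j * real (l + 8)"
        by (simp add: h_def power2_eq_square)
      finally show ?thesis .
    qed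
    thus "\<forall>\<^sub>F l in sequentially. P l ^ (l + 8)\<^sup>2 \<le> exp (- \<mu> j * real (l + 8))" by simp
    show "(\<lambda>l. exp (- \<mu> j * real (l + 8))) \<longlonglongrightarrow> 0" using pos(2) by real_asymp
  qed (simp add: P0)
  have sum_pos: "0 < (\<Sum>k<N. \<mu> k)" using pos \<mu> by (intro sum_pos2[of _ j]) auto
  have D: "1 - P l = walk_symbol 0 (q l) (\<lambda>_. 1) N" for l unfolding P_def by (rule one_minus_prod)
  have "walk_symbol t (q l) a (N * (l + 8)\<^sup>2) =
      P l ^ (l + 8)\<^sup>2 * t + (walk_symbol 0 (q l) a N / h l) / (walk_symbol 0 (q l) (\<lambda>_. 1) N / h l) * (1 - P l ^ (l + 8)\<^sup>2)" for l
  proof -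
    have "(1 - P l) * (\<Sum>j<(l + 8)\<^sup>2. P l ^ j) = 1 - P l ^ (l + 8)\<^sup>2" by (rule one_diff_power_eq[symmetric])
    hence "(\<Sum>j<(l + 8)\<^sup>2. P l ^ j) = (1 - P l ^ (l + 8)\<^sup>2) / (1 - P l)" using P1[of l] by (simp add: field_simps)
    moreover have "walk_symbol t (q l) a (N * (l + 8)\<^sup>2) = P l ^ (l + 8)\<^sup>2 * t + walk_symbol 0 (q l) a N * (\<Sum>j<(l + 8)\<^sup>2. P l ^ j)"
      unfolding P_def by (rule walk_symbol_cycles) (simp_all add: q_def per)
    ultimately show ?thesis using h0(1)[of l] by (simp add: D)
  qed
  moreover have "(\<lambda>l. P l ^ (l + 8)\<^sup>2 * t + (walk_symbol 0 (q l) a N / h l) / (walk_symbol 0 (q l) (\<lambda>_. 1) N / h l) * (1 - P l ^ (l + 8)\<^sup>2))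
      \<longlonglongrightarrow> 0 * t + (\<Sum>k<N. 2 * a k * \<mu> k) / (\<Sum>k<N. 2 * 1 * \<mu> k) * (1 - 0)"
    using sum_pos by (intro tendsto_add tendsto_mult tendsto_divide tendsto_diff tendsto_const PM ratio) (simp add: sum_distrib_left[symmetric])
  moreover have "(\<Sum>k<N. 2 * a k * \<mu> k) / (\<Sum>k<N. 2 * 1 * \<mu> k) = (\<Sum>k<N. a k * \<mu> k) / (\<Sum>k<N. \<mu> k)"
    by (simp add: sum_distrib_left[symmetric] mult.assoc)
  ultimately show ?thesis by (simp add: q_def[abs_def] h_def)
qed

section \<open>Operators defined by the walk\<close>

fun backward :: "real \<Rightarrow> (nat \<Rightarrow> 'x::ab_group_add) \<Rightarrow> nat \<Rightarrow> ('x \<Rightarrow> real) \<Rightarrow> nat \<Rightarrow> 'x \<Rightarrow> real" where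
  "backward h dir n f 0 = f"
| "backward h dir n f (Suc j) = lazy_average h (dir (n - Suc j)) (backward h dir n f j)"

fun forward :: "real \<Rightarrow> (nat \<Rightarrow> 'x::ab_group_add) \<Rightarrow> (nat \<Rightarrow> real) \<Rightarrow> (nat \<Rightarrow> 'x \<Rightarrow> real) \<Rightarrow> nat \<Rightarrow> 'x \<Rightarrow> real" where
  "forward h dir \<theta> F 0 = (\<lambda>x. \<theta> 0 * F 0 x)"
| "forward h dir \<theta> F (Suc k) = (\<lambda>x. lazy_average h (dir k) (forward h dir \<theta> F k) x +
     \<theta> (Suc k) * (F (Suc k) x - lazy_average h (dir k) (F k) x))"

text \<open>\<open>backward h dir n f (n - k)\<close> is \<open>F k\<close>, counted from the end
  because \<open>f\<close> is given at time \<open>n\<close>, and \<open>forward\<close> is the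
  recursion for \<open>S\<close> in \<open>lattice_walk\<close>. Its value at time \<open>n\<close>
  is the conditioned transform.\<close>

definition walk_operator ::
    "real \<Rightarrow> (nat \<Rightarrow> 'x::ab_group_add) \<Rightarrow> (nat \<Rightarrow> real) \<Rightarrow> nat \<Rightarrow> ('x \<Rightarrow> real) \<Rightarrow> 'x \<Rightarrow> real" where
  "walk_operator h dir \<theta> n f = forward h dir \<theta> (\<lambda>k. backward h dir n f (n - k)) n"

lemma backward_Suc_diff:
  "k < n \<Longrightarrow> backward h dir n f (n - k) = lazy_average h (dir k) (backward h dir n f (n - Suc k))"
  by (simp add: Suc_diff_Suc[symmetric])

lemma walk_operator_bound:
  fixes f :: "'x::ab_group_add \<Rightarrow> real"
  assumes p: "1 < p" and C: "choi_bound TYPE((real \<times> 'x) list) b B p C" "0 \<le> C"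
    and h: "0 \<le> h" "h \<le> 1 / 2" and \<theta>: "\<And>k. \<theta> k \<in> {b..B}"
    and A: "finite A" "\<And>x. x \<notin> A \<Longrightarrow> f x = 0"
  shows "(\<Sum>x\<in>A. \<bar>walk_operator h dir \<theta> n f x\<bar> powr p) \<le> C powr p * (\<Sum>x\<in>A. \<bar>f x\<bar> powr p)"
proof (cases "A = {}")
  case False
  \<comment> \<open>\<open>N j\<close> contains all points from which the last \<open>j\<close>
    steps can lead to \<open>A\<close>. Reversed in time, these are the sets of
    \<open>lattice_walk\<close>, with \<open>A\<close> itself at the end.\<close>
  define N where "N = rec_nat A (\<lambda>j X. X \<union> (\<lambda>x. x + dir (n - Suc j)) ` X \<union> (\<lambda>x. x - dir (n - Suc j)) ` X)"
  have N: "N 0 = A" "N (Suc j) = N j \<union> (\<lambda>x. x + dir (n - Suc j)) ` N j \<union> (\<lambda>x. x - dir (n - Suc j)) ` N j" for j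
    by (simp_all add: N_def)
  have finN: "finite (N j)" for j by (induction j) (auto simp: N A)
  have subN: "A \<subseteq> N j" for j by (induction j) (auto simp: N)
  define F where "F k = backward h dir n f (n - k)" for k
  interpret lattice_walk h dir n F "forward h dir \<theta> F" \<theta> "\<lambda>k. N (n - k)"
  proof
    show "F k = lazy_average h (dir k) (F (Suc k))" if "k < n" for k
      unfolding F_def by (rule backward_Suc_diff[OF that])
    show "N (n - 0) \<noteq> {}" using subN[of n] False by auto
    show "x \<in> N (n - k) \<and> x + dir k \<in> N (n - k) \<and> x - dir k \<in> N (n - k)" if "k < n" "x \<in> N (n - Suc k)" for k x
    proof -
      have "n - k = Suc (n - Suc k)" "n - Suc (n - Suc k) = k" using that(1) by auto
      thus ?thesis using that(2) by (simp add: N)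
    qed
  qed (use h finN in auto)
  have "(\<Sum>x\<in>N (n - n). \<bar>forward h dir \<theta> F n x\<bar> powr p) \<le> C powr p * (\<Sum>x\<in>N (n - n). \<bar>F n x\<bar> powr p)"
    by (rule lattice_walk_bound[OF p C \<theta>]) (simp add: F_def N A)
  moreover have "forward h dir \<theta> F n = walk_operator h dir \<theta> n f" by (simp add: walk_operator_def F_def[abs_def])
  ultimately show ?thesis by (simp add: N F_def)
qed simp

text \<open>\<open>\<Phi>\<close> stands for the Fourier transform at one frequency and
  \<open>V\<close> for its domain, so that a single induction covers all functions on the finite
  group and the finitely supported ones on the lattice.\<close>

lemma walk_operator_multiplier:
  fixes \<Phi> :: "('x::ab_group_add \<Rightarrow> real) \<Rightarrow> complex"
  assumes lin: "\<And>f g a c. V f \<Longrightarrow> V g \<Longrightarrow> V (\<lambda>x. a * f x + c * g x) \<and>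
        \<Phi> (\<lambda>x. a * f x + c * g x) = of_real a * \<Phi> f + of_real c * \<Phi> g"
    and avg: "\<And>f k. V f \<Longrightarrow> V (lazy_average h (dir k) f) \<and> \<Phi> (lazy_average h (dir k) f) = of_real (q k) * \<Phi> f"
    and f: "V f"
  shows "V (walk_operator h dir \<theta> n f)"
    "\<Phi> (walk_operator h dir \<theta> n f) = of_real (walk_symbol (\<theta> 0) q (\<lambda>k. \<theta> (Suc k)) n) * \<Phi> f"
proof -
  define F where "F k = backward h dir n f (n - k)" for k
  define S where "S = forward h dir \<theta> F"
  have "V (backward h dir n f j)" for j by (induction j) (use f avg in auto)
  hence VF: "V (F k)" for k by (simp add: F_def)
  have FF: "\<Phi> (F k) = of_real (q k) * \<Phi> (F (Suc k))" if "k < n" for k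
    using backward_Suc_diff[OF that, of h dir f] avg[OF VF[of "Suc k"], of k] by (simp add: F_def)
  have "V (S k) \<and> \<Phi> (S k) = of_real (walk_symbol (\<theta> 0) q (\<lambda>k. \<theta> (Suc k)) k) * \<Phi> (F k)" if "k \<le> n" for k
    using that
  proof (induction k)
    case 0
    show ?case using lin[OF VF[of 0] VF[of 0], of "\<theta> 0" 0] by (simp add: S_def)
  next
    case (Suc k)
    hence IH: "V (S k)" "\<Phi> (S k) = of_real (walk_symbol (\<theta> 0) q (\<lambda>k. \<theta> (Suc k)) k) * \<Phi> (F k)" by auto
    let ?D = "\<lambda>x. 1 * F (Suc k) x + (- 1) * lazy_average h (dir k) (F k) x"
    have D: "V ?D" "\<Phi> ?D = \<Phi> (F (Suc k)) - of_real (q k) * \<Phi> (F k)"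
      using lin[OF VF[of "Suc k"], of "lazy_average h (dir k) (F k)" 1 "- 1"] avg[OF VF[of k], of k] by auto
    have S: "S (Suc k) = (\<lambda>x. 1 * lazy_average h (dir k) (S k) x + \<theta> (Suc k) * ?D x)"
      by (simp add: S_def)
    have "V (S (Suc k))" "\<Phi> (S (Suc k)) = of_real (q k) * \<Phi> (S k) + of_real (\<theta> (Suc k)) * (\<Phi> (F (Suc k)) - of_real (q k) * \<Phi> (F k))"
      unfolding S using lin[of "lazy_average h (dir k) (S k)" ?D 1 "\<theta> (Suc k)"] avg[OF IH(1), of k] D by simp_all
    thus ?case using IH(2) FF[of k] Suc.prems by (simp add: algebra_simps power2_eq_square)
  qed
  from this[of n] show "V (walk_operator h dir \<theta> n f)"
    "\<Phi> (walk_operator h dir \<theta> n f) = of_real (walk_symbol (\<theta> 0) q (\<lambda>k. \<theta> (Suc k)) n) * \<Phi> f"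
    by (simp_all add: walk_operator_def S_def F_def[abs_def])
qed

lemma walk_symbol_one: "(\<And>k. q k = 1) \<Longrightarrow> walk_symbol t q a n = t"
  by (induction n) auto

lemma tendsto_abs_powr: "1 < p \<Longrightarrow> u \<longlonglongrightarrow> v \<Longrightarrow> (\<lambda>l. \<bar>u l :: real\<bar> powr p) \<longlonglongrightarrow> \<bar>v\<bar> powr p"
  by (rule tendsto_powr'[OF tendsto_rabs tendsto_const]) auto

lemma lazy_average_axis:
  "lazy_average h (axis i 1) f = (\<lambda>x. 1 * f x + h * deriv_plus i (deriv_minus i f) x)"
  by (simp add: fun_eq_iff lazy_average_def deriv_plus_deriv_minus algebra_simps)

section \<open>Rounds through the coordinate directions\<close>

definition coord :: "nat \<Rightarrow> 'n::finite" where
  "coord k = (SOME c. bij_betw c {..<CARD('n)} (UNIV :: 'n set)) (k mod CARD('n))"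

lemma bij_coord: "bij_betw (coord :: nat \<Rightarrow> 'n::finite) {..<CARD('n)} UNIV"
proof -
  obtain c where "bij_betw c {0..<CARD('n)} (UNIV :: 'n set)"
    using ex_bij_betw_nat_finite[of "UNIV :: 'n set"] by auto
  hence "\<exists>c. bij_betw c {..<CARD('n)} (UNIV :: 'n set)" by (auto simp: lessThan_atLeast0)
  hence "bij_betw (SOME c. bij_betw c {..<CARD('n)} (UNIV :: 'n set)) {..<CARD('n)} UNIV" by (rule someI_ex)
  thus ?thesis by (rule bij_betw_cong[THEN iffD1, rotated]) (simp add: coord_def)
qed

lemma coord_periodic: "coord (CARD('n) + k) = (coord k :: 'n::finite)"
  by (simp add: coord_def)

lemma sum_coord: "(\<Sum>k<CARD('n). g (coord k :: 'n::finite)) = (\<Sum>i\<in>UNIV. g i)"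
  by (rule sum.reindex_bij_betw[OF bij_coord])

text \<open>Index \<open>0\<close> belongs to the initial value of the martingale, index
  \<open>Suc k\<close> to the step in direction \<open>coord k\<close>.\<close>

definition multipliers :: "real \<Rightarrow> real ^ 'n::finite \<Rightarrow> nat \<Rightarrow> real" where
  "multipliers t \<alpha> k = (case k of 0 \<Rightarrow> t | Suc k \<Rightarrow> \<alpha> $ coord k)"

definition round_symbol :: "real \<Rightarrow> real ^ 'n::finite \<Rightarrow> ('n \<Rightarrow> real) \<Rightarrow> nat \<Rightarrow> real" where
  "round_symbol t \<alpha> \<mu> l =
     walk_symbol t (\<lambda>k. 1 - \<mu> (coord k) / real (l + 8)) (\<lambda>k. \<alpha> $ coord k) (CARD('n) * (l + 8)\<^sup>2)"

definition round_operator ::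
    "real \<Rightarrow> real ^ 'n::finite \<Rightarrow> nat \<Rightarrow> ('g::comm_ring_1 ^ 'n \<Rightarrow> real) \<Rightarrow> 'g ^ 'n \<Rightarrow> real" where
  "round_operator t \<alpha> l =
     walk_operator (1 / real (l + 8)) (\<lambda>k. axis (coord k) 1) (multipliers t \<alpha>) (CARD('n) * (l + 8)\<^sup>2)"

lemma round_symbol_limit:
  fixes \<alpha> :: "real ^ 'n::finite"
  assumes "\<And>i. 0 \<le> \<mu> i" "\<And>i. \<mu> i \<le> 4" "0 < \<mu> j"
  shows "round_symbol t \<alpha> \<mu> \<longlonglongrightarrow> (\<Sum>i\<in>UNIV. \<alpha> $ i * \<mu> i) / (\<Sum>i\<in>UNIV. \<mu> i)"
proof -
  have "j \<in> coord ` {..<CARD('n)}" using bij_betw_imp_surj_on[OF bij_coord[where 'n = 'n]] by simp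
  then obtain k where k: "k < CARD('n)" "coord k = j" by auto
  have "(\<lambda>l. walk_symbol t (\<lambda>k. 1 - \<mu> (coord k) / real (l + 8)) (\<lambda>k. \<alpha> $ coord k) (CARD('n) * (l + 8)\<^sup>2))
    \<longlonglongrightarrow> (\<Sum>k<CARD('n). \<alpha> $ coord k * \<mu> (coord k)) / (\<Sum>k<CARD('n). \<mu> (coord k))"
    by (rule walk_symbol_limit[of "\<lambda>k. \<mu> (coord k)", where j = k]) (use assms k in \<open>simp_all add: coord_periodic\<close>)
  thus ?thesis
    unfolding round_symbol_def[abs_def] sum_coord[of "\<lambda>i. \<alpha> $ i * \<mu> i"] sum_coord[of \<mu>] .
qed

lemma abs_round_symbol_le:
  fixes \<alpha> :: "real ^ 'n::finite"
  assumes "\<And>i. 0 \<le> \<mu> i" "\<And>i. \<mu> i \<le> 4" "\<bar>t\<bar> \<le> m" "\<And>i. \<bar>\<alpha> $ i\<bar> \<le> m"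
  shows "\<bar>round_symbol t \<alpha> \<mu> l\<bar> \<le> m"
  unfolding round_symbol_def
proof (rule abs_walk_symbol_le)
  show "(1 - \<mu> (coord k :: 'n) / real (l + 8))\<^sup>2 \<le> 1" for k
  proof -
    have "\<mu> (coord k :: 'n) / real (l + 8) \<le> 4 / 8" using assms(1,2) by (intro frac_le) auto
    thus ?thesis using assms(1)[of "coord k"] by (intro power_le_one) auto
  qed
qed (use assms in auto)

lemma round_operator_bound:
  fixes f :: "'g::comm_ring_1 ^ 'n::finite \<Rightarrow> real"
  assumes p: "1 < p" and C: "choi_bound TYPE((real \<times> ('g ^ 'n)) list) b B p C" "0 \<le> C"
    and \<alpha>: "t \<in> {b..B}" "\<And>i. \<alpha> $ i \<in> {b..B}" and A: "finite A" "\<And>x. x \<notin> A \<Longrightarrow> f x = 0"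
  shows "(\<Sum>x\<in>A. \<bar>round_operator t \<alpha> l f x\<bar> powr p) \<le> C powr p * (\<Sum>x\<in>A. \<bar>f x\<bar> powr p)"
  unfolding round_operator_def
proof (rule walk_operator_bound[OF p C _ _ _ A])
  show "multipliers t \<alpha> k \<in> {b..B}" for k
    unfolding multipliers_def using \<alpha> by (cases k) simp_all
qed auto

lemma round_operator_limit_bound:
  fixes f :: "'g::comm_ring_1 ^ 'n::finite \<Rightarrow> real"
  assumes "1 < p" "choi_bound TYPE((real \<times> ('g ^ 'n)) list) b B p C" "0 \<le> C"
    and "t \<in> {b..B}" "\<And>i. \<alpha> $ i \<in> {b..B}" "finite A" "\<And>x. x \<notin> A \<Longrightarrow> f x = 0"
    and lim: "\<And>x. (\<lambda>l. round_operator t \<alpha> l f x) \<longlonglongrightarrow> g x"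
  shows "(\<Sum>x\<in>A. \<bar>g x\<bar> powr p) \<le> C powr p * (\<Sum>x\<in>A. \<bar>f x\<bar> powr p)"
proof (rule LIMSEQ_le_const2)
  show "(\<lambda>l. \<Sum>x\<in>A. \<bar>round_operator t \<alpha> l f x\<bar> powr p) \<longlonglongrightarrow> (\<Sum>x\<in>A. \<bar>g x\<bar> powr p)"
    by (intro tendsto_sum tendsto_abs_powr assms)
  show "\<exists>N. \<forall>l\<ge>N. (\<Sum>x\<in>A. \<bar>round_operator t \<alpha> l f x\<bar> powr p) \<le> C powr p * (\<Sum>x\<in>A. \<bar>f x\<bar> powr p)"
    by (intro exI allI impI round_operator_bound[OF assms(1-7)])
qed

section \<open>Fourier multipliers on the finite group\<close>

lemma fourier_cyclic_linear:
  "fourier_cyclic (\<lambda>x. a * f x + c * g x) \<xi> = of_real a * fourier_cyclic f \<xi> + of_real c * fourier_cyclic g \<xi>"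
  by (simp add: fourier_cyclic_def sum_distrib_left sum.distrib algebra_simps)

lemma fourier_cyclic_round_operator:
  fixes f :: "'m::nontriv mod_ring ^ 'n::finite \<Rightarrow> real"
  shows "fourier_cyclic (round_operator t \<alpha> l f) \<xi> =
    of_real (round_symbol t \<alpha> (\<lambda>i. 4 * (sin (pi / CARD('m) * of_int (to_int_mod_ring (\<xi> $ i))))\<^sup>2) l) * fourier_cyclic f \<xi>"
proof -
  let ?\<mu> = "\<lambda>i. 4 * (sin (pi / CARD('m) * of_int (to_int_mod_ring (\<xi> $ i))))\<^sup>2"
  have "fourier_cyclic (round_operator t \<alpha> l f) \<xi> = of_real (walk_symbol (multipliers t \<alpha> 0)
      (\<lambda>k. 1 - ?\<mu> (coord k) / real (l + 8)) (\<lambda>k. multipliers t \<alpha> (Suc k)) (CARD('n) * (l + 8)\<^sup>2)) * fourier_cyclic f \<xi>"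
    unfolding round_operator_def
  proof (rule walk_operator_multiplier(2)[where V = "\<lambda>_. True"])
    fix f :: "'m mod_ring ^ 'n \<Rightarrow> real" and k
    have "fourier_cyclic (lazy_average (1 / real (l + 8)) (axis (coord k) 1) f) \<xi> =
        of_real 1 * fourier_cyclic f \<xi> + of_real (1 / real (l + 8)) * (of_real (- ?\<mu> (coord k)) * fourier_cyclic f \<xi>)"
      unfolding lazy_average_axis fourier_cyclic_linear fourier_cyclic_second_deriv by simp
    also have "\<dots> = of_real (1 - ?\<mu> (coord k) / real (l + 8)) * fourier_cyclic f \<xi>"
      by (simp add: algebra_simps)
    finally show "True \<and> fourier_cyclic (lazy_average (1 / real (l + 8)) (axis (coord k) 1) f) \<xi> =
        of_real (1 - ?\<mu> (coord k) / real (l + 8)) * fourier_cyclic f \<xi>" by simp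
  qed (simp_all add: fourier_cyclic_linear)
  thus ?thesis by (simp add: round_symbol_def multipliers_def)
qed

text \<open>At frequency \<open>0\<close> all averages act as the identity, so the initial
  multiplier survives and contributes \<open>t\<close> times the mean of \<open>f\<close>; at every
  other frequency it is forgotten, and the limit is minus the Riesz symbol.\<close>

lemma round_operator_cyclic_limit:
  fixes f :: "'m::nontriv mod_ring ^ 'n::finite \<Rightarrow> real"
  shows "(\<lambda>l. round_operator t \<alpha> l f x) \<longlonglongrightarrow> t * (\<Sum>k\<in>UNIV. f k) / (CARD('m) ^ CARD('n)) - riesz_cyclic \<alpha> f x"
proof -
  let ?\<mu> = "\<lambda>\<xi> :: 'm mod_ring ^ 'n. \<lambda>i. 4 * (sin (pi / CARD('m) * of_int (to_int_mod_ring (\<xi> $ i))))\<^sup>2"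
  let ?c = "of_nat (CARD('m) ^ CARD('n)) :: complex"
  define L where "L \<xi> = (if \<xi> = 0 then t else 0) - (\<Sum>i\<in>UNIV. \<alpha> $ i * symbol_cyclic i \<xi>)" for \<xi> :: "'m mod_ring ^ 'n"
  have sym: "symbol_cyclic i \<xi> = - ?\<mu> \<xi> i / (\<Sum>i\<in>UNIV. ?\<mu> \<xi> i)" for i and \<xi> :: "'m mod_ring ^ 'n"
    by (simp add: symbol_cyclic_def sum_distrib_left)
  have lim: "round_symbol t \<alpha> (?\<mu> \<xi>) \<longlonglongrightarrow> L \<xi>" for \<xi>
  proof (cases "\<xi> = 0")
    case True
    hence "round_symbol t \<alpha> (?\<mu> \<xi>) l = t" for l unfolding round_symbol_def by (intro walk_symbol_one) simp
    hence e: "round_symbol t \<alpha> (?\<mu> \<xi>) = (\<lambda>_. t)" by (rule ext)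
    have t: "L \<xi> = t" using True by (simp add: L_def symbol_cyclic_def)
    show ?thesis unfolding e t by (rule tendsto_const)
  next
    case False
    have "\<exists>j. ?\<mu> \<xi> j \<noteq> 0"
    proof (rule ccontr)
      assume "\<nexists>j. ?\<mu> \<xi> j \<noteq> 0"
      hence "symbol_cyclic j \<xi> = 0" for j by (simp add: sym)
      thus False using sum_symbol_cyclic[of \<xi>] False by simp
    qed
    then obtain j where "?\<mu> \<xi> j \<noteq> 0" by blast
    hence j: "0 < ?\<mu> \<xi> j" by simp
    have "L \<xi> = (\<Sum>i\<in>UNIV. \<alpha> $ i * ?\<mu> \<xi> i) / (\<Sum>i\<in>UNIV. ?\<mu> \<xi> i)"
      using False by (simp add: L_def sym sum_negf sum_divide_distrib)
    moreover have "round_symbol t \<alpha> (?\<mu> \<xi>) \<longlonglongrightarrow> (\<Sum>i\<in>UNIV. \<alpha> $ i * ?\<mu> \<xi> i) / (\<Sum>i\<in>UNIV. ?\<mu> \<xi> i)"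
      by (rule round_symbol_limit[where \<mu> = "?\<mu> \<xi>" and j = j]) (use j in \<open>auto simp: abs_square_le_1\<close>)
    ultimately show ?thesis by (simp only:)
  qed
  have "round_operator t \<alpha> l f x =
      Re ((\<Sum>\<xi>\<in>UNIV. of_real (round_symbol t \<alpha> (?\<mu> \<xi>) l) * fourier_cyclic f \<xi> * char_cyclic x \<xi>) / ?c)" for l
    using fourier_cyclic_inversion[of "round_operator t \<alpha> l f" x] unfolding fourier_cyclic_round_operator
    by (simp only: Re_complex_of_real)
  moreover have "(\<lambda>l. Re ((\<Sum>\<xi>\<in>UNIV. of_real (round_symbol t \<alpha> (?\<mu> \<xi>) l) * fourier_cyclic f \<xi> * char_cyclic x \<xi>) / ?c))
      \<longlonglongrightarrow> Re ((\<Sum>\<xi>\<in>UNIV. of_real (L \<xi>) * fourier_cyclic f \<xi> * char_cyclic x \<xi>) / ?c)"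
    by (intro tendsto_Re tendsto_divide tendsto_sum tendsto_mult tendsto_of_real lim tendsto_const) simp
  moreover have "Re ((\<Sum>\<xi>\<in>UNIV. of_real (L \<xi>) * fourier_cyclic f \<xi> * char_cyclic x \<xi>) / ?c) =
      t * (\<Sum>k\<in>UNIV. f k) / (CARD('m) ^ CARD('n)) - riesz_cyclic \<alpha> f x"
  proof -
    have L: "of_real (L \<xi>) * fourier_cyclic f \<xi> * char_cyclic x \<xi> =
        (if \<xi> = 0 then of_real t * fourier_cyclic f \<xi> * char_cyclic x \<xi> else 0) -
        (\<Sum>i\<in>UNIV. of_real (\<alpha> $ i) * (of_real (symbol_cyclic i \<xi>) * fourier_cyclic f \<xi> * char_cyclic x \<xi>))" for \<xi>
      by (simp add: L_def left_diff_distrib sum_distrib_right mult.assoc)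
    have f0: "fourier_cyclic f 0 = of_real (\<Sum>k\<in>UNIV. f k)" by (simp add: fourier_cyclic_def)
    have E: "(\<Sum>\<xi>\<in>UNIV. of_real (L \<xi>) * fourier_cyclic f \<xi> * char_cyclic x \<xi>) / ?c =
        of_real t * fourier_cyclic f 0 / ?c -
        (\<Sum>i\<in>UNIV. of_real (\<alpha> $ i) * ((\<Sum>\<xi>\<in>UNIV. of_real (symbol_cyclic i \<xi>) * fourier_cyclic f \<xi> * char_cyclic x \<xi>) / ?c))"
    proof -
      have "(\<Sum>\<xi>\<in>UNIV. \<Sum>i\<in>UNIV. of_real (\<alpha> $ i) * (of_real (symbol_cyclic i \<xi>) * fourier_cyclic f \<xi> * char_cyclic x \<xi>)) =
        (\<Sum>i\<in>UNIV. of_real (\<alpha> $ i) * (\<Sum>\<xi>\<in>UNIV. of_real (symbol_cyclic i \<xi>) * fourier_cyclic f \<xi> * char_cyclic x \<xi>))"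
        unfolding sum_distrib_left by (rule sum.swap)
      thus ?thesis unfolding L sum_subtractf by (simp add: diff_divide_distrib sum_divide_distrib sum_distrib_left)
    qed
    have rm: "Re (of_real r * z) = r * Re z" for r z by simp
    have "of_real t * of_real (\<Sum>k\<in>UNIV. f k) / ?c = of_real (t * (\<Sum>k\<in>UNIV. f k) / real (CARD('m) ^ CARD('n)))"
      by simp
    hence t0: "Re (of_real t * fourier_cyclic f 0 / ?c) = t * (\<Sum>k\<in>UNIV. f k) / real (CARD('m) ^ CARD('n))"
      by (simp only: f0 Re_complex_of_real)
    show ?thesis
      unfolding E minus_complex.sel Re_sum rm t0 riesz_cyclic_def riesz2_cyclic_def by simp
  qed
  ultimately show ?thesis by (simp only:)
qed

section \<open>Fourier multipliers on the integer lattice\<close>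

lemma fourier_int_linear:
  assumes f: "finsupp f" and g: "finsupp g"
  shows "fourier_int (\<lambda>n. a * f n + c * g n) \<xi> = of_real a * fourier_int f \<xi> + of_real c * fourier_int g \<xi>"
proof -
  let ?S = "{n. f n \<noteq> 0} \<union> {n. g n \<noteq> 0}"
  have S: "finite ?S" using f g by (simp add: finsupp_def)
  have "fourier_int (\<lambda>n. a * f n + c * g n) \<xi> = (\<Sum>n\<in>?S. of_real (a * f n + c * g n) * cnj (char_int n \<xi>))"
    by (rule fourier_int_superset[OF S]) auto
  moreover have "fourier_int f \<xi> = (\<Sum>n\<in>?S. of_real (f n) * cnj (char_int n \<xi>))"
    by (rule fourier_int_superset[OF S]) auto
  moreover have "fourier_int g \<xi> = (\<Sum>n\<in>?S. of_real (g n) * cnj (char_int n \<xi>))"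
    by (rule fourier_int_superset[OF S]) auto
  ultimately show ?thesis by (simp add: sum_distrib_left sum.distrib algebra_simps)
qed

lemma continuous_on_char_int: "continuous_on UNIV (\<lambda>\<xi>. char_int n \<xi>)"
  unfolding char_int_def by (intro continuous_intros)

lemma continuous_on_fourier_int: "continuous_on UNIV (fourier_int f)"
  unfolding fourier_int_def[abs_def]
  by (intro continuous_on_sum continuous_on_mult continuous_on_const continuous_on_cnj continuous_on_char_int)

lemma norm_char_int [simp]: "norm (char_int n \<xi>) = 1"
  by (simp add: char_int_def)

lemma norm_fourier_int_le: "norm (fourier_int f \<xi>) \<le> (\<Sum>n | f n \<noteq> 0. \<bar>f n\<bar>)"
  unfolding fourier_int_def by (rule order_trans[OF norm_sum]) (simp add: norm_mult)

lemma integrable_cube_const: "integrable lborel (\<lambda>\<xi>. indicator (cube :: (real ^ 'n::finite) set) \<xi> *\<^sub>R (c :: real))"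
  by (intro borel_integrable_compact continuous_on_const compact_cbox)

definition multiplier_int :: "(real ^ 'n::finite \<Rightarrow> real) \<Rightarrow> (int ^ 'n \<Rightarrow> real) \<Rightarrow> int ^ 'n \<Rightarrow> real ^ 'n \<Rightarrow> complex" where
  "multiplier_int g f n \<xi> = indicator cube \<xi> *\<^sub>R (of_real (g \<xi>) * fourier_int f \<xi> * char_int n \<xi>)"

lemma multiplier_int_measurable:
  assumes [measurable]: "g \<in> borel_measurable borel"
  shows "multiplier_int g f n \<in> borel_measurable lborel"
proof -
  have [measurable]: "fourier_int f \<in> borel_measurable borel" "char_int n \<in> borel_measurable borel"
    by (intro borel_measurable_continuous_onI continuous_on_fourier_int continuous_on_char_int)+
  show ?thesis unfolding multiplier_int_def[abs_def] by measurable
qed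

lemma norm_multiplier_int_le:
  assumes "\<bar>g \<xi>\<bar> \<le> m"
  shows "norm (multiplier_int g f n \<xi>) \<le> indicator cube \<xi> *\<^sub>R (m * (\<Sum>n | f n \<noteq> 0. \<bar>f n\<bar>))"
proof -
  have "\<bar>g \<xi>\<bar> * norm (fourier_int f \<xi>) \<le> m * (\<Sum>n | f n \<noteq> 0. \<bar>f n\<bar>)"
    using assms by (intro mult_mono norm_fourier_int_le) auto
  thus ?thesis by (simp add: multiplier_int_def norm_mult indicator_def)
qed

lemma integrable_multiplier_int:
  fixes g :: "real ^ 'n::finite \<Rightarrow> real"
  assumes "g \<in> borel_measurable borel" "\<And>\<xi>. \<bar>g \<xi>\<bar> \<le> m"
  shows "integrable lborel (multiplier_int g f n)"
proof (rule Bochner_Integration.integrable_bound[OF integrable_cube_const multiplier_int_measurable[OF assms(1)]])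
  show "AE \<xi> in lborel. norm (multiplier_int g f n \<xi>) \<le> norm (indicator (cube :: (real ^ 'n) set) \<xi> *\<^sub>R (m * (\<Sum>n | f n \<noteq> 0. \<bar>f n\<bar>)))"
    by (intro AE_I2 order_trans[OF norm_multiplier_int_le[OF assms(2)]]) (simp only: real_norm_def abs_ge_self)
qed

lemma measurable_symbol_int: "symbol_int j \<in> borel_measurable borel"
proof -
  have [measurable]: "(\<lambda>\<xi> :: real ^ 'n. \<xi> $ i) \<in> borel_measurable borel" for i
    by (intro borel_measurable_continuous_onI continuous_intros)
  have [measurable]: "(\<lambda>\<xi> :: real ^ 'n. sin (pi * \<xi> $ i)) \<in> borel_measurable borel" for i
    by (intro borel_measurable_continuous_onI continuous_intros)
  show ?thesis unfolding symbol_int_def[abs_def] by measurable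
qed

lemma abs_symbol_int_le: "\<bar>symbol_int j \<xi>\<bar> \<le> 1"
proof -
  let ?s = "\<lambda>i. (sin (pi * \<xi> $ i))\<^sup>2"
  have "?s j \<le> (\<Sum>i\<in>UNIV. ?s i)" by (rule member_le_sum[of j UNIV ?s]) auto
  moreover have "0 \<le> ?s j" by simp
  ultimately show ?thesis unfolding symbol_int_def
    by (cases "(\<Sum>i\<in>UNIV. ?s i) = 0") (auto simp: abs_mult field_simps)
qed

lemma riesz2_int_eq: "riesz2_int j f n = Re (\<integral>\<xi>. multiplier_int (symbol_int j) f n \<xi> \<partial>lborel)"
  unfolding riesz2_int_def multiplier_int_def set_lebesgue_integral_def ..

definition riesz_finite :: "real ^ 'n::finite \<Rightarrow> (int ^ 'n \<Rightarrow> real) \<Rightarrow> int ^ 'n \<Rightarrow> real" where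
  "riesz_finite \<alpha> f n = (\<Sum>i\<in>UNIV. \<alpha> $ i * riesz2_int i f n)"

lemma riesz2_int_linear:
  assumes "finsupp f" "finsupp g"
  shows "riesz2_int j (\<lambda>n. a * f n + c * g n) n = a * riesz2_int j f n + c * riesz2_int j g n"
proof -
  have int: "integrable lborel (multiplier_int (symbol_int j) f n)" for f
    by (rule integrable_multiplier_int[OF measurable_symbol_int abs_symbol_int_le])
  have e: "multiplier_int (symbol_int j) (\<lambda>n. a * f n + c * g n) n = (\<lambda>\<xi>.
      of_real a * multiplier_int (symbol_int j) f n \<xi> + of_real c * multiplier_int (symbol_int j) g n \<xi>)"
    by (simp add: fun_eq_iff multiplier_int_def fourier_int_linear[OF assms] scaleR_conv_of_real algebra_simps)
  show ?thesis unfolding riesz2_int_eq e using int by simp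
qed

lemma fourier_int_round_operator:
  fixes f :: "int ^ 'n::finite \<Rightarrow> real"
  assumes f: "finsupp f"
  shows "finsupp (round_operator t \<alpha> l f)"
    "fourier_int (round_operator t \<alpha> l f) \<xi> =
       of_real (round_symbol t \<alpha> (\<lambda>i. 4 * (sin (pi * \<xi> $ i))\<^sup>2) l) * fourier_int f \<xi>"
proof -
  let ?\<mu> = "\<lambda>i. 4 * (sin (pi * \<xi> $ i))\<^sup>2"
  have avg: "finsupp (lazy_average (1 / real (l + 8)) (axis (coord k) 1) f) \<and>
      fourier_int (lazy_average (1 / real (l + 8)) (axis (coord k) 1) f) \<xi> =
        of_real (1 - ?\<mu> (coord k) / real (l + 8)) * fourier_int f \<xi>" if f: "finsupp f" for f :: "int ^ 'n \<Rightarrow> real" and k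
  proof
    show "finsupp (lazy_average (1 / real (l + 8)) (axis (coord k) 1) f)"
      unfolding lazy_average_axis by (intro finsupp_linear finsupp_second_deriv f)
    have "fourier_int (lazy_average (1 / real (l + 8)) (axis (coord k) 1) f) \<xi> =
        of_real 1 * fourier_int f \<xi> + of_real (1 / real (l + 8)) * (of_real (- ?\<mu> (coord k)) * fourier_int f \<xi>)"
      unfolding lazy_average_axis fourier_int_linear[OF f finsupp_second_deriv[OF f]] fourier_int_second_deriv[OF f] by simp
    also have "\<dots> = of_real (1 - ?\<mu> (coord k) / real (l + 8)) * fourier_int f \<xi>"
      by (simp add: algebra_simps)
    finally show "fourier_int (lazy_average (1 / real (l + 8)) (axis (coord k) 1) f) \<xi> =
        of_real (1 - ?\<mu> (coord k) / real (l + 8)) * fourier_int f \<xi>" .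
  qed
  note m = walk_operator_multiplier[of finsupp "\<lambda>f. fourier_int f \<xi>" "1 / real (l + 8)" "\<lambda>k. axis (coord k :: 'n) 1",
      OF conjI[OF finsupp_linear fourier_int_linear] avg f]
  show "finsupp (round_operator t \<alpha> l f)" unfolding round_operator_def by (rule m(1))
  show "fourier_int (round_operator t \<alpha> l f) \<xi> = of_real (round_symbol t \<alpha> ?\<mu> l) * fourier_int f \<xi>"
  proof -
    have "round_symbol t \<alpha> ?\<mu> l = walk_symbol (multipliers t \<alpha> 0) (\<lambda>k. 1 - ?\<mu> (coord k) / real (l + 8))
        (\<lambda>k. multipliers t \<alpha> (Suc k)) (CARD('n) * (l + 8)\<^sup>2)"
      by (simp add: round_symbol_def multipliers_def)
    thus ?thesis unfolding round_operator_def by (simp only:) (rule m(2))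
  qed
qed

text \<open>Dominated convergence over the cube. The symbols converge to the Riesz quotient except
  at \<open>\<xi> = 0\<close>, a null set, so the initial multiplier \<open>t\<close> leaves no
  trace.\<close>

lemma round_operator_int_limit:
  fixes f :: "int ^ 'n::finite \<Rightarrow> real"
  assumes f: "finsupp f"
  shows "(\<lambda>l. round_operator t \<alpha> l f n) \<longlonglongrightarrow> - riesz_finite \<alpha> f n"
proof -
  define \<mu> where "\<mu> \<xi> i = 4 * (sin (pi * \<xi> $ i))\<^sup>2" for \<xi> :: "real ^ 'n" and i
  \<comment> \<open>A common bound for all multipliers, hence for the symbols uniformly in
    \<open>\<xi>\<close> and \<open>l\<close>.\<close>
  define m where "m = \<bar>t\<bar> + (\<Sum>i\<in>UNIV. \<bar>\<alpha> $ i\<bar>)"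
  define s where "s l = multiplier_int (\<lambda>\<xi>. round_symbol t \<alpha> (\<mu> \<xi>) l) f n" for l
  define L where "L \<xi> = - (\<Sum>i\<in>UNIV. \<alpha> $ i * symbol_int i \<xi>)" for \<xi> :: "real ^ 'n"
  have \<mu>: "0 \<le> \<mu> \<xi> i" "\<mu> \<xi> i \<le> 4" for \<xi> i by (auto simp: \<mu>_def abs_square_le_1)
  have m: "\<bar>t\<bar> \<le> m" "\<bar>\<alpha> $ i\<bar> \<le> m" for i
    unfolding m_def using member_le_sum[of i UNIV "\<lambda>i. \<bar>\<alpha> $ i\<bar>"] sum_nonneg[of UNIV "\<lambda>i. \<bar>\<alpha> $ i\<bar>"]
    by (auto intro: add_increasing2 add_increasing)
  have "continuous_on UNIV (\<lambda>\<xi>. walk_symbol t (\<lambda>k. 1 - \<mu> \<xi> (coord k) / real (l + 8)) (\<lambda>k. \<alpha> $ coord k) k)" for l k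
  proof (induction k)
    case (Suc k)
    have c: "continuous_on UNIV (\<lambda>\<xi>. 1 - \<mu> \<xi> (coord k) / real (l + 8))"
      unfolding \<mu>_def divide_inverse by (intro continuous_intros)
    show ?case
      unfolding walk_symbol.simps
      by (rule continuous_on_add[OF continuous_on_mult[OF continuous_on_power[OF c] Suc]
            continuous_on_mult[OF continuous_on_const continuous_on_diff[OF continuous_on_const continuous_on_power[OF c]]]])
  qed simp
  hence meas: "(\<lambda>\<xi>. round_symbol t \<alpha> (\<mu> \<xi>) l) \<in> borel_measurable borel" for l
    unfolding round_symbol_def by (intro borel_measurable_continuous_onI)
  have Lm: "L \<in> borel_measurable borel"
    unfolding L_def[abs_def] using measurable_symbol_int
    by (intro borel_measurable_uminus borel_measurable_sum borel_measurable_times borel_measurable_const)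
  have "(\<lambda>l. \<integral>\<xi>. s l \<xi> \<partial>lborel) \<longlonglongrightarrow> (\<integral>\<xi>. multiplier_int L f n \<xi> \<partial>lborel)"
  proof (rule integral_dominated_convergence)
    show "multiplier_int L f n \<in> borel_measurable lborel" by (rule multiplier_int_measurable[OF Lm])
    show "s l \<in> borel_measurable lborel" for l unfolding s_def by (rule multiplier_int_measurable[OF meas])
    show "integrable lborel (\<lambda>\<xi>. indicator (cube :: (real ^ 'n) set) \<xi> *\<^sub>R (m * (\<Sum>n | f n \<noteq> 0. \<bar>f n\<bar>)))"
      by (rule integrable_cube_const)
    show "AE \<xi> in lborel. norm (s l \<xi>) \<le> indicator (cube :: (real ^ 'n) set) \<xi> *\<^sub>R (m * (\<Sum>n | f n \<noteq> 0. \<bar>f n\<bar>))" for l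
      unfolding s_def by (intro AE_I2 norm_multiplier_int_le abs_round_symbol_le \<mu> m)
    \<comment> \<open>On the cube \<open>|pi * \<xi> $ j|\<close> stays below \<open>pi\<close>, so
      a nonzero coordinate has a nonzero sine.\<close>
    have pt: "(\<lambda>l. s l \<xi>) \<longlonglongrightarrow> multiplier_int L f n \<xi>" if "\<xi> \<noteq> 0" for \<xi>
    proof (cases "\<xi> \<in> cube")
      case True
      have "\<exists>j. \<xi> $ j \<noteq> 0" using that by (simp add: vec_eq_iff)
      then obtain j where j: "\<xi> $ j \<noteq> 0" by blast
      have "\<forall>i. - (1 / 2) \<le> \<xi> $ i \<and> \<xi> $ i \<le> 1 / 2" using True by (simp add: mem_box_cart)
      hence "- (1 / 2) \<le> \<xi> $ j" "\<xi> $ j \<le> 1 / 2" by blast+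
      hence "\<bar>\<xi> $ j\<bar> \<le> 1 / 2" by linarith
      hence "\<bar>pi * \<xi> $ j\<bar> < pi" using mult_left_mono[of "\<bar>\<xi> $ j\<bar>" "1 / 2" pi] by (simp add: abs_mult) 
      hence "sin (pi * \<xi> $ j) \<noteq> 0" using j sin_zero_pi_iff[of "pi * \<xi> $ j"] by simp
      hence "0 < \<mu> \<xi> j" by (simp add: \<mu>_def)
      hence "round_symbol t \<alpha> (\<mu> \<xi>) \<longlonglongrightarrow> (\<Sum>i\<in>UNIV. \<alpha> $ i * \<mu> \<xi> i) / (\<Sum>i\<in>UNIV. \<mu> \<xi> i)"
        by (intro round_symbol_limit[where j = j] \<mu>)
      also have "(\<Sum>i\<in>UNIV. \<alpha> $ i * \<mu> \<xi> i) / (\<Sum>i\<in>UNIV. \<mu> \<xi> i) = L \<xi>"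
        by (simp add: L_def symbol_int_def \<mu>_def sum_negf sum_distrib_left sum_divide_distrib)
      finally show ?thesis
        unfolding s_def multiplier_int_def by (intro tendsto_scaleR tendsto_mult tendsto_of_real tendsto_const)
    qed (simp add: s_def multiplier_int_def)
    show "AE \<xi> in lborel. (\<lambda>l. s l \<xi>) \<longlonglongrightarrow> multiplier_int L f n \<xi>"
      by (rule AE_mp[OF AE_lborel_singleton[of "0 :: real ^ 'n"] AE_I2]) (intro impI pt)
  qed
  hence "(\<lambda>l. Re (\<integral>\<xi>. s l \<xi> \<partial>lborel)) \<longlonglongrightarrow> Re (\<integral>\<xi>. multiplier_int L f n \<xi> \<partial>lborel)"
    by (rule tendsto_Re)
  moreover have "Re (\<integral>\<xi>. s l \<xi> \<partial>lborel) = round_operator t \<alpha> l f n" for l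
  proof -
    have "(\<integral>\<xi>. s l \<xi> \<partial>lborel) = (LINT \<xi> : cube | lborel. fourier_int (round_operator t \<alpha> l f) \<xi> * char_int n \<xi>)"
      unfolding s_def multiplier_int_def set_lebesgue_integral_def fourier_int_round_operator(2)[OF f] \<mu>_def ..
    thus ?thesis by (simp only: fourier_int_inversion[OF fourier_int_round_operator(1)[OF f]] Re_complex_of_real)
  qed
  moreover have "Re (\<integral>\<xi>. multiplier_int L f n \<xi> \<partial>lborel) = - riesz_finite \<alpha> f n"
  proof -
    have int: "integrable lborel (multiplier_int (symbol_int i) f n)" for i
      by (rule integrable_multiplier_int[OF measurable_symbol_int abs_symbol_int_le])
    have e: "multiplier_int L f n \<xi> = - (\<Sum>i\<in>UNIV. of_real (\<alpha> $ i) * multiplier_int (symbol_int i) f n \<xi>)" for \<xi>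
      by (simp add: multiplier_int_def L_def scaleR_conv_of_real sum_distrib_left sum_distrib_right mult_ac sum_negf)
    have "(\<integral>\<xi>. multiplier_int L f n \<xi> \<partial>lborel) =
        - (\<Sum>i\<in>UNIV. of_real (\<alpha> $ i) * (\<integral>\<xi>. multiplier_int (symbol_int i) f n \<xi> \<partial>lborel))"
      unfolding e using int by simp
    thus ?thesis by (simp add: riesz_finite_def riesz2_int_eq)
  qed
  ultimately show ?thesis by simp
qed

section \<open>Norm of the Riesz transforms\<close>

lemma riesz_finite_bound:
  fixes \<alpha> :: "real ^ 'n::finite"
  assumes p: "1 < p" and \<alpha>: "\<And>i. \<alpha> $ i \<in> {b..B}" and f: "finsupp f"
  shows "riesz_finite \<alpha> f \<in> lp p" "lp_norm p (riesz_finite \<alpha> f) \<le> choi_const b B p * lp_norm p f"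
proof -
  let ?C = "choi_const b B p"
  have C: "choi_bound TYPE((real \<times> (int ^ 'n)) list) b B p ?C" "0 \<le> ?C"
    by (rule choi_bound_choi_const[OF p] choi_const_nonneg[OF p])+
  \<comment> \<open>The initial multiplier is taken to be \<open>b\<close>; its value does not
    affect the limit on the integer lattice.\<close>
  have bB: "b \<in> {b..B}" using \<alpha>[of undefined] by simp
  define S where "S = {n. f n \<noteq> 0}"
  have S: "finite S" using f by (simp add: finsupp_def S_def)
  have sums: "(\<Sum>n\<in>A. \<bar>riesz_finite \<alpha> f n\<bar> powr p) \<le> ?C powr p * (\<integral>n. \<bar>f n\<bar> powr p \<partial>count_space UNIV)" if "finite A" for A
  proof -
    \<comment> \<open>The estimate for the walk holds on finite sets that contain the support of
      \<open>f\<close>, hence the union with \<open>S\<close>.\<close>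
    have "(\<Sum>n\<in>A. \<bar>riesz_finite \<alpha> f n\<bar> powr p) \<le> (\<Sum>n\<in>A \<union> S. \<bar>- riesz_finite \<alpha> f n\<bar> powr p)"
      using that S by (simp add: sum_mono2)
    also have "\<dots> \<le> ?C powr p * (\<Sum>n\<in>A \<union> S. \<bar>f n\<bar> powr p)"
      by (rule round_operator_limit_bound[OF p C bB \<alpha> _ _ round_operator_int_limit[OF f]])
        (use that S in \<open>auto simp: S_def\<close>)
    also have "(\<Sum>n\<in>A \<union> S. \<bar>f n\<bar> powr p) = (\<integral>n. \<bar>f n\<bar> powr p \<partial>count_space UNIV)"
      using that S by (subst lp_finite_support(2)[of "A \<union> S"]) (auto simp: S_def)
    finally show ?thesis .
  qed
  show "riesz_finite \<alpha> f \<in> lp p" by (rule lp_of_finite_sums(1)[OF sums])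
  show "lp_norm p (riesz_finite \<alpha> f) \<le> ?C * lp_norm p f"
    using lp_of_finite_sums(2)[OF sums] p C(2) by (subst Lp_norm_le_iff) auto
qed

lemma riesz_finite_linear:
  "finsupp f \<Longrightarrow> finsupp g \<Longrightarrow>
    riesz_finite \<alpha> (\<lambda>n. a * f n + c * g n) = (\<lambda>n. a * riesz_finite \<alpha> f n + c * riesz_finite \<alpha> g n)"
  by (simp add: fun_eq_iff riesz_finite_def riesz2_int_linear sum_distrib_left sum.distrib algebra_simps)

lemma riesz_int_eq: "riesz_int p \<alpha> = lp_extension p (riesz_finite \<alpha>)"
  unfolding riesz_int_def riesz_finite_def[abs_def] ..

lemma riesz_finite_laplacian:
  "finsupp u \<Longrightarrow> riesz_finite \<alpha> (\<lambda>n. - laplacian u n) n = (\<Sum>i\<in>UNIV. \<alpha> $ i * deriv_plus i (deriv_minus i u) n)"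
  by (simp add: riesz_finite_def riesz2_int_laplacian)

lemma finsupp_laplacian:
  fixes u :: "'g::comm_ring_1 ^ 'n::finite \<Rightarrow> real"
  assumes "finsupp u"
  shows "finsupp (laplacian u)"
proof -
  have "{n. laplacian u n \<noteq> 0} \<subseteq> (\<Union>l. {n. deriv_plus l (deriv_minus l u) n \<noteq> 0})"
    unfolding laplacian_def by (auto intro: ccontr)
  moreover have "finite (\<Union>l. {n. deriv_plus l (deriv_minus l u) n \<noteq> 0})"
    using finsupp_second_deriv[OF assms] by (simp add: finsupp_def)
  ultimately show ?thesis unfolding finsupp_def by (rule finite_subset)
qed

section \<open>Operator norms and sharpness\<close>

lemma divide_le_of_le_mult: "0 \<le> C \<Longrightarrow> 0 \<le> y \<Longrightarrow> x \<le> C * y \<Longrightarrow> x / y \<le> C" for x y C :: real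
  by (cases "y = 0") (auto simp: pos_divide_le_eq)

lemma lp_onorm_le:
  assumes "V \<noteq> {}" "0 \<le> C" "\<And>f. f \<in> V \<Longrightarrow> lp_norm p (T f) \<le> C * lp_norm p f"
  shows "lp_onorm V p T \<le> C"
  unfolding lp_onorm_def
proof (rule cSUP_least[OF assms(1)])
  fix f assume "f \<in> V"
  thus "lp_norm p (T f) / lp_norm p f \<le> C"
    by (intro divide_le_of_le_mult assms(2,3) Lp_norm_nonneg)
qed

lemma le_lp_onorm:
  assumes C: "0 \<le> C" "\<And>f. f \<in> V \<Longrightarrow> lp_norm p (T f) \<le> C * lp_norm p f" and f: "f \<in> V"
  shows "0 \<le> lp_onorm V p T" "lp_norm p (T f) \<le> lp_onorm V p T * lp_norm p f"
proof -
  have bdd: "bdd_above ((\<lambda>f. lp_norm p (T f) / lp_norm p f) ` V)"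
  proof (rule bdd_aboveI2)
    fix f assume "f \<in> V"
    thus "lp_norm p (T f) / lp_norm p f \<le> C"
      by (intro divide_le_of_le_mult C Lp_norm_nonneg)
  qed
  have le: "lp_norm p (T f) / lp_norm p f \<le> lp_onorm V p T"
    unfolding lp_onorm_def by (rule cSUP_upper[OF f bdd])
  show "0 \<le> lp_onorm V p T"
    using le divide_nonneg_nonneg[OF Lp_norm_nonneg[of p "count_space UNIV" "T f"] Lp_norm_nonneg[of p "count_space UNIV" f]]
    by linarith
  show "lp_norm p (T f) \<le> lp_onorm V p T * lp_norm p f"
  proof (cases "lp_norm p f = 0")
    case True
    thus ?thesis using C(2)[OF f] by simp
  next
    case False
    hence "0 < lp_norm p f" using Lp_norm_nonneg[of p "count_space UNIV" f] by linarith
    thus ?thesis using le by (simp add: divide_le_eq)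
  qed
qed

lemma choi_bound_const: "0 < p \<Longrightarrow> choi_bound TYPE('a) b b p \<bar>b\<bar>"
  unfolding choi_bound_def
proof (intro allI impI)
  fix n :: nat and M :: "'a measure" and F d \<theta>
  assume p: "0 < p" and m: "martingale_transform M F d \<theta> b b p"
  have "(\<integral>x. \<bar>\<Sum>k=1..n. \<theta> k x * d k x\<bar> powr p \<partial>M) = (\<integral>x. \<bar>b * (\<Sum>k=1..n. d k x)\<bar> powr p \<partial>M)"
  proof (intro Bochner_Integration.integral_cong refl)
    fix x assume x: "x \<in> space M"
    have "(\<Sum>k=1..n. \<theta> k x * d k x) = b * (\<Sum>k=1..n. d k x)"
      unfolding sum_distrib_left using m x by (intro sum.cong refl) (auto simp: martingale_transform_def)
    thus "\<bar>\<Sum>k=1..n. \<theta> k x * d k x\<bar> powr p = \<bar>b * (\<Sum>k=1..n. d k x)\<bar> powr p" by simp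
  qed
  thus "Lp_norm p M (\<lambda>x. \<Sum>k=1..n. \<theta> k x * d k x) \<le> \<bar>b\<bar> * Lp_norm p M (\<lambda>x. \<Sum>k=1..n. d k x)"
    unfolding Lp_norm_cmult[OF p, symmetric] by (simp add: Lp_norm_def)
qed

text \<open>If \<open>b = B\<close>, then \<open>i\<close> and \<open>j\<close> may coincide and
  there is no plane of two directions; the sum of second differences is then \<open>b\<close> times
  the Laplacian, and one function with nonzero Laplacian gives \<open>|b| \<le> K\<close>. Otherwise
  the hypothesis on \<open>u\<close> makes all attainable averages at the origin
  nonpositive.\<close>

lemma choi_const_le_of_lattice:
  fixes \<alpha> :: "real ^ 'n::finite"
  assumes p: "1 < p" and K: "0 \<le> K" and i: "\<alpha> $ i = b" and j: "\<alpha> $ j = B" and "b = B \<Longrightarrow> \<forall>l. \<alpha> $ l = b"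
    and op: "\<And>u :: int ^ 'n \<Rightarrow> real. finsupp u \<Longrightarrow>
        lp_norm p (\<lambda>n. \<Sum>l\<in>UNIV. \<alpha> $ l * deriv_plus l (deriv_minus l u) n) \<le> K * lp_norm p (laplacian u)"
  shows "choi_const b B p \<le> K"
proof (cases "b = B")
  case True
  define u :: "int ^ 'n \<Rightarrow> real" where "u n = (if n = 0 then 1 else 0)" for n
  have fin: "finsupp u" unfolding finsupp_def u_def by simp
  have "laplacian u 0 = - 2 * real CARD('n)"
  proof -
    have "axis l (1 :: int) \<noteq> 0" "- axis l (1 :: int) \<noteq> 0" for l :: 'n by (auto simp: axis_eq_0_iff)
    hence "deriv_plus l (deriv_minus l u) 0 = - 2" for l by (simp add: deriv_plus_deriv_minus u_def)
    thus ?thesis by (simp add: laplacian_def)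
  qed
  hence nz: "laplacian u 0 \<noteq> 0" by simp
  have "laplacian u \<in> lp p" by (rule finsupp_lp[OF finsupp_laplacian[OF fin]])
  hence pos: "0 < lp_norm p (laplacian u)" using abs_le_lp_norm[of p "laplacian u" 0] nz p by auto
  have "(\<lambda>n. \<Sum>l\<in>UNIV. \<alpha> $ l * deriv_plus l (deriv_minus l u) n) = (\<lambda>n. b * laplacian u n)"
    using assms(5) True by (simp add: laplacian_def sum_distrib_left)
  hence "\<bar>b\<bar> * lp_norm p (laplacian u) \<le> K * lp_norm p (laplacian u)"
    using op[OF fin] p by (simp add: Lp_norm_cmult)
  hence "\<bar>b\<bar> \<le> K" using pos by simp
  thus ?thesis using choi_const_le[OF choi_bound_const[of p b]] p True by simp
next
  case False
  hence ij: "i \<noteq> j" using i j by auto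
  have "choi_bound TYPE(nat \<Rightarrow> real) b B p K"
  proof (rule choi_bound_of_attainable[OF p K])
    fix a assume "a \<in> attainable (\<lambda>r s. \<bar>b * r + B * s\<bar> powr p - K powr p * \<bar>r + s\<bar> powr p) 0 0"
    thus "a \<le> 0"
      unfolding i[symmetric] j[symmetric]
    proof (rule attainable_nonpos_of_lattice[OF ij, rotated 2])
      fix u :: "int ^ 'n \<Rightarrow> real" and S
      assume S: "finite S" "{n. u n \<noteq> 0} \<subseteq> S" and D: "\<And>n l. n \<notin> S \<Longrightarrow> deriv_plus l (deriv_minus l u) n = 0"
      have "finsupp u" unfolding finsupp_def by (rule finite_subset[OF S(2,1)])
      note op[OF this]
      thus "(\<Sum>n\<in>S. \<bar>\<Sum>l\<in>UNIV. \<alpha> $ l * deriv_plus l (deriv_minus l u) n\<bar> powr p) \<le> K powr p * (\<Sum>n\<in>S. \<bar>laplacian u n\<bar> powr p)"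
        using p K S(1) by (subst (asm) Lp_norm_le_iff) (auto simp: lp_finite_support(2)[of S] laplacian_def D)
    qed (use p in simp)
  qed
  thus ?thesis by (rule choi_const_le)
qed

section \<open>Bounds on the finite group\<close>

lemma lp_finite: "(f :: 'a::finite \<Rightarrow> real) \<in> lp p"
  by (rule lp_finite_support(1)[of UNIV]) auto

text \<open>The second condition on \<open>t\<close> removes the term at frequency \<open>0\<close>
  from the limit of the walk operators. It holds with \<open>t = 0\<close> if \<open>0\<close> lies
  in \<open>[b, B]\<close>, and with every \<open>t\<close> if \<open>f\<close> has mean
  zero.\<close>

lemma riesz_cyclic_bound:
  fixes f :: "'m::nontriv mod_ring ^ 'n::finite \<Rightarrow> real"
  assumes p: "1 < p" and \<alpha>: "\<And>i. \<alpha> $ i \<in> {b..B}" and t: "t \<in> {b..B}" "t * (\<Sum>k\<in>UNIV. f k) = 0"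
  shows "lp_norm p (riesz_cyclic \<alpha> f) \<le> choi_const b B p * lp_norm p f"
proof -
  let ?C = "choi_const b B p"
  have C: "choi_bound TYPE((real \<times> ('m mod_ring ^ 'n)) list) b B p ?C" "0 \<le> ?C"
    by (rule choi_bound_choi_const[OF p] choi_const_nonneg[OF p])+
  have lim: "(\<lambda>l. round_operator t \<alpha> l f x) \<longlonglongrightarrow> - riesz_cyclic \<alpha> f x" for x
    using round_operator_cyclic_limit[of t \<alpha> f x] by (simp add: t(2))
  have "(\<Sum>x\<in>UNIV. \<bar>- riesz_cyclic \<alpha> f x\<bar> powr p) \<le> ?C powr p * (\<Sum>x\<in>UNIV. \<bar>f x\<bar> powr p)"
    by (rule round_operator_limit_bound[OF p C t(1) \<alpha> _ _ lim]) auto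
  moreover have "(\<Sum>x\<in>UNIV. \<bar>g x\<bar> powr p) = (\<integral>x. \<bar>g x\<bar> powr p \<partial>count_space UNIV)" for g :: "'m mod_ring ^ 'n \<Rightarrow> real"
    by (rule lp_finite_support(2)[symmetric]) auto
  ultimately show ?thesis using p C(2) by (subst Lp_norm_le_iff) auto
qed

lemma riesz_cyclic_linear:
  fixes f :: "'m::nontriv mod_ring ^ 'n::finite \<Rightarrow> real"
  shows "riesz_cyclic \<alpha> (\<lambda>x. a * f x + c * g x) = (\<lambda>x. a * riesz_cyclic \<alpha> f x + c * riesz_cyclic \<alpha> g x)"
proof
  fix x
  let ?M = "of_nat (CARD('m) ^ CARD('n)) :: complex"
  have "riesz2_cyclic i (\<lambda>x. a * f x + c * g x) x = a * riesz2_cyclic i f x + c * riesz2_cyclic i g x" for i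
  proof -
    let ?S = "\<lambda>f. \<Sum>\<xi>\<in>UNIV. of_real (symbol_cyclic i \<xi>) * fourier_cyclic f \<xi> * char_cyclic x \<xi>"
    have "?S (\<lambda>x. a * f x + c * g x) = of_real a * ?S f + of_real c * ?S g"
      by (simp add: fourier_cyclic_linear sum_distrib_left sum.distrib algebra_simps)
    hence "?S (\<lambda>x. a * f x + c * g x) / ?M = of_real a * (?S f / ?M) + of_real c * (?S g / ?M)"
      by (simp only: add_divide_distrib times_divide_eq_right)
    moreover have "Re (of_real a * z + of_real c * w) = a * Re z + c * Re w" for z w by simp
    ultimately show ?thesis by (simp only: riesz2_cyclic_def)
  qed
  thus "riesz_cyclic \<alpha> (\<lambda>x. a * f x + c * g x) x = a * riesz_cyclic \<alpha> f x + c * riesz_cyclic \<alpha> g x"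
    by (simp add: riesz_cyclic_def sum_distrib_left sum.distrib algebra_simps)
qed

text \<open>Summation over \<open>x\<close> picks out frequency \<open>0\<close>, where every symbol
  vanishes. Hence the mean zero functions form an invariant subspace.\<close>

lemma riesz_cyclic_mean_zero:
  fixes f :: "'m::nontriv mod_ring ^ 'n::finite \<Rightarrow> real"
  shows "(\<Sum>x\<in>UNIV. riesz_cyclic \<alpha> f x) = 0"
proof -
  let ?M = "of_nat (CARD('m) ^ CARD('n)) :: complex"
  have "(\<Sum>x\<in>UNIV. riesz2_cyclic i f x) = 0" for i
  proof -
    have "(\<Sum>x\<in>UNIV. char_cyclic x \<xi>) = (if \<xi> = 0 then ?M else 0)" for \<xi> :: "'m mod_ring ^ 'n"
    proof -
      have "char_cyclic x \<xi> = char_cyclic \<xi> x * cnj (char_cyclic 0 x)" for x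
        by (simp add: char_cyclic_def mult_ac)
      thus ?thesis by (simp only: char_cyclic_orthogonal)
    qed
    hence "of_real (symbol_cyclic i \<xi>) * fourier_cyclic f \<xi> * (\<Sum>x\<in>UNIV. char_cyclic x \<xi>) = 0" for \<xi>
      by (cases "\<xi> = 0") (auto simp: symbol_cyclic_def)
    hence "(\<Sum>\<xi>\<in>UNIV. \<Sum>x\<in>UNIV. of_real (symbol_cyclic i \<xi>) * fourier_cyclic f \<xi> * char_cyclic x \<xi>) = 0"
      by (simp only: sum_distrib_left[symmetric]) simp
    hence "(\<Sum>x\<in>UNIV. \<Sum>\<xi>\<in>UNIV. of_real (symbol_cyclic i \<xi>) * fourier_cyclic f \<xi> * char_cyclic x \<xi>) = 0"
      by (subst sum.swap)
    hence "(\<Sum>x\<in>UNIV. (\<Sum>\<xi>\<in>UNIV. of_real (symbol_cyclic i \<xi>) * fourier_cyclic f \<xi> * char_cyclic x \<xi>) / ?M) = 0"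
      by (simp only: sum_divide_distrib[symmetric] div_0)
    thus ?thesis unfolding riesz2_cyclic_def Re_sum[symmetric] by (simp only: zero_complex.sel)
  qed
  thus ?thesis unfolding riesz_cyclic_def by (subst sum.swap) (simp add: sum_distrib_left[symmetric])
qed

theorem theorem2:
  fixes \<alpha> :: "real ^ 'n" and p b B :: real
    and R_int :: "(int ^ 'n \<Rightarrow> real) \<Rightarrow> int ^ 'n \<Rightarrow> real"
    and R_cyc :: "('m::nontriv mod_ring ^ 'n \<Rightarrow> real) \<Rightarrow> 'm mod_ring ^ 'n \<Rightarrow> real"
  assumes "1 < p"
    and "b = (MIN i. \<alpha> $ i)" and "B = (MAX i. \<alpha> $ i)"
    and "R_int = riesz_int p \<alpha>" and "R_cyc = riesz_cyclic \<alpha>"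
  shows "lp_bounded_linear (lp p) p R_int \<and>
         lp_onorm (lp p) p R_int \<le> choi_const b B p \<and>
         (\<forall>C < choi_const b B p. \<not> lp_onorm (lp p) p R_int \<le> C) \<and>
         lp_bounded_linear (lp p) p R_cyc \<and>
         lp_bounded_linear (lp_mean_zero p) p R_cyc \<and>
         lp_onorm (lp_mean_zero p) p R_cyc \<le> choi_const b B p \<and>
         (b \<le> 0 \<and> 0 \<le> B \<longrightarrow> lp_onorm (lp p) p R_cyc \<le> choi_const b B p)"
proof -
  note p = assms(1)
  let ?C = "choi_const b B p"
  have C: "0 \<le> ?C" by (rule choi_const_nonneg[OF p])
  have \<alpha>: "\<alpha> $ i \<in> {b..B}" for i unfolding assms by simp
  have bB: "b \<le> B" using \<alpha>[of undefined] by simp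
  have "b \<in> range (($) \<alpha>)" "B \<in> range (($) \<alpha>)" unfolding assms by (intro Min_in Max_in; simp)+
  then obtain i j where ij: "\<alpha> $ i = b" "\<alpha> $ j = B" by auto
  note ext = p C riesz_finite_linear riesz_finite_bound[OF p \<alpha>]
  have bl: "lp_bounded_linear (lp p) p R_int"
    unfolding assms riesz_int_eq by (rule lp_extension_bounded_linear[OF ext[unfolded assms]])
  have le: "lp_norm p (R_int f) \<le> ?C * lp_norm p f" if "f \<in> lp p" for f
    unfolding assms(4) riesz_int_eq by (rule lp_extension_limit(2)[OF ext that])
  have zero: "(\<lambda>_. 0) \<in> lp p" by (rule Lp_zero)
  have sharp: "?C \<le> lp_onorm (lp p) p R_int"
  proof (rule choi_const_le_of_lattice[OF p _ ij])
    show "0 \<le> lp_onorm (lp p) p R_int" by (rule le_lp_onorm(1)[OF C le zero])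
    show "\<forall>l. \<alpha> $ l = b" if "b = B" using \<alpha> that by (auto intro: antisym)
    fix u :: "int ^ 'n \<Rightarrow> real" assume u: "finsupp u"
    let ?v = "\<lambda>n. - laplacian u n"
    have v: "finsupp ?v" using finsupp_laplacian[OF u] by (simp add: finsupp_def)
    have "R_int ?v = riesz_finite \<alpha> ?v"
      unfolding assms(4) riesz_int_eq by (rule lp_extension_finsupp[OF ext v])
    also have "\<dots> = (\<lambda>n. \<Sum>l\<in>UNIV. \<alpha> $ l * deriv_plus l (deriv_minus l u) n)"
      using riesz_finite_laplacian[OF u] by blast
    finally have "R_int ?v = (\<lambda>n. \<Sum>l\<in>UNIV. \<alpha> $ l * deriv_plus l (deriv_minus l u) n)" .
    moreover have "lp_norm p ?v = lp_norm p (laplacian u)" by (simp add: Lp_norm_def)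
    ultimately show "lp_norm p (\<lambda>n. \<Sum>l\<in>UNIV. \<alpha> $ l * deriv_plus l (deriv_minus l u) n) \<le>
        lp_onorm (lp p) p R_int * lp_norm p (laplacian u)"
      using le_lp_onorm(2)[OF C le finsupp_lp[OF v]] by simp
  qed
  have cyc_lin: "R_cyc (\<lambda>x. a * f x + c * g x) = (\<lambda>x. a * R_cyc f x + c * R_cyc g x)" for a c f g
    unfolding assms by (rule riesz_cyclic_linear)
  \<comment> \<open>Boundedness on the whole space for arbitrary signs of \<open>b\<close> and
    \<open>B\<close>: the interval is enlarged to contain \<open>0\<close>, which admits the initial
    multiplier \<open>0\<close>.\<close>
  have bounded: "lp_norm p (R_cyc f) \<le> choi_const (min b 0) (max B 0) p * lp_norm p f" for f
    unfolding assms(5)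
  proof (rule riesz_cyclic_bound[OF p, where t = 0])
    show "\<alpha> $ i \<in> {min b 0..max B 0}" for i using \<alpha>[of i] by auto
  qed auto
  have cyc_zero: "lp_norm p (R_cyc f) \<le> ?C * lp_norm p f" if "b \<le> 0" "0 \<le> B" for f
    unfolding assms(5) by (rule riesz_cyclic_bound[OF p \<alpha>, where t = 0]) (use that in auto)
  have cyc_mean: "lp_norm p (R_cyc f) \<le> ?C * lp_norm p f" if "f \<in> lp_mean_zero p" for f
    unfolding assms(5) by (rule riesz_cyclic_bound[OF p \<alpha>, where t = b]) (use that bB in \<open>auto simp: lp_mean_zero_def\<close>)
  have lin: "lp_bounded_linear V p R_cyc" if "\<And>f. f \<in> V \<Longrightarrow> R_cyc f \<in> V" for V
    unfolding lp_bounded_linear_def using that cyc_lin bounded by blast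
  have "lp_bounded_linear (lp p) p R_cyc" by (rule lin) (rule lp_finite)
  moreover have "lp_bounded_linear (lp_mean_zero p) p R_cyc"
    by (rule lin) (simp add: lp_mean_zero_def lp_finite assms(5) riesz_cyclic_mean_zero)
  moreover have "lp_onorm (lp_mean_zero p) p R_cyc \<le> ?C"
  proof (rule lp_onorm_le[OF _ C cyc_mean])
    have "(\<lambda>_. 0) \<in> lp_mean_zero p" by (simp add: lp_mean_zero_def Lp_zero)
    thus "lp_mean_zero p \<noteq> {}" by blast
  qed
  moreover have "lp_onorm (lp p) p R_cyc \<le> ?C" if "b \<le> 0" "0 \<le> B"
    by (rule lp_onorm_le[OF _ C cyc_zero[OF that]]) (use Lp_zero in blast)
  moreover have "lp_onorm (lp p) p R_int \<le> ?C"
    by (rule lp_onorm_le[OF _ C le]) (use zero in blast)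
  ultimately show ?thesis using bl sharp by force
qed

end
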